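(* In the vector Gaussian setting described in the context, the rate-distortion function satisfies $R^{MSE}(\mathbf{D})\le R^G_{ach}(\mathbf{D})=\min_{v\in\mathcal{V}}\inf_{p\in C^G_{ach,v}(\mathbf{D})}\inf_{C^{LP}_{ach}(p)}\sum_{j=1}^{2^m-1}R_{\mathcal{S}_j}$, where $C^G_{ach,v}(\mathbf{D})$ is the set of joint distributions $p$ of $(\mathbf{U}_{\mathcal{S}_1},\dots,\mathbf{U}_{\mathcal{S}_{2^m-1}},\mathbf{X},\mathbf{Y_1},\dots,\mathbf{Y_m})$ such that: (1) the marginal of $(\mathbf{X},\mathbf{Y_1},\dots,\mathbf{Y_m})$ is the given Gaussian distribution; (2) there is a random variable $T$ taking values in $[\tau]$ for some positive integer $\tau$, with $T$ independent of $(\mathbf{X},\mathbf{Y_1},\dots,\mathbf{Y_m})$; (3) $\mathcal{U}\leftrightarrow\mathbf{X}\leftrightarrow(\mathbf{Y_1},\dots,\mathbf{Y_m})$; (4) for each $i\in[m]$ the vector of diagonal entries of the conditional (MMSE error) covariance matrix $K_{\mathbf{X}|\mathbf{U}_{\mathcal{D}_i},\mathbf{Y_i}}$ is componentwise at most $\mathbf{D_i}$; (5) each $\mathbf{U}_{\mathcal{S}_j}=(\mathbf{U}_{\mathcal{S}_j,T},T)$, where for each $t$ the vectors $\mathbf{U}_{\mathcal{S}_j,t}$ are jointly Gaussian with $(\mathbf{X},\mathbf{Y_1},\dots,\mathbf{Y_m})$, and $I(\mathbf{U}_{\mathcal{S}_j};\mathbf{U}_{\mathcal{S}_i},\mathbf{X})<\infty$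 for all $i\ne j$. Here $C^{LP}_{ach}(p)$ is the set of nonnegative $R_{\mathcal{S}_j},R'_{\mathcal{S}_j}$ with $R_{\mathcal{S}_j}\ge I(\mathbf{X},\mathbf{U}^-_{\mathcal{S}_j};\mathbf{U}_{\mathcal{S}_j})-R'_{\mathcal{S}_j}$ for all $j$ and, for every $l\in[m]$ and every nonempty $\mathcal{D}'_l\subseteq\mathcal{D}_l$, $$\sum_{\mathcal{S}_j\in\mathcal{D}'_l}R'_{\mathcal{S}_j}\le\sum_{\mathcal{S}_j\in\mathcal{D}'_l}I\big(\mathbf{U}_{\mathcal{S}_j};\mathbf{U}^-_{\mathcal{S}_j,\mathcal{D}'_l},\mathbf{U}_{\mathcal{D}_l\setminus\mathcal{D}'_l},\mathbf{Y_l}\big).$$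
   Context: Setting: $(\mathbf{X},\mathbf{Y_1},\dots,\mathbf{Y_m})$ are zero-mean jointly Gaussian vectors ($\mathbf{X}\in\mathbb{R}^k$, $\mathbf{Y_i}\in\mathbb{R}^{k_i}$) with a given joint distribution; the blocks are i.i.d. over time. An $(n,M,\mathbf{D})$ code (with $\mathbf{D}=(\mathbf{D_1},\dots,\mathbf{D_m})$, each $\mathbf{D_i}\in(0,\infty)^k$) is an encoder $f:(\mathbb{R}^k)^n\to\{1,\dots,M\}$ and decoders $g_i$ mapping $(f(\mathbf{X}^n),\mathbf{Y_i}^n)$ to reconstructions $\widehat{\mathbf{X}}_{i1},\dots,\widehat{\mathbf{X}}_{in}\in\mathbb{R}^k$ such that the diagonal of $\frac1n\sum_{k=1}^nE[(\mathbf{X}_k-\widehat{\mathbf{X}}_{ik})(\mathbf{X}_k-\widehat{\mathbf{X}}_{ik})^T]$ is componentwise $\le\mathbf{D_i}$ for each $i$. A rate $R$ is $\mathbf{D}$-achievable if for every $\epsilon>0$ and all large $n$ there is an $(n,M,\mathbf{D}+\epsilon\mathbf{1})$ code with $\frac1n\log M\le R+\epsilon$; $R^{MSE}(\mathbf{D})$ is the infimum of achievable rates. Notation: $\mathcal{V}$ is the set of orderings $v=(\mathcal{S}_1,\dots,\mathcal{S}_{2^m-1})$ of the nonempty subsets of $[m]$; $\mathcal{U}=\{\mathbf{U}_{\mathcal{S}_1},\dots,\mathbf{U}_{\mathcal{S}_{2^m-1}}\}$; $\mathcal{D}_l=\{\mathcal{S}_i:l\in\mathcal{S}_i\}$; $\mathbf{U}_{\mathcal{D}'}=\{\mathbf{U}_{\mathcal{S}_i}:\mathcal{S}_i\in\mathcal{D}'\}$;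 $\mathbf{U}^-_{\mathcal{S}_j}=\{\mathbf{U}_{\mathcal{S}_i}:i<j\}$; $\mathbf{U}^-_{\mathcal{S}_j,\mathcal{D}'_l}=\{\mathbf{U}_{\mathcal{S}_i}: i<j,\ \mathcal{S}_i\in\mathcal{D}'_l\}$. *)

theory Defs
  imports "HOL-Probability.Probability"
begin

text \<open>A vector in R^d is represented as an extensional function on the
index set {..<d}; its measurable space is the finite product of Borel sets.\<close>

definition vecM :: "nat \<Rightarrow> (nat \<Rightarrow> real) measure" where
  "vecM d = PiM {..<d} (\<lambda>_. borel)"

text \<open>(Y_1,...,Y_m), indexed 0..m-1, Y_i in R^(kY i).\<close>
definition YM :: "nat \<Rightarrow> (nat \<Rightarrow> nat) \<Rightarrow> (nat \<Rightarrow> nat \<Rightarrow> real) measure" where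
  "YM m kY = PiM {..<m} (\<lambda>i. vecM (kY i))"

definition XYM :: "nat \<Rightarrow> nat \<Rightarrow> (nat \<Rightarrow> nat) \<Rightarrow> ((nat \<Rightarrow> real) \<times> (nat \<Rightarrow> nat \<Rightarrow> real)) measure" where
  "XYM m k kY = vecM k \<Otimes>\<^sub>M YM m kY"

definition gauss_rv :: "'a measure \<Rightarrow> ('a \<Rightarrow> real) \<Rightarrow> bool" where
  "gauss_rv M W \<longleftrightarrow> W \<in> borel_measurable M \<and>
     (\<exists>\<mu>. (AE \<omega> in M. W \<omega> = \<mu>) \<or>
          (\<exists>\<sigma>>0. distributed M lborel W (normal_density \<mu> \<sigma>)))"

definition jgauss :: "'a measure \<Rightarrow> 'i set \<Rightarrow> ('i \<Rightarrow> 'a \<Rightarrow> real) \<Rightarrow> bool" where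
  "jgauss M I Z \<longleftrightarrow> finite I \<and> (\<forall>i\<in>I. Z i \<in> borel_measurable M) \<and>
     (\<forall>c :: 'i \<Rightarrow> real. gauss_rv M (\<lambda>\<omega>. \<Sum>i\<in>I. c i * Z i \<omega>))"

text \<open>Scalar coordinates: of U_{S,t}, of X, of Y_i.\<close>
datatype coord = UC "nat set" nat | XC nat | YC nat nat

definition source_coords :: "nat \<Rightarrow> nat \<Rightarrow> (nat \<Rightarrow> nat) \<Rightarrow> coord set" where
  "source_coords m k kY = XC ` {..<k} \<union> (\<Union>i<m. YC i ` {..<kY i})"

fun source_val :: "coord \<Rightarrow> (nat \<Rightarrow> real) \<times> (nat \<Rightarrow> nat \<Rightarrow> real) \<Rightarrow> real" where
  "source_val (XC c) z = fst z c"
| "source_val (YC i c) z = snd z i c"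
| "source_val (UC S c) z = 0"

definition gaussian_source :: "nat \<Rightarrow> nat \<Rightarrow> (nat \<Rightarrow> nat) \<Rightarrow>
    ((nat \<Rightarrow> real) \<times> (nat \<Rightarrow> nat \<Rightarrow> real)) measure \<Rightarrow> bool" where
  "gaussian_source m k kY P \<longleftrightarrow> prob_space P \<and> sets P = sets (XYM m k kY) \<and>
     jgauss P (source_coords m k kY) source_val \<and>
     (\<forall>j\<in>source_coords m k kY. integral\<^sup>L P (source_val j) = 0)"

text \<open>An (n,M,D) code. The n-block source is the product of n copies of P
(i.i.d. blocks). f encodes the X-block into {1..M}; g i decodes from the index
and the Y_i-block, producing g i w ys t c = c-th component of hat X_{i,t}.
Distortion: (1/n) sum_t E[(X_t c - hat X_{i t} c)^2] <= D i c.\<close>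
definition is_code :: "nat \<Rightarrow> nat \<Rightarrow> (nat \<Rightarrow> nat) \<Rightarrow>
    ((nat \<Rightarrow> real) \<times> (nat \<Rightarrow> nat \<Rightarrow> real)) measure \<Rightarrow> nat \<Rightarrow> nat \<Rightarrow>
    (nat \<Rightarrow> nat \<Rightarrow> real) \<Rightarrow> ((nat \<Rightarrow> nat \<Rightarrow> real) \<Rightarrow> nat) \<Rightarrow>
    (nat \<Rightarrow> nat \<Rightarrow> (nat \<Rightarrow> nat \<Rightarrow> real) \<Rightarrow> nat \<Rightarrow> nat \<Rightarrow> real) \<Rightarrow> bool" where
  "is_code m k kY P n M D f g \<longleftrightarrow>
     f \<in> measurable (PiM {..<n} (\<lambda>_. vecM k)) (count_space UNIV) \<and>
     (\<forall>xs\<in>space (PiM {..<n} (\<lambda>_. vecM k)). f xs \<in> {1..M}) \<and>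
     (\<forall>i<m. \<forall>t<n. \<forall>c<k. (\<lambda>p. g i (fst p) (snd p) t c) \<in>
        borel_measurable (count_space UNIV \<Otimes>\<^sub>M PiM {..<n} (\<lambda>_. vecM (kY i)))) \<and>
     (\<forall>i<m. \<forall>c<k.
        ennreal (1 / real n) *
          (\<Sum>t<n. \<integral>\<^sup>+\<omega>. ennreal ((fst (\<omega> t) c -
              g i (f (\<lambda>s\<in>{..<n}. fst (\<omega> s))) (\<lambda>s\<in>{..<n}. snd (\<omega> s) i) t c)\<^sup>2)
            \<partial>(PiM {..<n} (\<lambda>_. P)))
        \<le> ennreal (D i c))"

definition mse_achievable :: "nat \<Rightarrow> nat \<Rightarrow> (nat \<Rightarrow> nat) \<Rightarrow>
    ((nat \<Rightarrow> real) \<times> (nat \<Rightarrow> nat \<Rightarrow> real)) measure \<Rightarrow> (nat \<Rightarrow> nat \<Rightarrow> real) \<Rightarrow> real \<Rightarrow> bool" where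
  "mse_achievable m k kY P D R \<longleftrightarrow>
     (\<forall>\<epsilon>>0. \<exists>N. \<forall>n\<ge>N. \<exists>M f g. n > 0 \<and>
        is_code m k kY P n M (\<lambda>i c. D i c + \<epsilon>) f g \<and> ln (real M) / real n \<le> R + \<epsilon>)"

definition R_MSE :: "nat \<Rightarrow> nat \<Rightarrow> (nat \<Rightarrow> nat) \<Rightarrow>
    ((nat \<Rightarrow> real) \<times> (nat \<Rightarrow> nat \<Rightarrow> real)) measure \<Rightarrow> (nat \<Rightarrow> nat \<Rightarrow> real) \<Rightarrow> ereal" where
  "R_MSE m k kY P D = Inf {ereal R | R. mse_achievable m k kY P D R}"

text \<open>Mutual information (in nats) as the KL divergence of the joint law from
the product of the marginals, with value infinity if the joint law is not
absolutely continuous. Uses D(J||Q) = int (f ln f - f + 1) dQ, f = dJ/dQ.\<close>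
definition mutual_info :: "'a measure \<Rightarrow> 'b measure \<Rightarrow> 'c measure \<Rightarrow>
    ('a \<Rightarrow> 'b) \<Rightarrow> ('a \<Rightarrow> 'c) \<Rightarrow> ereal" where
  "mutual_info M SA SB A B =
     (let J = distr M (SA \<Otimes>\<^sub>M SB) (\<lambda>\<omega>. (A \<omega>, B \<omega>));
          Q = distr M SA A \<Otimes>\<^sub>M distr M SB B
      in if absolutely_continuous Q J
         then enn2ereal (\<integral>\<^sup>+z. ennreal (let f = enn2real (RN_deriv Q J z) in f * ln f - f + 1) \<partial>Q)
         else \<infinity>)"

definition markov_chain :: "'a measure \<Rightarrow> 'u measure \<Rightarrow> ('a \<Rightarrow> 'u) \<Rightarrow>
    'x measure \<Rightarrow> ('a \<Rightarrow> 'x) \<Rightarrow> 'y measure \<Rightarrow> ('a \<Rightarrow> 'y) \<Rightarrow> bool" where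
  "markov_chain M SU U SX X SY Y \<longleftrightarrow>
     (\<forall>A\<in>sets SU. \<forall>B\<in>sets SY. AE \<omega> in M.
        real_cond_exp M (vimage_algebra (space M) X SX)
          (indicator {\<omega>\<in>space M. U \<omega> \<in> A \<and> Y \<omega> \<in> B}) \<omega> =
        real_cond_exp M (vimage_algebra (space M) X SX) (indicator {\<omega>\<in>space M. U \<omega> \<in> A}) \<omega> *
        real_cond_exp M (vimage_algebra (space M) X SX) (indicator {\<omega>\<in>space M. Y \<omega> \<in> B}) \<omega>)"

text \<open>Canonical sample space carrying the family U_{S,t}, the time-sharing
variable T, X and (Y_1,...,Y_m).\<close>
type_synonym omega = "(nat set \<Rightarrow> nat \<Rightarrow> nat \<Rightarrow> real) \<times> nat \<times> (nat \<Rightarrow> real) \<times> (nat \<Rightarrow> nat \<Rightarrow> real)"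

definition subsets :: "nat \<Rightarrow> nat set set" where
  "subsets m = {S. S \<subseteq> {..<m} \<and> S \<noteq> {}}"

definition orderings :: "nat \<Rightarrow> nat set list set" where
  "orderings m = {vs. distinct vs \<and> set vs = subsets m}"

definition Dl :: "nat \<Rightarrow> nat \<Rightarrow> nat set set" where
  "Dl m l = {S\<in>subsets m. l \<in> S}"

definition before :: "nat set list \<Rightarrow> nat set \<Rightarrow> nat set set" where
  "before vs S = {S'. \<exists>i j. i < j \<and> j < length vs \<and> vs ! i = S' \<and> vs ! j = S}"

text \<open>Value space of U_S = (U_{S,T}, T) when U_{S,t} is in R^d.\<close>
definition UM :: "nat \<Rightarrow> ((nat \<Rightarrow> real) \<times> nat) measure" where
  "UM d = vecM d \<Otimes>\<^sub>M count_space UNIV"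

definition Uval :: "(nat set \<Rightarrow> nat \<Rightarrow> 'a \<Rightarrow> nat \<Rightarrow> real) \<Rightarrow> ('a \<Rightarrow> nat) \<Rightarrow> nat set \<Rightarrow>
    'a \<Rightarrow> (nat \<Rightarrow> real) \<times> nat" where
  "Uval Uf T S \<omega> = (Uf S (T \<omega>) \<omega>, T \<omega>)"

definition Ucoll :: "(nat set \<Rightarrow> nat \<Rightarrow> 'a \<Rightarrow> nat \<Rightarrow> real) \<Rightarrow> ('a \<Rightarrow> nat) \<Rightarrow> nat set set \<Rightarrow>
    'a \<Rightarrow> nat set \<Rightarrow> (nat \<Rightarrow> real) \<times> nat" where
  "Ucoll Uf T A \<omega> = (\<lambda>S\<in>A. Uval Uf T S \<omega>)"

definition UcollM :: "(nat set \<Rightarrow> nat) \<Rightarrow> nat set set \<Rightarrow> (nat set \<Rightarrow> (nat \<Rightarrow> real) \<times> nat) measure" where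
  "UcollM dU A = PiM A (\<lambda>S. UM (dU S))"

text \<open>Membership of the joint distribution of (U, X, Y) in C^G_{ach}(D),
given by a realization on the canonical sample space. dU S is the dimension
of U_{S,t}.\<close>
definition CG :: "nat \<Rightarrow> nat \<Rightarrow> (nat \<Rightarrow> nat) \<Rightarrow>
    ((nat \<Rightarrow> real) \<times> (nat \<Rightarrow> nat \<Rightarrow> real)) measure \<Rightarrow> (nat \<Rightarrow> nat \<Rightarrow> real) \<Rightarrow>
    omega measure \<Rightarrow> (omega \<Rightarrow> nat \<Rightarrow> real) \<Rightarrow> (omega \<Rightarrow> nat \<Rightarrow> nat \<Rightarrow> real) \<Rightarrow>
    (omega \<Rightarrow> nat) \<Rightarrow> nat \<Rightarrow> (nat set \<Rightarrow> nat) \<Rightarrow> (nat set \<Rightarrow> nat \<Rightarrow> omega \<Rightarrow> nat \<Rightarrow> real) \<Rightarrow> bool" where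
  "CG m k kY P D M X Y T \<tau> dU Uf \<longleftrightarrow>
     prob_space M \<and>
     X \<in> measurable M (vecM k) \<and> Y \<in> measurable M (YM m kY) \<and>
     \<comment> \<open>(1) marginal of (X,Y) is the given Gaussian law\<close>
     distr M (XYM m k kY) (\<lambda>\<omega>. (X \<omega>, Y \<omega>)) = P \<and>
     \<comment> \<open>(2) time sharing variable T in [tau], independent of (X,Y)\<close>
     \<tau> > 0 \<and> T \<in> measurable M (count_space UNIV) \<and> (\<forall>\<omega>\<in>space M. T \<omega> \<in> {1..\<tau>}) \<and>
     (\<forall>A B. B \<in> sets (XYM m k kY) \<longrightarrow>
        measure M {\<omega>\<in>space M. T \<omega> \<in> A \<and> (X \<omega>, Y \<omega>) \<in> B} =
        measure M {\<omega>\<in>space M. T \<omega> \<in> A} * measure M {\<omega>\<in>space M. (X \<omega>, Y \<omega>) \<in> B}) \<and>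
     (\<forall>S\<in>subsets m. \<forall>t\<in>{1..\<tau>}. Uf S t \<in> measurable M (vecM (dU S))) \<and>
     \<comment> \<open>(3) Markov chain U -- X -- (Y_1,...,Y_m)\<close>
     markov_chain M (UcollM dU (subsets m)) (Ucoll Uf T (subsets m)) (vecM k) X (YM m kY) Y \<and>
     \<comment> \<open>(4) diagonal of the MMSE error covariance of X given (U_{D_i}, Y_i)\<close>
     (\<forall>i<m. \<forall>c<k.
        (\<integral>\<^sup>+\<omega>. ennreal ((X \<omega> c -
            real_cond_exp M
              (vimage_algebra (space M) (\<lambda>\<omega>. (Ucoll Uf T (Dl m i) \<omega>, Y \<omega> i))
                 (UcollM dU (Dl m i) \<Otimes>\<^sub>M vecM (kY i)))
              (\<lambda>\<omega>. X \<omega> c) \<omega>)\<^sup>2) \<partial>M)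
        \<le> ennreal (D i c)) \<and>
     \<comment> \<open>(5) for each t, the U_{S,t} are jointly Gaussian with (X,Y)\<close>
     (\<forall>t\<in>{1..\<tau>}. jgauss M ((\<Union>S\<in>subsets m. UC S ` {..<dU S}) \<union> source_coords m k kY)
        (\<lambda>j \<omega>. case j of UC S c \<Rightarrow> Uf S t \<omega> c | XC c \<Rightarrow> X \<omega> c | YC i c \<Rightarrow> Y \<omega> i c)) \<and>
     (\<forall>S\<in>subsets m. \<forall>S'\<in>subsets m. S \<noteq> S' \<longrightarrow>
        mutual_info M (UM (dU S)) (UM (dU S') \<Otimes>\<^sub>M vecM k)
          (Uval Uf T S) (\<lambda>\<omega>. (Uval Uf T S' \<omega>, X \<omega>)) < \<infinity>)"

definition LP :: "nat \<Rightarrow> nat \<Rightarrow> (nat \<Rightarrow> nat) \<Rightarrow> nat set list \<Rightarrow>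
    omega measure \<Rightarrow> (omega \<Rightarrow> nat \<Rightarrow> real) \<Rightarrow> (omega \<Rightarrow> nat \<Rightarrow> nat \<Rightarrow> real) \<Rightarrow>
    (omega \<Rightarrow> nat) \<Rightarrow> (nat set \<Rightarrow> nat) \<Rightarrow> (nat set \<Rightarrow> nat \<Rightarrow> omega \<Rightarrow> nat \<Rightarrow> real) \<Rightarrow>
    (nat set \<Rightarrow> real) \<Rightarrow> (nat set \<Rightarrow> real) \<Rightarrow> bool" where
  "LP m k kY vs M X Y T dU Uf R R' \<longleftrightarrow>
     (\<forall>S\<in>subsets m. R S \<ge> 0 \<and> R' S \<ge> 0) \<and>
     (\<forall>S\<in>subsets m. ereal (R S) \<ge>
        mutual_info M (vecM k \<Otimes>\<^sub>M UcollM dU (before vs S)) (UM (dU S))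
          (\<lambda>\<omega>. (X \<omega>, Ucoll Uf T (before vs S) \<omega>)) (Uval Uf T S) - ereal (R' S)) \<and>
     (\<forall>l<m. \<forall>D'. D' \<subseteq> Dl m l \<and> D' \<noteq> {} \<longrightarrow>
        ereal (\<Sum>S\<in>D'. R' S) \<le>
        (\<Sum>S\<in>D'. mutual_info M (UM (dU S))
            (UcollM dU (before vs S \<inter> D') \<Otimes>\<^sub>M UcollM dU (Dl m l - D') \<Otimes>\<^sub>M vecM (kY l))
            (Uval Uf T S)
            (\<lambda>\<omega>. (Ucoll Uf T (before vs S \<inter> D') \<omega>, Ucoll Uf T (Dl m l - D') \<omega>, Y \<omega> l))))"

definition R_G_ach :: "nat \<Rightarrow> nat \<Rightarrow> (nat \<Rightarrow> nat) \<Rightarrow>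
    ((nat \<Rightarrow> real) \<times> (nat \<Rightarrow> nat \<Rightarrow> real)) measure \<Rightarrow> (nat \<Rightarrow> nat \<Rightarrow> real) \<Rightarrow> ereal" where
  "R_G_ach m k kY P D =
     (INF vs\<in>orderings m.
        \<Sqinter> {\<Sqinter> {ereal (\<Sum>S\<in>subsets m. R S) | R R'. LP m k kY vs M X Y T dU Uf R R'}
           | M X Y T \<tau> dU Uf. CG m k kY P D M X Y T \<tau> dU Uf})"

end

theory Submission
  imports Defs "HOL-Real_Asymp.Real_Asymp"
begin

text \<open>
  For each subset \<open>S\<close> a codebook of \<open>exp (n (R S + R' S))\<close> words is drawn i.i.d. from the law of
  \<open>U\<^sub>S\<close> and split into \<open>exp (n R S)\<close> bins; the encoder picks one word per codebook and sends the
  bin indices, and decoder \<open>l\<close> looks for the unique jointly typical tuple of words in the bins of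
  the sets containing \<open>l\<close>.

  Encoding. Let \<open>\<rho> S\<close> be the density of \<open>((X, U before S), U\<^sub>S)\<close> with respect to the product of its marginals;
  the product of all \<open>\<rho> S\<close> is the density of \<open>((X, Y), U)\<close> with respect to the product of
  the source law and the laws of the \<open>U\<^sub>S\<close> (chain rule and Markov property). A second moment
  computation shows that the average of this product over all tuples of codewords, restricted to tuples
  where each \<open>\<rho> S\<close> is not too large, concentrates at 1. Hence the randomized encoder
  choosing a tuple with probability proportional to its weight behaves, up to a factor 2, as if the
  chosen codewords and the source were drawn from the true joint law, and minimizing the conditional
  failure probability makes the encoder deterministic.

  Decoding. Typicality is a lower bound on products of densities, so the probability that a wrong
  tuple is typical is bounded by Markov's inequality; the required integral factorizes over time and
  is at most 1 by integrating out one codeword at a time.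

  Distortion. The conditional expectations are clipped, the average distortion is made part of
  typicality, and the failure event is handled by uniform integrability of \<open>X\<close> squared. Gaussianity is
  used only for the second moments of \<open>X\<close>.
\<close>

section \<open>Finite sums, integrals and product measures\<close>

lemma sum_PiE_prod_if_eq:
  fixes e d :: "'s \<Rightarrow> real"
  assumes finite_V: "finite V" and finite_I: "\<And>S. S \<in> V \<Longrightarrow> finite (I S)" and j_in: "\<And>S. S \<in> V \<Longrightarrow> j S \<in> I S"
  shows "(\<Sum>i\<in>PiE V I. \<Prod>S\<in>V. if i S = j S then e S else d S)
    = (\<Prod>S\<in>V. e S + (real (card (I S)) - 1) * d S)"
proof -
  have "(\<Sum>i\<in>PiE V I. \<Prod>S\<in>V. if i S = j S then e S else d S)
    = (\<Prod>S\<in>V. \<Sum>i\<in>I S. if i = j S then e S else d S)"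
    by (rule prod_sum_PiE[symmetric]) (use finite_V finite_I in auto)
  also have "\<dots> = (\<Prod>S\<in>V. e S + (real (card (I S)) - 1) * d S)"
  proof (rule prod.cong[OF refl])
    fix S assume S_in: "S \<in> V"
    have "(\<Sum>i\<in>I S. if i = j S then e S else d S) = e S + (\<Sum>i\<in>I S - {j S}. if i = j S then e S else d S)"
      by (subst sum.remove[OF finite_I[OF S_in] j_in[OF S_in]]) simp
    also have "(\<Sum>i\<in>I S - {j S}. if i = j S then e S else d S) = (\<Sum>i\<in>I S - {j S}. d S)"
      by (intro sum.cong) auto
    also have "\<dots> = (real (card (I S)) - 1) * d S"
      using finite_I[OF S_in] j_in[OF S_in] card_gt_0_iff[of "I S"] by (auto simp: of_nat_diff)
    finally show "(\<Sum>i\<in>I S. if i = j S then e S else d S) = e S + (real (card (I S)) - 1) * d S" .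
  qed
  finally show ?thesis .
qed

lemma nn_integral_of_bool:
  assumes [measurable]: "Measurable.pred M Q"
  shows "(\<integral>\<^sup>+z. of_bool (Q z) \<partial>M) = emeasure M {z\<in>space M. Q z}"
proof -
  have "(\<integral>\<^sup>+z. of_bool (Q z) \<partial>M) = (\<integral>\<^sup>+z. indicator {z\<in>space M. Q z} z \<partial>M)"
    by (intro nn_integral_cong) (auto simp: indicator_def)
  then show ?thesis by simp
qed

lemma prob_space_nn_integral_less:
  assumes "prob_space M" "(\<integral>\<^sup>+x. f x \<partial>M) < e"
  shows "\<exists>x\<in>space M. f x < e"
proof (rule ccontr)
  interpret prob_space M by fact
  assume "\<not> ?thesis"
  then have "(\<integral>\<^sup>+x. e \<partial>M) \<le> (\<integral>\<^sup>+x. f x \<partial>M)" by (intro nn_integral_mono) (auto simp: not_less)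
  then show False using assms(2) by (simp add: emeasure_space_1)
qed

lemma indicator_PiE_eq_prod:
  assumes "finite K" and "z \<in> extensional K"
  shows "indicator (Pi\<^sub>E K A) z = (\<Prod>i\<in>K. indicator (A i) (z i) :: 'b::comm_semiring_1)"
proof (cases "\<forall>i\<in>K. z i \<in> A i")
  case True
  then show ?thesis using assms(2) by (simp add: indicator_def PiE_iff)
next
  case False
  then obtain i where "i \<in> K" "z i \<notin> A i" by blast
  then have "(\<Prod>i\<in>K. indicator (A i) (z i) :: 'b) = 0" and "z \<notin> Pi\<^sub>E K A"
    using assms(1) by (auto intro!: prod_zero bexI[of _ i])
  then show ?thesis by simp
qed

lemma (in product_sigma_finite) PiM_eqI_nn_integral:
  assumes finite_K: "finite K" and sets_N: "sets N = sets (PiM K M)"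
    and rect: "\<And>A. (\<And>i. i \<in> K \<Longrightarrow> A i \<in> sets (M i)) \<Longrightarrow>
      (\<integral>\<^sup>+z. (\<Prod>i\<in>K. indicator (A i) (z i)) \<partial>N) = (\<Prod>i\<in>K. emeasure (M i) (A i))"
  shows "N = PiM K M"
proof (rule PiM_eqI[OF finite_K sets_N])
  fix A assume A_sets: "\<And>i. i \<in> K \<Longrightarrow> A i \<in> sets (M i)"
  then have "Pi\<^sub>E K A \<in> sets N" unfolding sets_N by (intro sets_PiM_I_finite finite_K)
  then have "emeasure N (Pi\<^sub>E K A) = (\<integral>\<^sup>+z. indicator (Pi\<^sub>E K A) z \<partial>N)" by simp
  also have "\<dots> = (\<integral>\<^sup>+z. (\<Prod>i\<in>K. indicator (A i) (z i)) \<partial>N)"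
    using sets_eq_imp_space_eq[OF sets_N]
    by (intro nn_integral_cong indicator_PiE_eq_prod finite_K) (auto simp: space_PiM PiE_def)
  finally show "emeasure N (Pi\<^sub>E K A) = (\<Prod>i\<in>K. emeasure (M i) (A i))" using rect[OF A_sets] by simp
qed

lemma distr_pair_PiM:
  assumes prob_space_M: "\<And>i. prob_space (M i)" and prob_space_N: "\<And>i. prob_space (N i)" and finite_K: "finite K"
  shows "distr (PiM K M \<Otimes>\<^sub>M PiM K N) (PiM K (\<lambda>i. M i \<Otimes>\<^sub>M N i)) (\<lambda>z. \<lambda>i\<in>K. (fst z i, snd z i))
    = PiM K (\<lambda>i. M i \<Otimes>\<^sub>M N i)" (is "distr ?MN _ ?zip = _")
proof -
  interpret M: product_prob_space M by (rule product_prob_spaceI) (rule prob_space_M)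
  interpret N: product_prob_space N by (rule product_prob_spaceI) (rule prob_space_N)
  interpret PM: prob_space "PiM K M" by (rule prob_space_PiM) (rule prob_space_M)
  interpret PN: prob_space "PiM K N" by (rule prob_space_PiM) (rule prob_space_N)
  interpret PMN: pair_prob_space "PiM K M" "PiM K N" ..
  have pair: "pair_prob_space (M i) (N i)" for i by unfold_locales
  interpret MN: product_prob_space "\<lambda>i. M i \<Otimes>\<^sub>M N i"
    by (intro product_prob_spaceI prob_space_pair prob_space_M prob_space_N)
  show ?thesis
  proof (rule MN.PiM_eqI_nn_integral[OF finite_K])
    fix A assume A_sets: "\<And>i. i \<in> K \<Longrightarrow> A i \<in> sets (M i \<Otimes>\<^sub>M N i)"
    have factor[measurable]: "(\<lambda>z. indicator (A i) (fst z i, snd z i) :: ennreal) \<in> borel_measurable ?MN"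
      if "i \<in> K" for i using A_sets[OF that] that by measurable
    have "(\<integral>\<^sup>+z. (\<Prod>i\<in>K. indicator (A i) (z i)) \<partial>distr ?MN (PiM K (\<lambda>i. M i \<Otimes>\<^sub>M N i)) ?zip)
      = (\<integral>\<^sup>+z. (\<Prod>i\<in>K. indicator (A i) (fst z i, snd z i)) \<partial>?MN)"
      using A_sets by (subst nn_integral_distr) (auto intro!: borel_measurable_prod_ennreal)
    also have "\<dots> = (\<integral>\<^sup>+c. \<integral>\<^sup>+a. (\<Prod>i\<in>K. indicator (A i) (a i, c i)) \<partial>PiM K M \<partial>PiM K N)"
      by (subst PMN.nn_integral_snd[symmetric]) (auto intro!: borel_measurable_prod_ennreal)
    also have "\<dots> = (\<integral>\<^sup>+c. (\<Prod>i\<in>K. \<integral>\<^sup>+a. indicator (A i) (a, c i) \<partial>M i) \<partial>PiM K N)"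
      using A_sets by (intro nn_integral_cong M.product_nn_integral_prod finite_K)
        (auto simp: space_PiM PiE_iff intro!: measurable_compose[OF measurable_Pair2'])
    also have "\<dots> = (\<Prod>i\<in>K. \<integral>\<^sup>+c. \<integral>\<^sup>+a. indicator (A i) (a, c) \<partial>M i \<partial>N i)"
    proof (rule N.product_nn_integral_prod[OF finite_K])
      show "(\<lambda>c. \<integral>\<^sup>+a. indicator (A i) (a, c) \<partial>M i) \<in> borel_measurable (N i)" if "i \<in> K" for i
        using A_sets[OF that] by measurable
    qed
    also have "\<dots> = (\<Prod>i\<in>K. emeasure (M i \<Otimes>\<^sub>M N i) (A i))"
    proof (rule prod.cong[OF refl])
      fix i assume "i \<in> K"
      interpret pair_prob_space "M i" "N i" by (rule pair)
      show "(\<integral>\<^sup>+c. \<integral>\<^sup>+a. indicator (A i) (a, c) \<partial>M i \<partial>N i) = emeasure (M i \<Otimes>\<^sub>M N i) (A i)"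
        using A_sets[OF \<open>i \<in> K\<close>] by (subst nn_integral_snd) auto
    qed
    finally show "(\<integral>\<^sup>+z. (\<Prod>i\<in>K. indicator (A i) (z i)) \<partial>distr ?MN (PiM K (\<lambda>i. M i \<Otimes>\<^sub>M N i)) ?zip)
      = (\<Prod>i\<in>K. emeasure (M i \<Otimes>\<^sub>M N i) (A i))" .
  qed simp
qed

lemma PiM_density:
  assumes prob_space_M: "\<And>i. prob_space (M i)" and finite_K: "finite K"
    and w_measurable[measurable]: "\<And>i. w i \<in> borel_measurable (M i)"
    and prob_space_density: "\<And>i. prob_space (density (M i) (w i))"
  shows "PiM K (\<lambda>i. density (M i) (w i)) = density (PiM K M) (\<lambda>z. \<Prod>i\<in>K. w i (z i))"
proof -
  interpret M: product_prob_space M by (rule product_prob_spaceI) (rule prob_space_M)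
  interpret D: product_prob_space "\<lambda>i. density (M i) (w i)" by (rule product_prob_spaceI) (rule prob_space_density)
  show ?thesis
  proof (rule D.PiM_eqI_nn_integral[OF finite_K, symmetric])
    show "sets (density (PiM K M) (\<lambda>z. \<Prod>i\<in>K. w i (z i))) = sets (PiM K (\<lambda>i. density (M i) (w i)))"
      by (simp cong: sets_PiM_cong)
    fix A assume "\<And>i. i \<in> K \<Longrightarrow> A i \<in> sets (density (M i) (w i))"
    then have A_sets[measurable]: "\<And>i. i \<in> K \<Longrightarrow> A i \<in> sets (M i)" by simp
    have "(\<integral>\<^sup>+z. (\<Prod>i\<in>K. indicator (A i) (z i)) \<partial>density (PiM K M) (\<lambda>z. \<Prod>i\<in>K. w i (z i)))
      = (\<integral>\<^sup>+z. (\<Prod>i\<in>K. w i (z i) * indicator (A i) (z i)) \<partial>PiM K M)"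
      by (subst nn_integral_density) (auto simp: prod.distrib intro!: borel_measurable_prod_ennreal)
    also have "\<dots> = (\<Prod>i\<in>K. \<integral>\<^sup>+z. w i z * indicator (A i) z \<partial>M i)"
      by (rule M.product_nn_integral_prod[OF finite_K]) measurable
    also have "\<dots> = (\<Prod>i\<in>K. emeasure (density (M i) (w i)) (A i))"
      by (intro prod.cong refl emeasure_density[symmetric] A_sets) auto
    finally show "(\<integral>\<^sup>+z. (\<Prod>i\<in>K. indicator (A i) (z i)) \<partial>density (PiM K M) (\<lambda>z. \<Prod>i\<in>K. w i (z i)))
      = (\<Prod>i\<in>K. emeasure (density (M i) (w i)) (A i))" .
  qed
qed

lemma measurable_PiM_fun_upd:
  assumes "k \<in> K" and "c \<in> space (PiM K M)"
  shows "(\<lambda>v. c(k := v)) \<in> measurable (M k) (PiM K M)"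
  using assms by (intro measurable_fun_upd[where J=K]) auto

lemma nn_integral_PiM_fun_upd:
  assumes prob_space_q: "\<And>i. prob_space (q i)" and K_finite: "finite K" "k \<in> K"
    and F_measurable[measurable]: "F \<in> borel_measurable (PiM K q)"
  shows "(\<integral>\<^sup>+c. F c \<partial>PiM K q) = (\<integral>\<^sup>+c. \<integral>\<^sup>+v. F (c(k := v)) \<partial>q k \<partial>PiM K q)"
proof -
  interpret q: product_prob_space q by (rule product_prob_spaceI) (rule prob_space_q)
  define K' where "K' = K - {k}"
  have K'_props: "finite K'" "k \<notin> K'" "K = insert k K'" using K_finite by (auto simp: K'_def)
  have [measurable]: "(\<lambda>z. (fst z)(k := snd z)) \<in> measurable (PiM K q \<Otimes>\<^sub>M q k) (PiM K q)"
    using K_finite by (intro measurable_fun_upd[where J=K]) auto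
  have "(\<integral>\<^sup>+c. \<integral>\<^sup>+v. F (c(k := v)) \<partial>q k \<partial>PiM K q)
    = (\<integral>\<^sup>+c. \<integral>\<^sup>+y. \<integral>\<^sup>+v. F ((c(k := y))(k := v)) \<partial>q k \<partial>q k \<partial>PiM K' q)"
    unfolding K'_props(3) by (rule q.product_nn_integral_insert[OF K'_props(1,2)]) (fold K'_props(3), measurable)
  also have "\<dots> = (\<integral>\<^sup>+c. \<integral>\<^sup>+v. F (c(k := v)) \<partial>q k \<partial>PiM K' q)"
    by (simp add: prob_space.emeasure_space_1[OF prob_space_q])
  also have "\<dots> = (\<integral>\<^sup>+c. F c \<partial>PiM K q)"
    unfolding K'_props(3) by (rule q.product_nn_integral_insert[symmetric, OF K'_props(1,2)])
      (fold K'_props(3), measurable)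
  finally show ?thesis ..
qed

lemma nn_integral_PiM_prod_pair_le_1:
  assumes prob_space_P: "prob_space P" and prob_space_Q: "prob_space Q"
    and f_measurable[measurable]: "f \<in> borel_measurable (P \<Otimes>\<^sub>M Q)"
    and slice: "\<And>a. a \<in> space P \<Longrightarrow> (\<integral>\<^sup>+c. f (a, c) \<partial>Q) \<le> (1::ennreal)" and finite_K: "finite K"
  shows "(\<integral>\<^sup>+z. (\<Prod>t\<in>K. f (z t)) \<partial>PiM K (\<lambda>_. P \<Otimes>\<^sub>M Q)) \<le> 1"
proof -
  interpret P: prob_space P by fact
  interpret Q: prob_space Q by fact
  interpret PQ: product_prob_space "\<lambda>_. P \<Otimes>\<^sub>M Q"
    by (intro product_prob_spaceI prob_space_pair prob_space_P prob_space_Q)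
  have "(\<integral>\<^sup>+z. f z \<partial>(P \<Otimes>\<^sub>M Q)) = (\<integral>\<^sup>+a. \<integral>\<^sup>+c. f (a, c) \<partial>Q \<partial>P)"
    by (rule Q.nn_integral_fst[OF f_measurable, symmetric])
  also have "\<dots> \<le> (\<integral>\<^sup>+a. 1 \<partial>P)" by (rule nn_integral_mono) (rule slice)
  finally have "(\<integral>\<^sup>+z. f z \<partial>(P \<Otimes>\<^sub>M Q)) \<le> 1" by (simp add: P.emeasure_space_1)
  moreover have "(\<integral>\<^sup>+z. (\<Prod>t\<in>K. f (z t)) \<partial>PiM K (\<lambda>_. P \<Otimes>\<^sub>M Q)) = (\<Prod>t\<in>K. \<integral>\<^sup>+z. f z \<partial>(P \<Otimes>\<^sub>M Q))"
    by (rule PQ.product_nn_integral_prod[OF finite_K]) measurable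
  ultimately show ?thesis by (simp add: power_le_one)
qed

lemma measure_eqI_rectangles:
  assumes "sets M = sets (S \<Otimes>\<^sub>M T)" "sets N = sets (S \<Otimes>\<^sub>M T)" and finite_M: "finite_measure M"
    and "\<And>A B. A \<in> sets S \<Longrightarrow> B \<in> sets T \<Longrightarrow> emeasure M (A \<times> B) = emeasure N (A \<times> B)"
  shows "M = N"
proof (rule measure_eqI_generator_eq[OF Int_stable_pair_measure_generator[of S T]])
  let ?A = "\<lambda>_::nat. space S \<times> space T"
  show "range ?A \<subseteq> {a \<times> b |a b. a \<in> sets S \<and> b \<in> sets T}" by auto
  show "(\<Union>i. ?A i) = space S \<times> space T" by auto
  show "emeasure M (?A i) \<noteq> \<infinity>" for i using finite_measure.emeasure_finite[OF finite_M] by auto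
  show "{a \<times> b |a b. a \<in> sets S \<and> b \<in> sets T} \<subseteq> Pow (space S \<times> space T)"
    by (auto dest: sets.sets_into_space)
qed (use assms in \<open>auto simp: sets_pair_measure\<close>)

lemma emeasure_distr_density_fst:
  assumes sets_M: "sets M = sets (K \<Otimes>\<^sub>M L)" and Z_sets: "Z \<in> sets K" and C_sets: "C \<in> sets L"
  shows "emeasure (distr (density M (indicator (space K \<times> C))) K fst) Z = emeasure M (Z \<times> C)"
proof -
  note [measurable_cong] = sets_M and [measurable] = Z_sets C_sets
  have "space M = space K \<times> space L" using sets_eq_imp_space_eq[OF sets_M] by (simp add: space_pair_measure)
  then have "space K \<times> C \<inter> (fst -` Z \<inter> space M) = Z \<times> C"
    using sets.sets_into_space[OF Z_sets] sets.sets_into_space[OF C_sets] by auto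
  then show ?thesis
    by (simp add: emeasure_distr emeasure_density indicator_inter_arith[symmetric])
qed

lemma measure_eqI_triple_rectangles:
  assumes sets_M: "sets M = sets ((S \<Otimes>\<^sub>M T) \<Otimes>\<^sub>M L)" and sets_N: "sets N = sets ((S \<Otimes>\<^sub>M T) \<Otimes>\<^sub>M L)"
    and finite_M: "finite_measure M"
    and emeasure_rectangle: "\<And>A B C. A \<in> sets S \<Longrightarrow> B \<in> sets T \<Longrightarrow> C \<in> sets L \<Longrightarrow>
      emeasure M ((A \<times> B) \<times> C) = emeasure N ((A \<times> B) \<times> C)"
  shows "M = N"
proof (rule measure_eqI_rectangles[OF sets_M sets_N finite_M])
  interpret finite_measure M by fact
  fix Z C assume Z_sets: "Z \<in> sets (S \<Otimes>\<^sub>M T)" and C_sets: "C \<in> sets L"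
  note [measurable_cong] = sets_M sets_N
  let ?m = "\<lambda>M. distr (density M (indicator (space (S \<Otimes>\<^sub>M T) \<times> C))) (S \<Otimes>\<^sub>M T) fst"
  have "?m M = ?m N"
  proof (rule measure_eqI_rectangles)
    have "emeasure (?m M) (space (?m M)) = emeasure M (space (S \<Otimes>\<^sub>M T) \<times> C)"
      using emeasure_distr_density_fst[OF sets_M sets.top C_sets] by simp
    then show "finite_measure (?m M)" by (intro finite_measureI) (simp add: emeasure_finite)
    show "emeasure (?m M) (A \<times> B) = emeasure (?m N) (A \<times> B)" if "A \<in> sets S" "B \<in> sets T" for A B
      using that emeasure_rectangle[OF that C_sets]
      by (simp add: emeasure_distr_density_fst[OF sets_M _ C_sets] emeasure_distr_density_fst[OF sets_N _ C_sets])
  qed simp_all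
  then show "emeasure M (Z \<times> C) = emeasure N (Z \<times> C)"
    by (metis emeasure_distr_density_fst[OF sets_M Z_sets C_sets] emeasure_distr_density_fst[OF sets_N Z_sets C_sets])
qed

section \<open>Chains of conditional subdensities\<close>

definition ignores :: "(('k \<Rightarrow> 'u) \<Rightarrow> 'b) \<Rightarrow> 'k \<Rightarrow> bool" where
  "ignores h k \<longleftrightarrow> (\<forall>c v. h (c(k := v)) = h c)"

lemma ignoresD: "ignores h k \<Longrightarrow> h (c(k := v)) = h c"
  by (simp add: ignores_def)

lemma ignores_compose: "ignores h k \<Longrightarrow> ignores (\<lambda>c. F (h c)) k"
  by (simp add: ignores_def)

lemma nn_integral_PiM_insert_prod:
  assumes prob_space_q: "\<And>S. prob_space (q S)" and W_finite: "finite W" "S \<notin> W"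
    and F_measurable[measurable]: "F \<in> borel_measurable (PiM (insert S W) q)"
    and p_measurable[measurable]: "\<And>T. T \<in> insert S W \<Longrightarrow> p T \<in> borel_measurable (PiM (insert S W) q)"
    and ignores: "\<And>T. T \<in> W \<Longrightarrow> ignores (p T) S"
  shows "(\<integral>\<^sup>+u. F u * (\<Prod>T\<in>insert S W. p T u) \<partial>PiM (insert S W) q)
    = (\<integral>\<^sup>+u. (\<integral>\<^sup>+v. p S (u(S := v)) * F (u(S := v)) \<partial>q S) * (\<Prod>T\<in>W. p T u) \<partial>PiM W q)"
proof -
  interpret q: product_prob_space q by (rule product_prob_spaceI) (rule prob_space_q)
  have "(\<integral>\<^sup>+u. F u * (\<Prod>T\<in>insert S W. p T u) \<partial>PiM (insert S W) q)
    = (\<integral>\<^sup>+u. \<integral>\<^sup>+v. F (u(S := v)) * (\<Prod>T\<in>insert S W. p T (u(S := v))) \<partial>q S \<partial>PiM W q)"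
    by (rule q.product_nn_integral_insert[OF W_finite])
      (intro borel_measurable_times_ennreal borel_measurable_prod_ennreal F_measurable p_measurable)
  also have "\<dots> = (\<integral>\<^sup>+u. \<integral>\<^sup>+v. (p S (u(S := v)) * F (u(S := v))) * (\<Prod>T\<in>W. p T u) \<partial>q S \<partial>PiM W q)"
    using W_finite by (simp add: ignoresD[OF ignores] mult_ac del: fun_upd_apply cong: prod.cong)
  also have "\<dots> = (\<integral>\<^sup>+u. (\<integral>\<^sup>+v. p S (u(S := v)) * F (u(S := v)) \<partial>q S) * (\<Prod>T\<in>W. p T u) \<partial>PiM W q)"
  proof (intro nn_integral_cong nn_integral_multc borel_measurable_times_ennreal)
    fix u assume "u \<in> space (PiM W q)"
    then have "(\<lambda>v. u(S := v)) \<in> measurable (q S) (PiM (insert S W) q)"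
      by (intro measurable_fun_upd[where J=W]) auto
    then show "(\<lambda>v. p S (u(S := v))) \<in> borel_measurable (q S)" "(\<lambda>v. F (u(S := v))) \<in> borel_measurable (q S)"
      by (auto intro: measurable_compose[OF _ p_measurable] measurable_compose[OF _ F_measurable])
  qed
  finally show ?thesis .
qed

definition subdensity_chain ::
    "'k set \<Rightarrow> ('k \<Rightarrow> 'u measure) \<Rightarrow> ('k \<times> (('k \<Rightarrow> 'u) \<Rightarrow> ennreal)) list \<Rightarrow> bool" where
  "subdensity_chain K q hs \<longleftrightarrow>
     (\<forall>(k, h)\<in>set hs. k \<in> K \<and> h \<in> borel_measurable (PiM K q) \<and>
        (\<forall>c\<in>space (PiM K q). (\<integral>\<^sup>+v. h (c(k := v)) \<partial>q k) \<le> 1)) \<and>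
     sorted_wrt (\<lambda>(k, h) (k', h'). ignores h k') hs"

lemma subdensity_chain_append:
  "subdensity_chain K q (hs @ hs') \<longleftrightarrow> subdensity_chain K q hs \<and> subdensity_chain K q hs' \<and>
     (\<forall>(k, h)\<in>set hs. \<forall>(k', h')\<in>set hs'. ignores h k')"
  unfolding subdensity_chain_def sorted_wrt_append by fastforce

lemma subdensity_chain_filter: "subdensity_chain K q hs \<Longrightarrow> subdensity_chain K q (filter P hs)"
  unfolding subdensity_chain_def by (auto intro: sorted_wrt_filter)

lemma subdensity_chain_map:
  "subdensity_chain K q (map (\<lambda>S. (key S, h S)) Ss) \<longleftrightarrow>
    (\<forall>S\<in>set Ss. key S \<in> K \<and> h S \<in> borel_measurable (PiM K q) \<and>
       (\<forall>c\<in>space (PiM K q). (\<integral>\<^sup>+v. h S (c(key S := v)) \<partial>q (key S)) \<le> 1)) \<and>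
    sorted_wrt (\<lambda>S S'. ignores (h S) (key S')) Ss"
  by (simp add: subdensity_chain_def sorted_wrt_map)

text \<open>Integrating the coordinates in reverse order peels off one factor at a time.\<close>
lemma nn_integral_subdensity_chain_le_1:
  assumes prob_space_q: "\<And>i. prob_space (q i)" and finite_K: "finite K" and "subdensity_chain K q hs"
  shows "(\<integral>\<^sup>+c. (\<Prod>(k, h)\<leftarrow>hs. h c) \<partial>PiM K q) \<le> 1"
  using assms(3)
proof (induction hs rule: rev_induct)
  case Nil
  interpret prob_space "PiM K q" by (rule prob_space_PiM) (rule prob_space_q)
  show ?case by (simp add: emeasure_space_1)
next
  case (snoc p hs)
  obtain k h where p_eq: "p = (k, h)" by force
  have hs_chain: "subdensity_chain K q hs" and indep: "\<And>i g. (i, g) \<in> set hs \<Longrightarrow> ignores g k"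
    and k_in: "k \<in> K" and h_measurable[measurable]: "h \<in> borel_measurable (PiM K q)"
    and nn_integral_le_1: "\<And>c. c \<in> space (PiM K q) \<Longrightarrow> (\<integral>\<^sup>+v. h (c(k := v)) \<partial>q k) \<le> 1"
    using snoc.prems by (auto simp: p_eq subdensity_chain_append) (auto simp: subdensity_chain_def)
  let ?front = "\<lambda>c. \<Prod>(k, h)\<leftarrow>hs. h c"
  have front[measurable]: "?front \<in> borel_measurable (PiM K q)"
    using hs_chain unfolding subdensity_chain_def
    by (induction hs) (auto intro!: borel_measurable_times_ennreal)
  have front_upd: "?front (c(k := v)) = ?front c" for c v
    using indep by (intro arg_cong[where f=prod_list] map_cong refl) (auto simp: ignoresD)
  have "(\<integral>\<^sup>+c. (\<Prod>(k, h)\<leftarrow>hs @ [p]. h c) \<partial>PiM K q) = (\<integral>\<^sup>+c. ?front c * h c \<partial>PiM K q)"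
    by (simp add: p_eq)
  also have "\<dots> = (\<integral>\<^sup>+c. \<integral>\<^sup>+v. ?front (c(k := v)) * h (c(k := v)) \<partial>q k \<partial>PiM K q)"
    by (rule nn_integral_PiM_fun_upd[OF prob_space_q finite_K k_in]) measurable
  also have "\<dots> = (\<integral>\<^sup>+c. ?front c * (\<integral>\<^sup>+v. h (c(k := v)) \<partial>q k) \<partial>PiM K q)"
    unfolding front_upd using k_in
    by (intro nn_integral_cong nn_integral_cmult measurable_compose[OF measurable_PiM_fun_upd h_measurable])
  also have "\<dots> \<le> (\<integral>\<^sup>+c. ?front c * 1 \<partial>PiM K q)"
    by (intro nn_integral_mono mult_left_mono nn_integral_le_1) auto
  also have "\<dots> \<le> 1" using snoc.IH[OF hs_chain] by simp
  finally show ?case .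
qed

section \<open>Clipping\<close>

definition clip :: "real \<Rightarrow> real \<Rightarrow> real" where
  "clip b x = max (- b) (min b x)"

lemma borel_measurable_clip[measurable (raw)]:
  assumes [measurable]: "f \<in> borel_measurable M"
  shows "(\<lambda>x. clip b (f x)) \<in> borel_measurable M"
  unfolding clip_def by measurable

lemma abs_clip_le: "0 \<le> b \<Longrightarrow> \<bar>clip b x\<bar> \<le> b"
  by (simp add: clip_def)

lemma abs_clip_le_abs: "0 \<le> b \<Longrightarrow> \<bar>clip b x\<bar> \<le> \<bar>x\<bar>"
  by (simp add: clip_def)

lemma abs_diff_clip_le_abs: "0 \<le> b \<Longrightarrow> \<bar>x - clip b x\<bar> \<le> \<bar>x\<bar>"
  by (simp add: clip_def)

lemma tendsto_clip_at_top: "((\<lambda>b. clip b x) \<longlongrightarrow> x) at_top"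
proof (rule tendsto_eventually)
  show "\<forall>\<^sub>F b in at_top. clip b x = x"
    using eventually_ge_at_top[of "\<bar>x\<bar>"] by eventually_elim (simp add: clip_def)
qed

lemma integral_abs_diff_clip_tendsto_0:
  assumes f_integrable: "integrable M f"
  shows "((\<lambda>b. \<integral>x. \<bar>f x - clip b (f x)\<bar> \<partial>M) \<longlongrightarrow> 0) at_top"
proof -
  have [measurable]: "f \<in> borel_measurable M" using f_integrable by auto
  have "((\<lambda>b. \<integral>x. \<bar>f x - clip b (f x)\<bar> \<partial>M) \<longlongrightarrow> (\<integral>x. 0 \<partial>M)) at_top"
  proof (rule integral_dominated_convergence_at_top[where w="\<lambda>x. \<bar>f x\<bar>"])
    show "AE x in M. ((\<lambda>b. \<bar>f x - clip b (f x)\<bar>) \<longlongrightarrow> 0) at_top"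
    proof (rule AE_I2)
      fix x
      have "((\<lambda>b. \<bar>f x - clip b (f x)\<bar>) \<longlongrightarrow> \<bar>f x - f x\<bar>) at_top"
        by (intro tendsto_intros tendsto_clip_at_top)
      then show "((\<lambda>b. \<bar>f x - clip b (f x)\<bar>) \<longlongrightarrow> 0) at_top" by simp
    qed
    show "\<forall>\<^sub>F b in at_top. AE x in M. norm \<bar>f x - clip b (f x)\<bar> \<le> \<bar>f x\<bar>"
      using eventually_ge_at_top[of 0]
      by eventually_elim (auto intro!: AE_I2 abs_diff_clip_le_abs)
  qed (use f_integrable in auto)
  then show ?thesis by simp
qed

lemma power2_diff_le: "(x - y)\<^sup>2 \<le> 2 * x\<^sup>2 + 2 * (y::real)\<^sup>2"
  using zero_le_power2[of "x + y"] by (simp only: power2_sum power2_diff)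

lemma integral_power2_diff_clip_tendsto:
  fixes X \<psi> :: "'a \<Rightarrow> real"
  assumes [measurable]: "X \<in> borel_measurable M" "\<psi> \<in> borel_measurable M"
    and X_square_integrable: "integrable M (\<lambda>\<omega>. (X \<omega>)\<^sup>2)"
    and error_square_integrable: "integrable M (\<lambda>\<omega>. (X \<omega> - \<psi> \<omega>)\<^sup>2)"
  shows "\<forall>\<^sub>F b in at_top. integrable M (\<lambda>\<omega>. (X \<omega> - clip b (\<psi> \<omega>))\<^sup>2)"
    and "((\<lambda>b. \<integral>\<omega>. (X \<omega> - clip b (\<psi> \<omega>))\<^sup>2 \<partial>M) \<longlongrightarrow> (\<integral>\<omega>. (X \<omega> - \<psi> \<omega>)\<^sup>2 \<partial>M)) at_top"
proof -
  let ?dom = "\<lambda>\<omega>. 6 * (X \<omega>)\<^sup>2 + 4 * (X \<omega> - \<psi> \<omega>)\<^sup>2"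
  have dom_integrable: "integrable M ?dom" using X_square_integrable error_square_integrable by auto
  have dominated: "(X \<omega> - clip b (\<psi> \<omega>))\<^sup>2 \<le> ?dom \<omega>" if "0 \<le> b" for b \<omega>
  proof -
    have "(clip b (\<psi> \<omega>))\<^sup>2 \<le> (\<psi> \<omega>)\<^sup>2"
      using abs_clip_le_abs[OF that] by (simp add: abs_le_square_iff)
    moreover have "(\<psi> \<omega>)\<^sup>2 \<le> 2 * (X \<omega>)\<^sup>2 + 2 * (X \<omega> - \<psi> \<omega>)\<^sup>2"
      using power2_diff_le[of "X \<omega>" "X \<omega> - \<psi> \<omega>"] by simp
    ultimately show ?thesis using power2_diff_le[of "X \<omega>" "clip b (\<psi> \<omega>)"] by linarith
  qed
  show "\<forall>\<^sub>F b in at_top. integrable M (\<lambda>\<omega>. (X \<omega> - clip b (\<psi> \<omega>))\<^sup>2)"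
    using eventually_ge_at_top[of 0]
  proof eventually_elim
    case (elim b)
    show ?case
      by (rule Bochner_Integration.integrable_bound[OF dom_integrable])
        (use dominated[OF elim] in \<open>auto intro: order_trans[OF _ abs_ge_self]\<close>)
  qed
  show "((\<lambda>b. \<integral>\<omega>. (X \<omega> - clip b (\<psi> \<omega>))\<^sup>2 \<partial>M) \<longlongrightarrow> (\<integral>\<omega>. (X \<omega> - \<psi> \<omega>)\<^sup>2 \<partial>M)) at_top"
  proof (rule integral_dominated_convergence_at_top[OF _ _ dom_integrable])
    show "\<forall>\<^sub>F b in at_top. AE \<omega> in M. norm ((X \<omega> - clip b (\<psi> \<omega>))\<^sup>2) \<le> ?dom \<omega>"
      using eventually_ge_at_top[of 0] by eventually_elim (simp add: dominated)
    show "AE \<omega> in M. ((\<lambda>b. (X \<omega> - clip b (\<psi> \<omega>))\<^sup>2) \<longlongrightarrow> (X \<omega> - \<psi> \<omega>)\<^sup>2) at_top"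
      by (intro AE_I2 tendsto_intros tendsto_clip_at_top)
  qed auto
qed

lemma eventually_nn_integral_tail_le:
  fixes f :: "'a \<Rightarrow> real"
  assumes f_integrable: "integrable M f" and f_nonneg: "\<And>z. f z \<ge> 0" and "\<kappa> > 0"
  shows "\<forall>\<^sub>F C in at_top. (\<integral>\<^sup>+z. ennreal (f z) * indicator {z. C < f z} z \<partial>M) \<le> ennreal \<kappa>"
proof -
  have [measurable]: "f \<in> borel_measurable M" using f_integrable by auto
  let ?tail = "\<lambda>C z. f z * of_bool (C < f z)"
  have "((\<lambda>C. \<integral>z. ?tail C z \<partial>M) \<longlongrightarrow> (\<integral>z. 0 \<partial>M)) at_top"
  proof (rule integral_dominated_convergence_at_top[where w=f])
    have "\<forall>\<^sub>F C in at_top. ?tail C z = 0" for z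
      using eventually_ge_at_top[of "f z"] by eventually_elim auto
    then show "AE z in M. ((\<lambda>C. ?tail C z) \<longlongrightarrow> 0) at_top"
      by (intro AE_I2 tendsto_eventually)
  qed (use f_integrable f_nonneg in auto)
  then have "\<forall>\<^sub>F C in at_top. (\<integral>z. ?tail C z \<partial>M) < \<kappa>"
    using \<open>\<kappa> > 0\<close> by (intro order_tendstoD(2)[where y=0]) auto
  then show ?thesis
  proof eventually_elim
    case (elim C)
    have "integrable M (?tail C)"
      by (rule Bochner_Integration.integrable_bound[OF f_integrable]) (use f_nonneg in auto)
    then have "(\<integral>\<^sup>+z. ennreal (?tail C z) \<partial>M) = ennreal (\<integral>z. ?tail C z \<partial>M)"
      by (rule nn_integral_eq_integral) (use f_nonneg in auto)
    moreover have "(\<integral>\<^sup>+z. ennreal (f z) * indicator {z. C < f z} z \<partial>M) = (\<integral>\<^sup>+z. ennreal (?tail C z) \<partial>M)"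
      by (intro nn_integral_cong) (auto simp: indicator_def)
    ultimately show ?case using elim by (simp add: ennreal_leI)
  qed
qed

section \<open>Laws of large numbers\<close>

lemma
  fixes f :: "'a \<Rightarrow> real"
  assumes prob_space_M: "\<And>i. i \<in> K \<Longrightarrow> prob_space (M i)" and i_in: "i \<in> K" and f_integrable: "integrable (M i) f"
  shows integrable_PiM_component: "integrable (PiM K M) (\<lambda>z. f (z i))"
    and integral_PiM_component: "(\<integral>z. f (z i) \<partial>PiM K M) = integral\<^sup>L (M i) f"
proof -
  have distr_component: "distr (PiM K M) (M i) (\<lambda>z. z i) = M i" by (rule distr_PiM_component[OF prob_space_M i_in])
  have meas: "(\<lambda>z. z i) \<in> measurable (PiM K M) (M i)" "f \<in> borel_measurable (M i)" using i_in f_integrable by auto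
  show "integrable (PiM K M) (\<lambda>z. f (z i))"
    using integrable_distr_eq[OF meas] f_integrable by (simp add: distr_component)
  show "(\<integral>z. f (z i) \<partial>PiM K M) = integral\<^sup>L (M i) f"
    using integral_distr[OF meas] by (simp add: distr_component)
qed

lemma nn_integral_PiM_component:
  assumes prob_space_M: "\<And>i. i \<in> K \<Longrightarrow> prob_space (M i)" and i_in: "i \<in> K"
    and f_measurable: "f \<in> borel_measurable (M i)"
  shows "(\<integral>\<^sup>+z. f (z i) \<partial>PiM K M) = (\<integral>\<^sup>+x. f x \<partial>M i)"
proof -
  have "distr (PiM K M) (M i) (\<lambda>z. z i) = M i" by (rule distr_PiM_component[OF prob_space_M i_in])
  then have "(\<integral>\<^sup>+x. f x \<partial>M i) = (\<integral>\<^sup>+x. f x \<partial>distr (PiM K M) (M i) (\<lambda>z. z i))" by simp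
  also have "\<dots> = (\<integral>\<^sup>+z. f (z i) \<partial>PiM K M)"
    using i_in f_measurable by (intro nn_integral_distr) auto
  finally show ?thesis ..
qed

lemma indep_vars_PiM_component:
  assumes prob_space_M: "\<And>i. i \<in> K \<Longrightarrow> prob_space (M i)" and "K \<noteq> {}"
  shows "prob_space.indep_vars (PiM K M) M (\<lambda>i z. z i) K"
proof -
  interpret P: prob_space "PiM K M" by (rule prob_space_PiM) (rule prob_space_M)
  show ?thesis
  proof (subst P.indep_vars_iff_distr_eq_PiM')
    have "distr (PiM K M) (PiM K M) (\<lambda>z. \<lambda>i\<in>K. z i) = distr (PiM K M) (PiM K M) (\<lambda>z. z)"
      by (rule distr_cong) (auto simp: space_PiM PiE_iff extensional_restrict)
    also have "\<dots> = PiM K M" by (rule distr_id)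
    also have "\<dots> = PiM K (\<lambda>i. distr (PiM K M) (M i) (\<lambda>z. z i))"
      by (intro PiM_cong refl distr_PiM_component[symmetric] prob_space_M)
    finally show "distr (PiM K M) (PiM K M) (\<lambda>z. \<lambda>i\<in>K. z i) = PiM K (\<lambda>i. distr (PiM K M) (M i) (\<lambda>z. z i))" .
  qed (use \<open>K \<noteq> {}\<close> in auto)
qed

lemma measure_PiM_sum_ge_Hoeffding:
  fixes g :: "'a \<Rightarrow> real"
  assumes prob_space_M: "prob_space M" and [measurable]: "g \<in> borel_measurable M"
    and B_bound: "\<And>x. x \<in> space M \<Longrightarrow> \<bar>g x\<bar> \<le> B" "B > 0" and e_pos: "e > 0" and n_pos: "n > 0"
  shows "measure (PiM {..<n} (\<lambda>_. M))
      {z \<in> space (PiM {..<n} (\<lambda>_. M)). real n * (integral\<^sup>L M g + e) \<le> (\<Sum>t<n. g (z t))}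
    \<le> exp (- (e\<^sup>2 / (2 * B\<^sup>2)) * real n)"
proof -
  let ?P = "PiM {..<n} (\<lambda>_. M)"
  interpret M: prob_space M by fact
  interpret P: prob_space ?P by (rule prob_space_PiM) (rule prob_space_M)
  have g_integrable: "integrable M g"
    by (rule M.integrable_const_bound[where B=B]) (use B_bound in auto)
  interpret Hoeffding_ineq ?P "{..<n}" "\<lambda>t z. g (z t)" "\<lambda>_. - B" "\<lambda>_. B" "real n * integral\<^sup>L M g"
  proof unfold_locales
    show "P.indep_vars (\<lambda>_. borel) (\<lambda>t z. g (z t)) {..<n}"
      by (rule P.indep_vars_compose2[OF indep_vars_PiM_component[OF prob_space_M]]) (use n_pos in auto)
    show "real n * integral\<^sup>L M g \<equiv> \<Sum>t<n. P.expectation (\<lambda>z. g (z t))"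
      using integral_PiM_component[of "{..<n}" "\<lambda>_. M" _ g, OF prob_space_M _ g_integrable] by simp
    show "AE z in ?P. g (z t) \<in> {- B..B}" if "t \<in> {..<n}" for t
      using that B_bound(1) by (intro AE_I2) (auto simp: space_PiM PiE_iff abs_le_iff neg_le_iff_le minus_le_iff)
  qed auto
  have "P.prob {z\<in>space ?P. real n * integral\<^sup>L M g + real n * e \<le> (\<Sum>t<n. g (z t))}
     \<le> exp (-2 * (real n * e)\<^sup>2 / (\<Sum>t<n. (B - -B)\<^sup>2))"
    by (rule Hoeffding_ineq_ge) (use n_pos B_bound e_pos in auto)
  also have "-2 * (real n * e)\<^sup>2 / (\<Sum>t<n. (B - -B)\<^sup>2) = - (e\<^sup>2 / (2 * B\<^sup>2)) * real n"
    using n_pos B_bound by (simp add: field_simps power2_eq_square)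
  finally show ?thesis by (simp add: distrib_left)
qed

lemma measure_PiM_sum_ge_Markov:
  fixes f :: "'a \<Rightarrow> real"
  assumes prob_space_M: "prob_space M" and integrable_f: "integrable M f" and f_nonneg: "\<And>x. f x \<ge> 0"
    and a_pos: "a > 0" and n_pos: "n > 0"
  shows "measure (PiM {..<n} (\<lambda>_. M)) {z \<in> space (PiM {..<n} (\<lambda>_. M)). real n * a \<le> (\<Sum>t<n. f (z t))}
    \<le> integral\<^sup>L M f / a"
proof -
  let ?P = "PiM {..<n} (\<lambda>_. M)"
  interpret P: prob_space ?P by (rule prob_space_PiM) (rule prob_space_M)
  have f_integrable: "integrable ?P (\<lambda>z. f (z t))" if "t < n" for t
    using integrable_PiM_component[of "{..<n}" "\<lambda>_. M" t f] prob_space_M integrable_f that by simp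
  have "measure ?P {z \<in> space ?P. real n * a \<le> (\<Sum>t<n. f (z t))} \<le> (\<integral>z. (\<Sum>t<n. f (z t)) \<partial>?P) / (real n * a)"
    by (rule integral_Markov_inequality_measure[where A="{}"])
      (use f_integrable f_nonneg n_pos a_pos in \<open>auto intro!: sum_nonneg\<close>)
  also have "(\<integral>z. (\<Sum>t<n. f (z t)) \<partial>?P) = real n * integral\<^sup>L M f"
    using integral_PiM_component[of "{..<n}" "\<lambda>_. M" _ f, OF prob_space_M _ integrable_f] f_integrable by simp
  finally show ?thesis using n_pos by simp
qed

lemma measure_PiM_sum_gt_le:
  fixes f g :: "'a \<Rightarrow> real"
  assumes prob_space_M: "prob_space M" and f_integrable: "integrable M f"
    and g_measurable[measurable]: "g \<in> borel_measurable M"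
    and B_bound: "\<And>x. x \<in> space M \<Longrightarrow> \<bar>g x\<bar> \<le> B" "B > 0" and e_pos: "e > 0" and n_pos: "n > 0"
    and close: "(\<integral>x. \<bar>f x - g x\<bar> \<partial>M) \<le> e"
  shows "measure (PiM {..<n} (\<lambda>_. M))
      {z \<in> space (PiM {..<n} (\<lambda>_. M)). real n * (integral\<^sup>L M f + 3 * e) < (\<Sum>t<n. f (z t))}
    \<le> exp (- (e\<^sup>2 / (2 * B\<^sup>2)) * real n) + (\<integral>x. \<bar>f x - g x\<bar> \<partial>M) / e"
proof -
  let ?P = "PiM {..<n} (\<lambda>_. M)"
  interpret M: prob_space M by fact
  interpret P: prob_space ?P by (rule prob_space_PiM) (rule prob_space_M)
  have [measurable]: "f \<in> borel_measurable M" using f_integrable by auto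
  have g_integrable: "integrable M g"
    by (rule M.integrable_const_bound[where B=B]) (use B_bound in auto)
  let ?A = "{z \<in> space ?P. real n * (integral\<^sup>L M g + e) \<le> (\<Sum>t<n. g (z t))}"
  let ?B = "{z \<in> space ?P. real n * e \<le> (\<Sum>t<n. \<bar>f (z t) - g (z t)\<bar>)}"
  have "\<bar>integral\<^sup>L M f - integral\<^sup>L M g\<bar> \<le> (\<integral>x. \<bar>f x - g x\<bar> \<partial>M)"
    using integral_abs_bound[of M "\<lambda>x. f x - g x"] f_integrable g_integrable by simp
  then have mean: "real n * (integral\<^sup>L M g + e + e) \<le> real n * (integral\<^sup>L M f + 3 * e)"
    using close by (intro mult_left_mono) auto
  have "{z \<in> space ?P. real n * (integral\<^sup>L M f + 3 * e) < (\<Sum>t<n. f (z t))} \<subseteq> ?A \<union> ?B"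
  proof (safe, rule ccontr)
    fix z assume "real n * (integral\<^sup>L M f + 3 * e) < (\<Sum>t<n. f (z t))"
      and "\<not> real n * e \<le> (\<Sum>t<n. \<bar>f (z t) - g (z t)\<bar>)"
      and "\<not> real n * (integral\<^sup>L M g + e) \<le> (\<Sum>t<n. g (z t))"
    moreover have "(\<Sum>t<n. f (z t)) \<le> (\<Sum>t<n. g (z t)) + (\<Sum>t<n. \<bar>f (z t) - g (z t)\<bar>)"
      unfolding sum.distrib[symmetric] by (rule sum_mono) simp
    ultimately show False using mean by (simp add: algebra_simps)
  qed
  then have "P.prob {z \<in> space ?P. real n * (integral\<^sup>L M f + 3 * e) < (\<Sum>t<n. f (z t))} \<le> P.prob (?A \<union> ?B)"
    by (rule P.finite_measure_mono) measurable
  also have "\<dots> \<le> P.prob ?A + P.prob ?B"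
    by (rule measure_Un_le) measurable
  also have "\<dots> \<le> exp (- (e\<^sup>2 / (2 * B\<^sup>2)) * real n) + (\<integral>x. \<bar>f x - g x\<bar> \<partial>M) / e"
    using measure_PiM_sum_ge_Hoeffding[OF prob_space_M g_measurable B_bound e_pos n_pos]
      measure_PiM_sum_ge_Markov[of M "\<lambda>x. \<bar>f x - g x\<bar>", OF prob_space_M _ _ e_pos n_pos] f_integrable g_integrable
    by (intro add_mono) auto
  finally show ?thesis .
qed

lemma weak_law_upper_tail:
  fixes f :: "'a \<Rightarrow> real"
  assumes prob_space_M: "prob_space M" and f_integrable: "integrable M f" and "e > 0"
  shows "(\<lambda>n. measure (PiM {..<n} (\<lambda>_. M))
     {z \<in> space (PiM {..<n} (\<lambda>_. M)). real n * (integral\<^sup>L M f + e) < (\<Sum>t<n. f (z t))}) \<longlonglongrightarrow> 0"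
    (is "?dev \<longlonglongrightarrow> 0")
proof (rule order_tendstoI)
  fix r :: real assume "r > 0"
  define d where "d = e / 3"
  have "d > 0" "e = 3 * d" using \<open>e > 0\<close> by (simp_all add: d_def)
  have "\<forall>\<^sub>F b in at_top. (\<integral>x. \<bar>f x - clip b (f x)\<bar> \<partial>M) < min d (r * d / 2) \<and> b > 0"
    using \<open>d > 0\<close> \<open>r > 0\<close>
    by (intro eventually_conj order_tendstoD(2)[OF integral_abs_diff_clip_tendsto_0[OF f_integrable]] eventually_gt_at_top) auto
  from eventually_happens'[OF trivial_limit_at_top_linorder this]
  obtain b where b_close: "(\<integral>x. \<bar>f x - clip b (f x)\<bar> \<partial>M) < min d (r * d / 2)" "b > 0" by blast
  define \<gamma> where "\<gamma> = d\<^sup>2 / (2 * b\<^sup>2)"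
  have "\<gamma> > 0" using \<open>d > 0\<close> \<open>b > 0\<close> by (simp add: \<gamma>_def)
  then have "(\<lambda>n. exp (- \<gamma> * real n)) \<longlonglongrightarrow> 0" by real_asymp
  then have "\<forall>\<^sub>F n in sequentially. exp (- \<gamma> * real n) < r / 2"
    using \<open>r > 0\<close> by (intro order_tendstoD(2)) auto
  then show "\<forall>\<^sub>F n in sequentially. ?dev n < r"
    using eventually_gt_at_top[of 0]
  proof eventually_elim
    case (elim n)
    have "?dev n \<le> exp (- \<gamma> * real n) + (\<integral>x. \<bar>f x - clip b (f x)\<bar> \<partial>M) / d"
      unfolding \<open>e = 3 * d\<close> \<gamma>_def
      by (rule measure_PiM_sum_gt_le[OF prob_space_M f_integrable])
        (use b_close \<open>d > 0\<close> f_integrable elim in \<open>auto intro: abs_clip_le\<close>)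
    moreover have "(\<integral>x. \<bar>f x - clip b (f x)\<bar> \<partial>M) / d < r / 2"
      using b_close(1) \<open>d > 0\<close> by (simp add: divide_less_eq mult.commute)
    ultimately show ?case using elim(1) by linarith
  qed
qed (auto intro!: always_eventually less_le_trans[OF _ measure_nonneg])

lemma second_moment_lower_tail:
  fixes W :: "'a \<Rightarrow> ennreal"
  assumes "prob_space M" and [measurable]: "W \<in> borel_measurable M"
    and mean: "(\<integral>\<^sup>+z. W z \<partial>M) = ennreal p" and second: "(\<integral>\<^sup>+z. W z * W z \<partial>M) \<le> ennreal b"
    and nonneg: "p \<ge> 0" "b \<ge> 0"
  shows "measure M {z\<in>space M. 2 * W z < 1} + 8 * p \<le> 4 * b + 4"
proof -
  interpret M: prob_space M by fact
  have pointwise: "of_bool (2 * w < 1) + 8 * w \<le> 4 * (w * w) + 4" for w :: ennreal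
  proof (cases w)
    case (real r)
    have "of_bool (2 * r < 1) + 8 * r \<le> 4 * (r * r) + 4"
    proof (cases "2 * r < 1")
      case True
      then have "(1 - r)\<^sup>2 \<ge> (1/2)\<^sup>2" by (intro power_mono) auto
      then show ?thesis using True by (simp add: power2_eq_square algebra_simps)
    next
      case False
      then show ?thesis using zero_le_power2[of "1 - r"] by (simp add: power2_eq_square algebra_simps)
    qed
    then have "ennreal (of_bool (2 * r < 1) + 8 * r) \<le> ennreal (4 * (r * r) + 4)" by (rule ennreal_leI)
    moreover have "2 * w = ennreal (2 * r)" using real by (simp add: ennreal_mult')
    then have "of_bool (2 * w < 1) = ennreal (of_bool (2 * r < 1))" by (simp only: ennreal_less_one_iff) simp
    ultimately show ?thesis using real by (simp add: ennreal_mult')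
  qed (simp add: ennreal_top_mult)
  have "ennreal (measure M {z\<in>space M. 2 * W z < 1} + 8 * p)
    = emeasure M {z\<in>space M. 2 * W z < 1} + 8 * (\<integral>\<^sup>+z. W z \<partial>M)"
    using nonneg by (simp add: mean M.emeasure_eq_measure ennreal_mult')
  also have "\<dots> = (\<integral>\<^sup>+z. of_bool (2 * W z < 1) + 8 * W z \<partial>M)"
    by (simp add: nn_integral_add nn_integral_cmult nn_integral_of_bool)
  also have "\<dots> \<le> (\<integral>\<^sup>+z. 4 * (W z * W z) + 4 \<partial>M)" by (intro nn_integral_mono pointwise)
  also have "\<dots> = 4 * (\<integral>\<^sup>+z. W z * W z \<partial>M) + 4"
    by (simp add: nn_integral_add nn_integral_cmult M.emeasure_space_1)
  also have "\<dots> \<le> 4 * ennreal b + 4" by (intro add_right_mono mult_left_mono second) auto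
  also have "\<dots> = ennreal (4 * b + 4)" using nonneg by (simp add: ennreal_mult')
  finally show ?thesis using nonneg by (subst (asm) ennreal_le_iff) auto
qed

lemma measure_tendsto_0_mono_AE:
  fixes N :: "nat \<Rightarrow> 'a measure"
  assumes "\<And>n. finite_measure (N n)" and "\<And>n. B n \<in> sets (N n)"
    and "\<And>n. AE z in N n. z \<in> A n \<longrightarrow> z \<in> B n" and lim: "(\<lambda>n. measure (N n) (B n)) \<longlonglongrightarrow> 0"
  shows "(\<lambda>n. measure (N n) (A n)) \<longlonglongrightarrow> 0"
proof (rule tendsto_sandwich[OF _ _ tendsto_const lim])
  show "\<forall>\<^sub>F n in sequentially. measure (N n) (A n) \<le> measure (N n) (B n)"
    by (intro always_eventually allI finite_measure.finite_measure_mono_AE assms)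
qed simp

lemma measure_UN_tendsto_0:
  fixes N :: "nat \<Rightarrow> 'a measure"
  assumes finite_measure_N: "\<And>n. finite_measure (N n)" and finite_I: "finite I"
    and A_sets: "\<And>i n. i \<in> I \<Longrightarrow> A i n \<in> sets (N n)"
    and lim: "\<And>i. i \<in> I \<Longrightarrow> (\<lambda>n. measure (N n) (A i n)) \<longlonglongrightarrow> 0"
  shows "(\<lambda>n. measure (N n) (\<Union>i\<in>I. A i n)) \<longlonglongrightarrow> 0"
proof (rule tendsto_sandwich[OF _ _ tendsto_const])
  show "(\<lambda>n. \<Sum>i\<in>I. measure (N n) (A i n)) \<longlonglongrightarrow> 0"
    using tendsto_sum[of I "\<lambda>i n. measure (N n) (A i n)" "\<lambda>_. 0" sequentially] lim by simp
  show "\<forall>\<^sub>F n in sequentially. measure (N n) (\<Union>i\<in>I. A i n) \<le> (\<Sum>i\<in>I. measure (N n) (A i n))"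
    using A_sets
    by (intro always_eventually allI finite_measure.finite_measure_subadditive_finite finite_measure_N finite_I) auto
qed simp

lemma measure_PiM_prod_gt_exp_tendsto_0:
  fixes f :: "'a \<Rightarrow> real"
  assumes prob_space_M: "prob_space M" and f_nonneg: "\<And>x. f x \<ge> 0" and ln_f: "integrable M (\<lambda>x. ln (f x))"
    and mean: "(\<integral>x. ln (f x) \<partial>M) \<le> r" and \<theta>_pos: "\<theta> > 0"
  shows "(\<lambda>n. measure (PiM {..<n} (\<lambda>_. M))
    {z \<in> space (PiM {..<n} (\<lambda>_. M)). exp (real n * (r + \<theta>)) < (\<Prod>t<n. f (z t))}) \<longlonglongrightarrow> 0"
proof (rule measure_tendsto_0_mono_AE[OF _ _ _ weak_law_upper_tail[OF prob_space_M ln_f \<theta>_pos]])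
  fix n :: nat
  let ?P = "PiM {..<n} (\<lambda>_. M)"
  have [measurable]: "(\<lambda>x. ln (f x)) \<in> borel_measurable M" using ln_f by auto
  show "finite_measure ?P" by (intro prob_space.finite_measure prob_space_PiM prob_space_M)
  show "{z \<in> space ?P. real n * ((\<integral>x. ln (f x) \<partial>M) + \<theta>) < (\<Sum>t<n. ln (f (z t)))} \<in> sets ?P"
    by measurable
  show "AE z in ?P. z \<in> {z \<in> space ?P. exp (real n * (r + \<theta>)) < (\<Prod>t<n. f (z t))} \<longrightarrow>
    z \<in> {z \<in> space ?P. real n * ((\<integral>x. ln (f x) \<partial>M) + \<theta>) < (\<Sum>t<n. ln (f (z t)))}"
  proof (intro AE_I2 impI CollectI conjI, simp)
    fix z assume z_in: "z \<in> {z \<in> space ?P. exp (real n * (r + \<theta>)) < (\<Prod>t<n. f (z t))}"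
    then have prod_gt: "exp (real n * (r + \<theta>)) < (\<Prod>t<n. f (z t))" by simp
    then have prod_pos: "0 < (\<Prod>t<n. f (z t))" by (rule less_trans[OF exp_gt_zero])
    then have "f (z t) > 0" if "t < n" for t
      using that f_nonneg[of "z t"] by (auto simp: less_le dest: prod_zero_iff[THEN iffD2, rotated])
    then have "(\<Sum>t<n. ln (f (z t))) = ln (\<Prod>t<n. f (z t))" by (intro ln_prod[symmetric]) fastforce+
    also have "\<dots> > real n * (r + \<theta>)" using ln_strict_mono[OF prod_gt exp_gt_zero] by simp
    finally show "real n * ((\<integral>x. ln (f x) \<partial>M) + \<theta>) < (\<Sum>t<n. ln (f (z t)))"
      by (rule le_less_trans[rotated]) (use mean in \<open>intro mult_left_mono; simp\<close>)
  qed
qed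

text \<open>The mean of \<open>ln f\<close> may be infinite, hence the approximation from below by integrable functions.\<close>
definition ln_mean_ge :: "'a measure \<Rightarrow> ('a \<Rightarrow> real) \<Rightarrow> real \<Rightarrow> bool" where
  "ln_mean_ge M f r \<longleftrightarrow> (AE x in M. f x > 0) \<and>
     (\<forall>e>0. \<exists>h. integrable M h \<and> (AE x in M. h x \<le> ln (f x)) \<and> r - e \<le> integral\<^sup>L M h)"

lemma measure_PiM_prod_less_exp_tendsto_0:
  fixes f :: "'a \<Rightarrow> real"
  assumes prob_space_M: "prob_space M" and ln_mean_f: "ln_mean_ge M f r" and \<theta>_pos: "\<theta> > 0"
  shows "(\<lambda>n. measure (PiM {..<n} (\<lambda>_. M))
    {z \<in> space (PiM {..<n} (\<lambda>_. M)). (\<Prod>t<n. f (z t)) < exp (real n * (r - \<theta>))}) \<longlonglongrightarrow> 0"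
proof -
  have f_pos: "AE x in M. f x > 0" using ln_mean_f by (simp add: ln_mean_ge_def)
  obtain h where h_approx: "integrable M h" "r - \<theta> / 2 \<le> integral\<^sup>L M h" and "AE x in M. h x \<le> ln (f x)"
    using ln_mean_f half_gt_zero[OF \<theta>_pos] unfolding ln_mean_ge_def by blast
  with f_pos have h_le: "AE x in M. f x > 0 \<and> h x \<le> ln (f x)" by simp
  have deviation_tendsto_0: "(\<lambda>n. measure (PiM {..<n} (\<lambda>_. M)) {z \<in> space (PiM {..<n} (\<lambda>_. M)).
      real n * ((\<integral>x. - h x \<partial>M) + \<theta> / 2) < (\<Sum>t<n. - h (z t))}) \<longlonglongrightarrow> 0"
    by (rule weak_law_upper_tail[OF prob_space_M]) (use h_approx \<theta>_pos in auto)
  show ?thesis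
  proof (rule measure_tendsto_0_mono_AE[OF _ _ _ deviation_tendsto_0])
    fix n :: nat
    let ?P = "PiM {..<n} (\<lambda>_. M)"
    have [measurable]: "h \<in> borel_measurable M" using h_approx by auto
    show "finite_measure ?P" by (intro prob_space.finite_measure prob_space_PiM prob_space_M)
    show "{z \<in> space ?P. real n * ((\<integral>x. - h x \<partial>M) + \<theta> / 2) < (\<Sum>t<n. - h (z t))} \<in> sets ?P"
      by measurable
    have "\<forall>t\<in>{..<n}. AE z in ?P. f (z t) > 0 \<and> h (z t) \<le> ln (f (z t))"
      using AE_PiM_component[of "{..<n}" "\<lambda>_. M", OF prob_space_M _ h_le] by simp
    then have "AE z in ?P. \<forall>t\<in>{..<n}. f (z t) > 0 \<and> h (z t) \<le> ln (f (z t))"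
      by (simp add: AE_finite_all)
    then show "AE z in ?P. z \<in> {z \<in> space ?P. (\<Prod>t<n. f (z t)) < exp (real n * (r - \<theta>))} \<longrightarrow>
      z \<in> {z \<in> space ?P. real n * ((\<integral>x. - h x \<partial>M) + \<theta> / 2) < (\<Sum>t<n. - h (z t))}"
    proof (eventually_elim, intro impI CollectI conjI, simp)
      fix z assume good: "\<forall>t\<in>{..<n}. f (z t) > 0 \<and> h (z t) \<le> ln (f (z t))"
        and z_in: "z \<in> {z \<in> space ?P. (\<Prod>t<n. f (z t)) < exp (real n * (r - \<theta>))}"
      have product_pos: "0 < (\<Prod>t<n. f (z t))" using good by (intro prod_pos) auto
      have "(\<Sum>t<n. h (z t)) \<le> (\<Sum>t<n. ln (f (z t)))" using good by (intro sum_mono) auto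
      also have "\<dots> = ln (\<Prod>t<n. f (z t))" using good by (intro ln_prod[symmetric]) (auto dest!: bspec)
      also have "\<dots> < real n * (r - \<theta>)"
        using ln_strict_mono[OF _ product_pos, of "exp (real n * (r - \<theta>))"] z_in by simp
      also have "\<dots> \<le> real n * (integral\<^sup>L M h - \<theta> / 2)" using h_approx(2) by (intro mult_left_mono) auto
      finally show "real n * ((\<integral>x. - h x \<partial>M) + \<theta> / 2) < (\<Sum>t<n. - h (z t))"
        by (simp add: sum_negf algebra_simps)
    qed
  qed
qed

section \<open>Measurable selection and the Doob--Dynkin lemma\<close>

lemma doob_dynkin_ennreal:
  fixes f :: "'a \<Rightarrow> ennreal"
  assumes f_measurable: "f \<in> borel_measurable (vimage_algebra X B N)" and B_in: "B \<in> X \<rightarrow> space N"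
  shows "\<exists>h\<in>borel_measurable N. \<forall>x\<in>X. f x = h (B x)"
  using f_measurable
proof (induction rule: borel_measurable_induct)
  case (cong f g)
  then show ?case by auto
next
  case (set A)
  then obtain C where "C \<in> sets N" "A = B -` C \<inter> X" using B_in by (auto simp: sets_vimage_algebra2)
  then show ?case by (intro bexI[of _ "indicator C"]) (auto simp: indicator_def)
next
  case (mult u v)
  then obtain h where "h \<in> borel_measurable N" "\<forall>x\<in>X. u x = h (B x)" by blast
  then show ?case using mult by (intro bexI[of _ "\<lambda>y. v * h y"]) auto
next
  case (add u v)
  then obtain h k where "h \<in> borel_measurable N" "\<forall>x\<in>X. u x = h (B x)"
    "k \<in> borel_measurable N" "\<forall>x\<in>X. v x = k (B x)" by blast
  then show ?case by (intro bexI[of _ "\<lambda>y. k y + h y"]) auto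
next
  case (seq U)
  then have "\<forall>i. \<exists>h\<in>borel_measurable N. \<forall>x\<in>X. U i x = h (B x)" by blast
  then obtain h where h_factor: "\<And>i. h i \<in> borel_measurable N" "\<And>i x. x \<in> X \<Longrightarrow> U i x = h i (B x)" by metis
  show ?case
  proof (intro bexI[of _ "\<lambda>y. SUP i. h i y"] ballI)
    show "(SUP i. U i) x = (SUP i. h i (B x))" if "x \<in> X" for x
      using h_factor(2)[OF that] by (simp add: image_image)
  qed (use h_factor(1) in simp)
qed

lemma doob_dynkin:
  fixes f :: "'a \<Rightarrow> real"
  assumes f_measurable[measurable]: "f \<in> borel_measurable (vimage_algebra X B N)" and B_in: "B \<in> X \<rightarrow> space N"
  shows "\<exists>h\<in>borel_measurable N. \<forall>x\<in>X. f x = h (B x)"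
proof -
  obtain h where h_factor: "h \<in> borel_measurable N" "\<And>x. x \<in> X \<Longrightarrow> ennreal (f x) = h (B x)"
    using doob_dynkin_ennreal[OF _ B_in, of "\<lambda>x. ennreal (f x)"] by auto
  obtain k where k_factor: "k \<in> borel_measurable N" "\<And>x. x \<in> X \<Longrightarrow> ennreal (- f x) = k (B x)"
    using doob_dynkin_ennreal[OF _ B_in, of "\<lambda>x. ennreal (- f x)"] by auto
  have "f x = enn2real (h (B x)) - enn2real (k (B x))" if "x \<in> X" for x
    using that by (cases "f x \<ge> 0") (auto simp: h_factor(2)[symmetric] k_factor(2)[symmetric] ennreal_neg)
  then show ?thesis using h_factor(1) k_factor(1)
    by (intro bexI[of _ "\<lambda>y. enn2real (h y) - enn2real (k y)"]) auto
qed

lemma measurable_finite_selector_exists: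
  assumes "finite T" and "T \<noteq> {}" and "\<And>b. b \<in> T \<Longrightarrow> Measurable.pred N (Q b)"
  shows "\<exists>s\<in>measurable N (count_space T). \<forall>y. (\<exists>b\<in>T. Q b y) \<longrightarrow> Q (s y) y"
  using assms
proof (induction T rule: finite_ne_induct)
  case (singleton b)
  then show ?case by (intro bexI[of _ "\<lambda>_. b"]) auto
next
  case (insert b T)
  then obtain s where s_selects: "s \<in> measurable N (count_space T)" "\<And>y. \<exists>b\<in>T. Q b y \<Longrightarrow> Q (s y) y" by blast
  have [measurable]: "Measurable.pred N (Q b)" using insert.prems by simp
  have [measurable]: "s \<in> measurable N (count_space (insert b T))"
    using measurable_compose[OF s_selects(1), of "\<lambda>c. c" "count_space (insert b T)"] by simp
  have "(\<lambda>y. if Q b y then b else s y) \<in> measurable N (count_space (insert b T))" by measurable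
  then show ?case using s_selects(2) by (intro bexI[of _ "\<lambda>y. if Q b y then b else s y"]) auto
qed

lemma measurable_argmin_exists:
  fixes F :: "'i \<Rightarrow> 'a \<Rightarrow> 'b::{linorder_topology, second_countable_topology}"
  assumes I_finite: "finite I" "I \<noteq> {}" and F_measurable[measurable]: "\<And>i. i \<in> I \<Longrightarrow> F i \<in> borel_measurable N"
  shows "\<exists>f\<in>measurable N (count_space I). \<forall>v. \<forall>i\<in>I. F (f v) v \<le> F i v"
proof -
  have "\<exists>f\<in>measurable N (count_space I). \<forall>v. (\<exists>j\<in>I. \<forall>i\<in>I. F j v \<le> F i v) \<longrightarrow> (\<forall>i\<in>I. F (f v) v \<le> F i v)"
    by (rule measurable_finite_selector_exists[OF I_finite]) (use I_finite in measurable)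
  moreover have "\<exists>j\<in>I. \<forall>i\<in>I. F j v \<le> F i v" for v
    using ex_min_if_finite[of "(\<lambda>i. F i v) ` I"] I_finite by (force simp: not_less)
  ultimately show ?thesis by blast
qed

definition cond_emeasure :: "'a measure \<Rightarrow> 'x measure \<Rightarrow> ('a \<Rightarrow> 'x) \<Rightarrow> 'a set \<Rightarrow> 'x \<Rightarrow> ennreal" where
  "cond_emeasure Q SX x A = RN_deriv (distr Q SX x) (distr (density Q (indicator A)) SX x)"

lemma borel_measurable_cond_emeasure[measurable]: "cond_emeasure Q SX x A \<in> borel_measurable SX"
  unfolding cond_emeasure_def
  using borel_measurable_RN_deriv[of "distr Q SX x"] by (simp cong: measurable_cong_sets)

lemma nn_integral_cond_emeasure:
  assumes "prob_space Q" and x_measurable[measurable]: "x \<in> measurable Q SX" and A_sets[measurable]: "A \<in> sets Q"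
    and h_measurable[measurable]: "h \<in> borel_measurable SX"
  shows "(\<integral>\<^sup>+v. cond_emeasure Q SX x A v * h v \<partial>distr Q SX x) = (\<integral>\<^sup>+a. h (x a) * indicator A a \<partial>Q)"
proof -
  interpret Q: prob_space Q by fact
  interpret Qx: prob_space "distr Q SX x" by (rule Q.prob_space_distr) (rule x_measurable)
  have "absolutely_continuous (distr Q SX x) (distr (density Q (indicator A)) SX x)"
  proof (unfold absolutely_continuous_def, safe)
    fix N assume N_in: "N \<in> null_sets (distr Q SX x)"
    then have [measurable]: "N \<in> sets SX" by (auto simp: null_sets_def)
    have "AE a in Q. x a \<notin> N" using AE_distrD[OF x_measurable AE_not_in[OF N_in]] .
    then have "emeasure (density Q (indicator A)) (x -` N \<inter> space Q) = 0"
      by (subst emeasure_density) (auto simp: nn_integral_0_iff_AE indicator_def elim: AE_mp)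
    then show "N \<in> null_sets (distr (density Q (indicator A)) SX x)"
      by (auto simp: null_sets_def emeasure_distr)
  qed
  then have "(\<integral>\<^sup>+v. cond_emeasure Q SX x A v * h v \<partial>distr Q SX x)
    = integral\<^sup>N (distr (density Q (indicator A)) SX x) h"
    unfolding cond_emeasure_def by (subst Qx.RN_deriv_nn_integral) auto
  also have "\<dots> = (\<integral>\<^sup>+a. h (x a) * indicator A a \<partial>Q)"
    by (simp add: nn_integral_distr nn_integral_density mult.commute)
  finally show ?thesis .
qed

lemma argmin_le_twice_weighted_sum:
  fixes F p :: "'i \<Rightarrow> ennreal"
  assumes I_finite: "finite I" "i \<in> I" and min: "\<And>j. j \<in> I \<Longrightarrow> F i \<le> F j"
  shows "(\<Sum>j\<in>I. F j * (if i = j \<and> 1 \<le> 2 * (\<Sum>j\<in>I. p j) then 1 else 0)) \<le> 2 * (\<Sum>j\<in>I. F j * p j)"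
proof -
  have "(\<Sum>j\<in>I. F j * (if i = j \<and> 1 \<le> 2 * (\<Sum>j\<in>I. p j) then 1 else 0))
    = (\<Sum>j\<in>I. if i = j then F j * (if 1 \<le> 2 * (\<Sum>j\<in>I. p j) then 1 else 0) else 0)"
    by (intro sum.cong) auto
  also have "\<dots> = F i * (if 1 \<le> 2 * (\<Sum>j\<in>I. p j) then 1 else 0)" using I_finite by simp
  also have "\<dots> \<le> F i * (2 * (\<Sum>j\<in>I. p j))" by (intro mult_left_mono) auto
  also have "\<dots> = 2 * (\<Sum>j\<in>I. F i * p j)" by (simp add: sum_distrib_left[symmetric] mult_ac)
  also have "\<dots> \<le> 2 * (\<Sum>j\<in>I. F j * p j)" using min by (intro mult_left_mono sum_mono mult_right_mono) auto
  finally show ?thesis .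
qed

text \<open>A randomized encoder with weights \<open>p\<close> can be replaced by the deterministic encoder that
  minimizes the conditional failure probability.\<close>
lemma argmin_encoder_exists:
  fixes Q :: "'a measure" and p :: "'i \<Rightarrow> 'x \<Rightarrow> ennreal"
  assumes prob_space_Q: "prob_space Q" and x_measurable[measurable]: "x \<in> measurable Q SX"
    and I_finite: "finite I" "I \<noteq> {}"
    and fail: "\<And>i. i \<in> I \<Longrightarrow> fail i \<in> sets Q" and p_measurable: "\<And>i. i \<in> I \<Longrightarrow> p i \<in> borel_measurable SX"
  shows "\<exists>f\<in>measurable SX (count_space I). {a\<in>space Q. a \<in> fail (f (x a))} \<in> sets Q \<and>
    emeasure Q {a\<in>space Q. a \<in> fail (f (x a))} \<le> emeasure Q {a\<in>space Q. 2 * (\<Sum>i\<in>I. p i (x a)) < 1}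
      + 2 * (\<Sum>i\<in>I. \<integral>\<^sup>+a. p i (x a) * indicator (fail i) a \<partial>Q)"
proof -
  interpret Q: prob_space Q by fact
  note [measurable] = fail p_measurable
  let ?F = "\<lambda>i. cond_emeasure Q SX x (fail i)" and ?Qx = "distr Q SX x"
  have "\<exists>f\<in>measurable SX (count_space I). \<forall>v. \<forall>i\<in>I. ?F (f v) v \<le> ?F i v"
    by (rule measurable_argmin_exists[OF I_finite borel_measurable_cond_emeasure])
  then obtain f where f_encoder[measurable]: "f \<in> measurable SX (count_space I)"
    and min: "\<And>v i. i \<in> I \<Longrightarrow> ?F (f v) v \<le> ?F i v" by blast
  have f_in: "f v \<in> I" if "v \<in> space SX" for v using measurable_space[OF f_encoder that] by simp
  let ?E = "{a\<in>space Q. a \<in> fail (f (x a))}" and ?N = "\<lambda>v. \<Sum>i\<in>I. p i v"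
  have sum_measurable[measurable]: "?N \<in> borel_measurable SX" by (auto intro!: borel_measurable_sum)
  have "?E = (\<Union>i\<in>I. {a\<in>space Q. f (x a) = i} \<inter> fail i)"
    using f_in[OF measurable_space[OF x_measurable]] fail[THEN sets.sets_into_space] by blast
  moreover have "{a\<in>space Q. f (x a) = i} \<inter> fail i \<in> sets Q" if "i \<in> I" for i
    using that by measurable
  ultimately have failure_event_sets[measurable]: "?E \<in> sets Q" using I_finite(1) by (simp only: sets.finite_UN)
  let ?pick = "\<lambda>i v. if f v = i \<and> 1 \<le> 2 * ?N v then 1 else (0::ennreal)"
  have pick[measurable]: "?pick i \<in> borel_measurable SX" if "i \<in> I" for i
    using that by measurable
  have "emeasure Q ?E = (\<integral>\<^sup>+a. indicator ?E a \<partial>Q)" by simp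
  also have "\<dots> \<le> (\<integral>\<^sup>+a. indicator {a\<in>space Q. 2 * ?N (x a) < 1} a + (\<Sum>i\<in>I. ?pick i (x a) * indicator (fail i) a) \<partial>Q)"
  proof (rule nn_integral_mono)
    fix a assume a_space: "a \<in> space Q"
    have "(\<Sum>i\<in>I. ?pick i (x a) * indicator (fail i) a) \<ge> ?pick (f (x a)) (x a) * indicator (fail (f (x a))) a"
      by (rule member_le_sum[OF f_in]) (use measurable_space[OF x_measurable a_space] I_finite in auto)
    then show "indicator ?E a \<le> indicator {a\<in>space Q. 2 * ?N (x a) < 1} a + (\<Sum>i\<in>I. ?pick i (x a) * indicator (fail i) a)"
      using a_space by (auto simp: indicator_def not_less split: if_splits)
  qed
  also have "\<dots> = emeasure Q {a\<in>space Q. 2 * ?N (x a) < 1} + (\<Sum>i\<in>I. \<integral>\<^sup>+a. ?pick i (x a) * indicator (fail i) a \<partial>Q)"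
    by (subst nn_integral_add) (auto intro!: borel_measurable_sum nn_integral_sum)
  also have "(\<Sum>i\<in>I. \<integral>\<^sup>+a. ?pick i (x a) * indicator (fail i) a \<partial>Q) = (\<integral>\<^sup>+v. (\<Sum>i\<in>I. ?F i v * ?pick i v) \<partial>?Qx)"
    using nn_integral_cond_emeasure[OF prob_space_Q x_measurable fail pick] by (subst nn_integral_sum) auto
  also have "\<dots> \<le> (\<integral>\<^sup>+v. 2 * (\<Sum>i\<in>I. ?F i v * p i v) \<partial>?Qx)"
    using f_in by (intro nn_integral_mono argmin_le_twice_weighted_sum I_finite min) auto
  also have "\<dots> = 2 * (\<Sum>i\<in>I. \<integral>\<^sup>+v. ?F i v * p i v \<partial>?Qx)"
    by (simp add: nn_integral_cmult nn_integral_sum)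
  also have "\<dots> = 2 * (\<Sum>i\<in>I. \<integral>\<^sup>+a. p i (x a) * indicator (fail i) a \<partial>Q)"
    using nn_integral_cond_emeasure[OF prob_space_Q x_measurable fail p_measurable] by simp
  finally show ?thesis using f_encoder failure_event_sets by (intro bexI[of _ f]) (auto intro: add_left_mono)
qed

section \<open>Random codebooks\<close>

lemma exp_neg_sum_eq_prod:
  fixes r :: "'s \<Rightarrow> real"
  assumes "finite I"
  shows "exp (- real n * ((\<Sum>S\<in>{S\<in>I. Q S}. r S) - \<theta>))
    = exp (real n * \<theta>) * (\<Prod>S\<in>I. if Q S then exp (- real n * r S) else 1)"
proof -
  have "exp (- real n * ((\<Sum>S\<in>{S\<in>I. Q S}. r S) - \<theta>))
    = exp (real n * \<theta>) * exp (\<Sum>S\<in>{S\<in>I. Q S}. - real n * r S)"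
    unfolding exp_add[symmetric] by (simp add: sum_distrib_left[symmetric] algebra_simps sum_negf)
  also have "exp (\<Sum>S\<in>{S\<in>I. Q S}. - real n * r S) = (\<Prod>S\<in>{S\<in>I. Q S}. exp (- real n * r S))"
    using assms by (intro exp_sum) simp
  finally show ?thesis by (simp only: prod.inter_filter[OF assms])
qed

text \<open>
  \<open>\<rho> S x u\<close> stands for the density of \<open>((X, U before S), U\<^sub>S)\<close>, and \<open>g l D S y u\<close> for that of
  \<open>(U\<^sub>S, (U before S within D, U outside D, Y\<^sub>l))\<close>, relative to the product of the marginals. They are
  normalized so that the integral over the \<open>S\<close>-coordinate is at most 1 everywhere, not only almost
  everywhere.
\<close>
locale codebook_densities =
  fixes P :: "'a measure" and SX :: "'x measure" and px :: "'a \<Rightarrow> 'x"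
    and q :: "'s \<Rightarrow> 'u measure" and vs :: "'s list"
    and \<rho> :: "'s \<Rightarrow> 'x \<Rightarrow> ('s \<Rightarrow> 'u) \<Rightarrow> real"
    and m :: nat and DS :: "nat \<Rightarrow> 's set"
    and SY :: "nat \<Rightarrow> 'y measure" and py :: "nat \<Rightarrow> 'a \<Rightarrow> 'y"
    and g :: "nat \<Rightarrow> 's set \<Rightarrow> 's \<Rightarrow> 'y \<Rightarrow> ('s \<Rightarrow> 'u) \<Rightarrow> real"
    and R R' :: "'s \<Rightarrow> real"
  assumes prob_space_P: "prob_space P" and px_measurable[measurable]: "px \<in> measurable P SX"
    and py_measurable: "\<And>l. l < m \<Longrightarrow> py l \<in> measurable P (SY l)"
    and prob_space_q: "\<And>S. prob_space (q S)" and distinct_vs: "distinct vs"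
    and DS_subset: "\<And>l. l < m \<Longrightarrow> DS l \<subseteq> set vs"
    and rho_measurable: "\<And>S. S \<in> set vs \<Longrightarrow>
        (\<lambda>z. \<rho> S (fst z) (snd z)) \<in> borel_measurable (SX \<Otimes>\<^sub>M PiM (set vs) q)"
    and rho_nonneg: "\<And>S x u. \<rho> S x u \<ge> 0"
    and rho_ignores: "sorted_wrt (\<lambda>S S'. \<forall>x. ignores (\<rho> S x) S') vs"
    and rho_subdensity: "\<And>S x u. S \<in> set vs \<Longrightarrow> x \<in> space SX \<Longrightarrow> u \<in> space (PiM (set vs) q) \<Longrightarrow>
        (\<integral>\<^sup>+v. ennreal (\<rho> S x (u(S := v))) \<partial>q S) \<le> 1"
    and g_measurable: "\<And>l D S. l < m \<Longrightarrow> D \<subseteq> DS l \<Longrightarrow> S \<in> D \<Longrightarrow>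
        (\<lambda>z. g l D S (fst z) (snd z)) \<in> borel_measurable (SY l \<Otimes>\<^sub>M PiM (DS l) q)"
    and g_nonneg: "\<And>l D S y u. g l D S y u \<ge> 0"
    and g_ignores: "\<And>l D. l < m \<Longrightarrow> D \<subseteq> DS l \<Longrightarrow>
        sorted_wrt (\<lambda>S S'. \<forall>y. ignores (g l D S y) S') (filter (\<lambda>S. S \<in> D) vs)"
    and g_subdensity: "\<And>l D S y u. l < m \<Longrightarrow> D \<subseteq> DS l \<Longrightarrow> S \<in> D \<Longrightarrow> y \<in> space (SY l) \<Longrightarrow>
        u \<in> space (PiM (DS l) q) \<Longrightarrow> (\<integral>\<^sup>+v. ennreal (g l D S y (u(S := v))) \<partial>q S) \<le> 1"
begin

definition indep_law :: "('a \<times> ('s \<Rightarrow> 'u)) measure" where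
  "indep_law = P \<Otimes>\<^sub>M PiM (set vs) q"

definition joint_density :: "'a \<times> ('s \<Rightarrow> 'u) \<Rightarrow> ennreal" where
  "joint_density z = (\<Prod>S\<in>set vs. ennreal (\<rho> S (px (fst z)) (snd z)))"

definition joint_law :: "('a \<times> ('s \<Rightarrow> 'u)) measure" where
  "joint_law = density indep_law joint_density"

definition enc_typical :: "nat \<Rightarrow> real \<Rightarrow> (nat \<Rightarrow> 'x) \<Rightarrow> (nat \<Rightarrow> 's \<Rightarrow> 'u) \<Rightarrow> bool" where
  "enc_typical n \<theta> xs us \<longleftrightarrow>
     (\<forall>S\<in>set vs. (\<Prod>t<n. \<rho> S (xs t) (us t)) \<le> exp (real n * (R S + R' S + \<theta>)))"

definition dec_typical :: "nat \<Rightarrow> real \<Rightarrow> nat \<Rightarrow> (nat \<Rightarrow> 'y) \<Rightarrow> (nat \<Rightarrow> 's \<Rightarrow> 'u) \<Rightarrow> bool" where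
  "dec_typical n \<theta> l ys us \<longleftrightarrow> (\<forall>D\<in>Pow (DS l) - {{}}.
     exp (real n * ((\<Sum>S\<in>D. R' S) - \<theta>)) \<le> (\<Prod>t<n. \<Prod>S\<in>D. g l D S (ys t) (us t)))"

lemma finite_DS: "l < m \<Longrightarrow> finite (DS l)"
  using DS_subset by (rule finite_subset) auto

lemma prob_space_indep_law: "prob_space indep_law"
  unfolding indep_law_def by (intro prob_space_pair prob_space_P prob_space_PiM prob_space_q)

lemma sets_joint_law[measurable_cong]: "sets joint_law = sets indep_law"
  by (simp add: joint_law_def)

lemma sets_PiM_joint_law[measurable_cong]:
  "sets (PiM K (\<lambda>_. joint_law)) = sets (PiM K (\<lambda>_. indep_law))"
  by (intro sets_PiM_cong) (simp_all add: sets_joint_law)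

lemma rho_comp_measurable:
  assumes "S \<in> set vs" and [measurable]: "X \<in> measurable M SX" "U \<in> measurable M (PiM (set vs) q)"
  shows "(\<lambda>z. \<rho> S (X z) (U z)) \<in> borel_measurable M"
proof -
  have "(\<lambda>z. (X z, U z)) \<in> measurable M (SX \<Otimes>\<^sub>M PiM (set vs) q)" by measurable
  from measurable_compose[OF this rho_measurable[OF assms(1)]] show ?thesis by simp
qed

lemma g_comp_measurable:
  assumes "l < m" "D \<subseteq> DS l" "S \<in> D"
    and [measurable]: "Y \<in> measurable M (SY l)" "U \<in> measurable M (PiM (DS l) q)"
  shows "(\<lambda>z. g l D S (Y z) (U z)) \<in> borel_measurable M"
proof -
  have "(\<lambda>z. (Y z, U z)) \<in> measurable M (SY l \<Otimes>\<^sub>M PiM (DS l) q)" by measurable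
  from measurable_compose[OF this g_measurable[OF assms(1-3)]] show ?thesis by simp
qed

lemma
  shows fst_indep_law[measurable]: "fst \<in> measurable indep_law P"
    and snd_indep_law[measurable]: "snd \<in> measurable indep_law (PiM (set vs) q)"
  unfolding indep_law_def by measurable

lemma joint_density_measurable[measurable]: "joint_density \<in> borel_measurable indep_law"
  unfolding joint_density_def
  by (intro borel_measurable_prod_ennreal measurable_compose[OF rho_comp_measurable measurable_ennreal]) measurable

lemma enc_typical_measurable:
  assumes X_measurable: "\<And>t. t < n \<Longrightarrow> X t \<in> measurable M SX"
    and U_measurable: "\<And>t. t < n \<Longrightarrow> U t \<in> measurable M (PiM (set vs) q)"
  shows "Measurable.pred M (\<lambda>z. enc_typical n \<theta> (\<lambda>t. X t z) (\<lambda>t. U t z))"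
proof -
  have [measurable]: "(\<lambda>z. \<Prod>t<n. \<rho> S (X t z) (U t z)) \<in> borel_measurable M" if "S \<in> set vs" for S
    using X_measurable U_measurable that by (intro borel_measurable_prod rho_comp_measurable) auto
  show ?thesis unfolding enc_typical_def by measurable
qed

lemma dec_typical_measurable:
  assumes l_less: "l < m" and Y_measurable: "\<And>t. t < n \<Longrightarrow> Y t \<in> measurable M (SY l)"
    and U_measurable: "\<And>t. t < n \<Longrightarrow> U t \<in> measurable M (PiM (DS l) q)"
  shows "Measurable.pred M (\<lambda>z. dec_typical n \<theta> l (\<lambda>t. Y t z) (\<lambda>t. U t z))"
proof -
  have [measurable]: "(\<lambda>z. \<Prod>t<n. \<Prod>S\<in>D. g l D S (Y t z) (U t z)) \<in> borel_measurable M"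
    if "D \<in> Pow (DS l) - {{}}" for D
    using Y_measurable U_measurable l_less that by (intro borel_measurable_prod g_comp_measurable) auto
  have "finite (Pow (DS l) - {{}})" using finite_DS[OF l_less] by auto
  then show ?thesis unfolding dec_typical_def by measurable
qed

lemma dec_typical_restrict_measurable:
  assumes l_less: "l < m"
  shows "Measurable.pred (PiM {..<n} (\<lambda>_. indep_law))
    (\<lambda>z. dec_typical n \<theta> l (\<lambda>t. py l (fst (z t))) (\<lambda>t. restrict (snd (z t)) (DS l)))"
proof (rule dec_typical_measurable[OF l_less])
  note [measurable] = py_measurable[OF l_less]
  fix t assume "t < n"
  then have [measurable]: "(\<lambda>z. z t) \<in> measurable (PiM {..<n} (\<lambda>_. indep_law)) indep_law" by simp
  show "(\<lambda>z. py l (fst (z t))) \<in> measurable (PiM {..<n} (\<lambda>_. indep_law)) (SY l)" by measurable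
  show "(\<lambda>z. restrict (snd (z t)) (DS l)) \<in> measurable (PiM {..<n} (\<lambda>_. indep_law)) (PiM (DS l) q)"
    by (rule measurable_compose[OF _ measurable_restrict_subset[OF DS_subset[OF l_less]]]) measurable
qed

lemma enc_typical_cong:
  assumes "\<And>t. t < n \<Longrightarrow> xs t = xs' t" and "\<And>t. t < n \<Longrightarrow> us t = us' t"
  shows "enc_typical n \<theta> xs us \<longleftrightarrow> enc_typical n \<theta> xs' us'"
  unfolding enc_typical_def using assms by simp

lemma dec_typical_cong:
  assumes "\<And>t. t < n \<Longrightarrow> ys t = ys' t" and "\<And>t. t < n \<Longrightarrow> us t = us' t"
  shows "dec_typical n \<theta> l ys us \<longleftrightarrow> dec_typical n \<theta> l ys' us'"
  unfolding dec_typical_def using assms by simp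

end

text \<open>
  In a codeword index \<open>(a, b)\<close>, \<open>a\<close> is the transmitted bin and \<open>b\<close> the position inside the bin. The
  predicate \<open>accept\<close> is the part of joint typicality that controls the distortion.
\<close>
locale random_codebook = codebook_densities P SX px q vs \<rho> m DS SY py g R R'
  for P :: "'a measure" and SX :: "'x measure" and px
    and q :: "'s \<Rightarrow> 'u measure" and vs and \<rho> and m and DS
    and SY :: "nat \<Rightarrow> 'y measure" and py and g and R R' +
  fixes n :: nat and A B :: "'s \<Rightarrow> nat" and \<theta> :: real
    and accept :: "(nat \<Rightarrow> 'a \<times> ('s \<Rightarrow> 'u)) \<Rightarrow> bool"
  assumes prob_space_joint_law: "prob_space joint_law"
    and A_pos: "\<And>S. A S > 0" and B_pos: "\<And>S. B S > 0"
    and accept_measurable[measurable]: "Measurable.pred (PiM {..<n} (\<lambda>_. indep_law)) accept"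
begin

definition word_indices :: "'s \<Rightarrow> (nat \<times> nat) set" where
  "word_indices S = {..<A S} \<times> {..<B S}"

definition codebook_indices :: "('s \<times> nat \<times> nat) set" where
  "codebook_indices = Sigma (set vs) word_indices"

definition codebook_law :: "('s \<times> nat \<times> nat \<Rightarrow> 'u) measure" where
  "codebook_law = PiM codebook_indices (\<lambda>k. q (fst k))"

definition trial_law :: "('a \<times> ('s \<times> nat \<times> nat \<Rightarrow> 'u)) measure" where
  "trial_law = P \<Otimes>\<^sub>M codebook_law"

definition selections :: "('s \<Rightarrow> nat \<times> nat) set" where
  "selections = PiE (set vs) word_indices"

definition positions :: "nat \<Rightarrow> ('s \<Rightarrow> nat) set" where
  "positions l = PiE (DS l) (\<lambda>S. {..<B S})"

definition chosen :: "('s \<Rightarrow> nat \<times> nat) \<Rightarrow> ('s \<times> nat \<times> nat \<Rightarrow> 'u) \<Rightarrow> 's \<Rightarrow> 'u" where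
  "chosen j c = (\<lambda>S\<in>set vs. c (S, j S))"

definition candidate :: "nat \<Rightarrow> ('s \<Rightarrow> nat) \<Rightarrow> ('s \<Rightarrow> nat) \<Rightarrow> ('s \<times> nat \<times> nat \<Rightarrow> 'u) \<Rightarrow> 's \<Rightarrow> 'u" where
  "candidate l a b c = (\<lambda>S\<in>DS l. c (S, a S, b S))"

lemma finite_codebook_indices: "finite codebook_indices"
  by (auto simp: codebook_indices_def word_indices_def)

lemma finite_selections: "finite selections"
  by (auto simp: selections_def word_indices_def intro!: finite_PiE)

lemma finite_positions: "l < m \<Longrightarrow> finite (positions l)"
  by (auto simp: positions_def finite_DS intro!: finite_PiE)

lemma card_selections: "real (card selections) = (\<Prod>S\<in>set vs. real (A S * B S))"
  unfolding selections_def word_indices_def by (subst card_PiE) (auto simp: card_cartesian_product)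

lemma card_selections_pos: "card selections > 0"
proof -
  have "(\<Prod>S\<in>set vs. real (A S * B S)) > 0" using A_pos B_pos by (intro prod_pos) auto
  then show ?thesis using card_selections by simp
qed

lemma selection_index: "j \<in> selections \<Longrightarrow> S \<in> set vs \<Longrightarrow> (S, j S) \<in> codebook_indices"
  by (auto simp: selections_def codebook_indices_def)

lemma candidate_index:
  assumes "j \<in> selections" "l < m" "b \<in> positions l" "S \<in> DS l"
  shows "(S, fst (j S), b S) \<in> codebook_indices"
proof -
  have "S \<in> set vs" using DS_subset assms by auto
  then have "j S \<in> word_indices S" "b S < B S"
    using assms by (auto simp: selections_def positions_def PiE_iff)
  then show ?thesis using \<open>S \<in> set vs\<close> by (auto simp: codebook_indices_def word_indices_def)
qed

lemma prob_space_codebook_law: "prob_space codebook_law"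
  unfolding codebook_law_def by (rule prob_space_PiM) (rule prob_space_q)

lemma prob_space_trial_law: "prob_space trial_law"
  unfolding trial_law_def by (intro prob_space_pair prob_space_P prob_space_codebook_law)

lemma
  shows fst_trial_law[measurable]: "fst \<in> measurable trial_law P"
    and snd_trial_law[measurable]: "snd \<in> measurable trial_law codebook_law"
  unfolding trial_law_def by measurable

lemma codeword_measurable:
  assumes "(S, i) \<in> codebook_indices" shows "(\<lambda>c. c (S, i)) \<in> measurable codebook_law (q S)"
  using measurable_component_singleton[OF assms, of "\<lambda>k. q (fst k)"] by (simp add: codebook_law_def)

lemma chosen_measurable[measurable]:
  assumes "j \<in> selections" shows "chosen j \<in> measurable codebook_law (PiM (set vs) q)"
  unfolding chosen_def by (intro measurable_restrict codeword_measurable selection_index assms)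

lemma candidate_measurable[measurable]:
  assumes "j \<in> selections" "l < m" "b \<in> positions l"
  shows "candidate l (\<lambda>S. fst (j S)) b \<in> measurable codebook_law (PiM (DS l) q)"
  unfolding candidate_def by (intro measurable_restrict codeword_measurable candidate_index[OF assms])

lemma chosen_fun_upd: "S \<in> set vs \<Longrightarrow> chosen j (c((S, j S) := v)) = (chosen j c)(S := v)"
  by (auto simp: chosen_def fun_eq_iff)

lemma chosen_ignores: "i \<noteq> j S \<Longrightarrow> ignores (chosen j) (S, i)"
  by (auto simp: ignores_def chosen_def fun_eq_iff)

lemma candidate_fun_upd:
  "S \<in> DS l \<Longrightarrow> candidate l a b (c((S, a S, b S) := v)) = (candidate l a b c)(S := v)"
  by (auto simp: candidate_def fun_eq_iff)

subsection \<open>Integrals over the codebook\<close>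

definition chosen_chain where
  "chosen_chain x j Ss = map (\<lambda>S. ((S, j S), \<lambda>c. ennreal (\<rho> S x (chosen j c)))) Ss"

definition candidate_chain where
  "candidate_chain l D y j b Ss =
     map (\<lambda>S. ((S, fst (j S), b S), \<lambda>c. ennreal (g l D S y (candidate l (\<lambda>S. fst (j S)) b c)))) Ss"

lemma prod_list_chosen_chain:
  "distinct Ss \<Longrightarrow> (\<Prod>(k, h)\<leftarrow>chosen_chain x j Ss. h c) = (\<Prod>S\<in>set Ss. ennreal (\<rho> S x (chosen j c)))"
  by (simp add: chosen_chain_def comp_def prod.distinct_set_conv_list)

lemma prod_list_candidate_chain:
  "distinct Ss \<Longrightarrow> (\<Prod>(k, h)\<leftarrow>candidate_chain l D y j b Ss. h c) =
    (\<Prod>S\<in>set Ss. ennreal (g l D S y (candidate l (\<lambda>S. fst (j S)) b c)))"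
  by (simp add: candidate_chain_def comp_def prod.distinct_set_conv_list)

lemma subdensity_chain_chosen:
  assumes j_in: "j \<in> selections" and x_space: "x \<in> space SX"
  shows "subdensity_chain codebook_indices (\<lambda>k. q (fst k)) (chosen_chain x j vs)"
  unfolding chosen_chain_def subdensity_chain_map codebook_law_def[symmetric] fst_conv
proof (intro conjI ballI)
  show "sorted_wrt (\<lambda>S S'. ignores (\<lambda>c. ennreal (\<rho> S x (chosen j c))) (S', j S')) vs"
    by (rule sorted_wrt_mono_rel[OF _ rho_ignores]) (simp add: ignores_def chosen_fun_upd del: fun_upd_apply)
  fix S assume S_in: "S \<in> set vs"
  show "(S, j S) \<in> codebook_indices" by (rule selection_index[OF j_in S_in])
  show "(\<lambda>c. ennreal (\<rho> S x (chosen j c))) \<in> borel_measurable codebook_law"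
    using x_space j_in by (intro measurable_compose[OF rho_comp_measurable[OF S_in] measurable_ennreal]) measurable
  show "(\<integral>\<^sup>+v. ennreal (\<rho> S x (chosen j (c((S, j S) := v)))) \<partial>q S) \<le> 1" if "c \<in> space codebook_law" for c
    unfolding chosen_fun_upd[OF S_in]
    by (rule rho_subdensity[OF S_in x_space measurable_space[OF chosen_measurable[OF j_in] that]])
qed

lemma subdensity_chain_candidate:
  assumes j_in: "j \<in> selections" and l_less: "l < m" and b_in: "b \<in> positions l" and D_subset: "D \<subseteq> DS l"
    and y_space: "y \<in> space (SY l)"
  shows "subdensity_chain codebook_indices (\<lambda>k. q (fst k)) (candidate_chain l D y j b (filter (\<lambda>S. S \<in> D) vs))"
  unfolding candidate_chain_def subdensity_chain_map codebook_law_def[symmetric] fst_conv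
proof (intro conjI ballI)
  let ?cand = "candidate l (\<lambda>S. fst (j S)) b"
  show "sorted_wrt (\<lambda>S S'. ignores (\<lambda>c. ennreal (g l D S y (?cand c))) (S', fst (j S'), b S'))
      (filter (\<lambda>S. S \<in> D) vs)"
    by (rule sorted_wrt_mono_rel[OF _ g_ignores[OF l_less D_subset]])
      (use D_subset in \<open>auto simp: ignores_def subset_eq candidate_fun_upd[where a="\<lambda>S. fst (j S)"] simp del: fun_upd_apply\<close>)
  fix S assume "S \<in> set (filter (\<lambda>S. S \<in> D) vs)"
  then have S_in: "S \<in> D" and S_DS: "S \<in> DS l" using D_subset by auto
  show "(S, fst (j S), b S) \<in> codebook_indices" by (rule candidate_index[OF j_in l_less b_in S_DS])
  show "(\<lambda>c. ennreal (g l D S y (?cand c))) \<in> borel_measurable codebook_law"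
    using y_space j_in l_less b_in
    by (intro measurable_compose[OF g_comp_measurable[OF l_less D_subset S_in] measurable_ennreal]) measurable
  show "(\<integral>\<^sup>+v. ennreal (g l D S y (?cand (c((S, fst (j S), b S) := v)))) \<partial>q S) \<le> 1"
    if "c \<in> space codebook_law" for c
    unfolding candidate_fun_upd[OF S_DS, where a="\<lambda>S. fst (j S)"]
    using measurable_space[OF candidate_measurable[OF j_in l_less b_in] that]
    by (rule g_subdensity[OF l_less D_subset S_in y_space])
qed

lemma nn_integral_chosen_chain_append_le_1:
  assumes j_in: "j \<in> selections" and x_space: "x \<in> space SX"
    and hs_chain: "subdensity_chain codebook_indices (\<lambda>k. q (fst k)) hs"
    and fresh: "\<And>S i h. ((S, i), h) \<in> set hs \<Longrightarrow> i \<noteq> j S"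
  shows "(\<integral>\<^sup>+c. (\<Prod>S\<in>set vs. ennreal (\<rho> S x (chosen j c))) * (\<Prod>(k, h)\<leftarrow>hs. h c) \<partial>codebook_law) \<le> 1"
proof -
  have "ignores h k'" if "(k, h) \<in> set (chosen_chain x j vs)" "(k', h') \<in> set hs" for k h k' h'
    using that fresh[of "fst k'" "snd k'" h'] ignores_compose[OF chosen_ignores[of "snd k'" j "fst k'"]]
    by (auto simp: chosen_chain_def)
  then have "subdensity_chain codebook_indices (\<lambda>k. q (fst k)) (chosen_chain x j vs @ hs)"
    using hs_chain subdensity_chain_chosen[OF j_in x_space] by (auto simp: subdensity_chain_append)
  from nn_integral_subdensity_chain_le_1[OF prob_space_q finite_codebook_indices this]
  show ?thesis by (simp add: prod_list_chosen_chain distinct_vs codebook_law_def)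
qed

lemma nn_integral_two_selections_le_1:
  assumes j_in: "j \<in> selections" and j'_in: "j' \<in> selections" and x_space: "x \<in> space SX"
  shows "(\<integral>\<^sup>+c. (\<Prod>S\<in>set vs. ennreal (\<rho> S x (chosen j' c))) *
      (\<Prod>S\<in>{S\<in>set vs. j S \<noteq> j' S}. ennreal (\<rho> S x (chosen j c))) \<partial>codebook_law) \<le> 1"
proof -
  let ?ws = "filter (\<lambda>S. j S \<noteq> j' S) vs"
  have "chosen_chain x j ?ws = filter (\<lambda>(k, h). snd k \<noteq> j' (fst k)) (chosen_chain x j vs)"
    by (simp add: chosen_chain_def filter_map comp_def)
  then have "subdensity_chain codebook_indices (\<lambda>k. q (fst k)) (chosen_chain x j ?ws)"
    by (simp only: subdensity_chain_filter subdensity_chain_chosen[OF j_in x_space])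
  moreover have "i \<noteq> j' S" if "((S, i), h) \<in> set (chosen_chain x j ?ws)" for S i h
    using that by (auto simp: chosen_chain_def)
  ultimately have "(\<integral>\<^sup>+c. (\<Prod>S\<in>set vs. ennreal (\<rho> S x (chosen j' c))) *
      (\<Prod>(k, h)\<leftarrow>chosen_chain x j ?ws. h c) \<partial>codebook_law) \<le> 1"
    by (rule nn_integral_chosen_chain_append_le_1[OF j'_in x_space])
  then show ?thesis by (simp add: prod_list_chosen_chain distinct_vs)
qed

lemma nn_integral_selection_candidate_le_1:
  assumes j_in: "j \<in> selections" and l_less: "l < m" and b_in: "b \<in> positions l"
    and D_eq: "D = {S\<in>DS l. b S \<noteq> snd (j S)}" and x_space: "x \<in> space SX" and y_space: "y \<in> space (SY l)"
  shows "(\<integral>\<^sup>+c. (\<Prod>S\<in>set vs. ennreal (\<rho> S x (chosen j c))) *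
      (\<Prod>S\<in>D. ennreal (g l D S y (candidate l (\<lambda>S. fst (j S)) b c))) \<partial>codebook_law) \<le> 1"
proof -
  have sub: "D \<subseteq> DS l" and set_filter: "set (filter (\<lambda>S. S \<in> D) vs) = D" using D_eq DS_subset[OF l_less] by auto
  have "i \<noteq> j S" if "((S, i), h) \<in> set (candidate_chain l D y j b (filter (\<lambda>S. S \<in> D) vs))" for S i h
  proof -
    have "b S \<noteq> snd (j S)" and "i = (fst (j S), b S)" using that by (auto simp: candidate_chain_def D_eq)
    then show ?thesis by (metis snd_conv)
  qed
  from nn_integral_chosen_chain_append_le_1[OF j_in x_space
      subdensity_chain_candidate[OF j_in l_less b_in sub y_space] this]
  show ?thesis by (simp only: prod_list_candidate_chain distinct_filter distinct_vs set_filter)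
qed

subsection \<open>Covering\<close>

definition chosen_block ::
    "('s \<Rightarrow> nat \<times> nat) \<Rightarrow> (nat \<Rightarrow> 'a \<times> ('s \<times> nat \<times> nat \<Rightarrow> 'u)) \<Rightarrow> nat \<Rightarrow> 'a \<times> ('s \<Rightarrow> 'u)" where
  "chosen_block j = compose {..<n} (\<lambda>z. (fst z, chosen j (snd z)))"

definition block_density :: "(nat \<Rightarrow> 'a \<times> ('s \<Rightarrow> 'u)) \<Rightarrow> ennreal" where
  "block_density z = (\<Prod>t<n. joint_density (z t))"

definition enc_typical_block :: "(nat \<Rightarrow> 'a \<times> ('s \<Rightarrow> 'u)) \<Rightarrow> bool" where
  "enc_typical_block z \<longleftrightarrow> enc_typical n \<theta> (\<lambda>t. px (fst (z t))) (\<lambda>t. snd (z t))"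

lemma chosen_block_nth: "t < n \<Longrightarrow> chosen_block j z t = (fst (z t), chosen j (snd (z t)))"
  by (simp add: chosen_block_def compose_def)

lemma chosen_letter_measurable[measurable]:
  assumes [measurable]: "j \<in> selections"
  shows "(\<lambda>z. (fst z, chosen j (snd z))) \<in> measurable trial_law indep_law"
  unfolding trial_law_def indep_law_def by measurable

lemma distr_chosen:
  assumes j_in: "j \<in> selections"
  shows "distr codebook_law (PiM (set vs) q) (chosen j) = PiM (set vs) q"
proof -
  have "distr (PiM codebook_indices (\<lambda>k. q (fst k))) (\<Pi>\<^sub>M S\<in>set vs. q (fst (S, j S))) (\<lambda>c. \<lambda>S\<in>set vs. c (S, j S))
     = (\<Pi>\<^sub>M S\<in>set vs. q (fst (S, j S)))"
    by (rule distr_PiM_reindex) (use j_in in \<open>auto simp: inj_on_def prob_space_q selection_index\<close>)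
  then show ?thesis by (simp add: codebook_law_def chosen_def[abs_def])
qed

lemma distr_chosen_letter:
  assumes j_in: "j \<in> selections"
  shows "distr trial_law indep_law (\<lambda>z. (fst z, chosen j (snd z))) = indep_law"
proof -
  have "sigma_finite_measure (PiM (set vs) q)"
    by (intro prob_space_imp_sigma_finite prob_space_PiM prob_space_q)
  then have "distr P P (\<lambda>x. x) \<Otimes>\<^sub>M distr codebook_law (PiM (set vs) q) (chosen j)
    = distr (P \<Otimes>\<^sub>M codebook_law) (P \<Otimes>\<^sub>M PiM (set vs) q) (\<lambda>(x, y). (x, chosen j y))"
    by (intro pair_measure_distr) (auto simp: distr_chosen[OF j_in] intro: chosen_measurable[OF j_in])
  then show ?thesis
    by (simp add: distr_chosen[OF j_in] trial_law_def indep_law_def case_prod_beta' distr_id)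
qed

lemma chosen_block_measurable[measurable]:
  assumes [measurable]: "j \<in> selections"
  shows "chosen_block j \<in> measurable (PiM {..<n} (\<lambda>_. trial_law)) (PiM {..<n} (\<lambda>_. indep_law))"
  unfolding chosen_block_def compose_def by measurable

lemma distr_chosen_block:
  assumes j_in: "j \<in> selections"
  shows "distr (PiM {..<n} (\<lambda>_. trial_law)) (PiM {..<n} (\<lambda>_. indep_law)) (chosen_block j)
      = PiM {..<n} (\<lambda>_. indep_law)"
  unfolding chosen_block_def
  by (subst distr_PiM_finite_prob_space')
    (auto simp: distr_chosen_letter[OF j_in]
      intro: prob_space_trial_law prob_space_indep_law chosen_letter_measurable j_in)

lemma block_density_measurable[measurable]: "block_density \<in> borel_measurable (PiM {..<n} (\<lambda>_. indep_law))"
  unfolding block_density_def by measurable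

lemma enc_typical_block_measurable[measurable]: "Measurable.pred (PiM {..<n} (\<lambda>_. indep_law)) enc_typical_block"
  unfolding enc_typical_block_def by (intro enc_typical_measurable) measurable

lemma nn_integral_chosen_block:
  assumes j_in[measurable]: "j \<in> selections" and [measurable]: "F \<in> borel_measurable (PiM {..<n} (\<lambda>_. indep_law))"
  shows "(\<integral>\<^sup>+z. block_density (chosen_block j z) * F (chosen_block j z) \<partial>PiM {..<n} (\<lambda>_. trial_law))
    = (\<integral>\<^sup>+z. F z \<partial>PiM {..<n} (\<lambda>_. joint_law))"
proof -
  have "(\<integral>\<^sup>+z. block_density (chosen_block j z) * F (chosen_block j z) \<partial>PiM {..<n} (\<lambda>_. trial_law))
    = (\<integral>\<^sup>+z. block_density z * F z \<partial>distr (PiM {..<n} (\<lambda>_. trial_law)) (PiM {..<n} (\<lambda>_. indep_law)) (chosen_block j))"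
    by (subst nn_integral_distr) auto
  also have "\<dots> = (\<integral>\<^sup>+z. F z \<partial>density (PiM {..<n} (\<lambda>_. indep_law)) block_density)"
    by (simp add: distr_chosen_block[OF j_in] nn_integral_density)
  also have "density (PiM {..<n} (\<lambda>_. indep_law)) block_density = PiM {..<n} (\<lambda>_. joint_law)"
    unfolding joint_law_def block_density_def
    by (subst PiM_density) (auto simp: prob_space_indep_law prob_space_joint_law[unfolded joint_law_def])
  finally show ?thesis .
qed

definition weight :: "('s \<Rightarrow> nat \<times> nat) \<Rightarrow> (nat \<Rightarrow> 'x) \<Rightarrow> (nat \<Rightarrow> 's \<times> nat \<times> nat \<Rightarrow> 'u) \<Rightarrow> ennreal" where
  "weight j xs c = (\<Prod>t<n. \<Prod>S\<in>set vs. ennreal (\<rho> S (xs t) (chosen j (c t)))) *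
     of_bool (enc_typical n \<theta> xs (\<lambda>t. chosen j (c t)))"

definition trial_weight :: "('s \<Rightarrow> nat \<times> nat) \<Rightarrow> (nat \<Rightarrow> 'a \<times> ('s \<times> nat \<times> nat \<Rightarrow> 'u)) \<Rightarrow> ennreal" where
  "trial_weight j z = weight j (\<lambda>t. px (fst (z t))) (\<lambda>t. snd (z t))"

definition enc_bound :: "'s \<Rightarrow> real" where
  "enc_bound S = exp (real n * (R S + R' S + \<theta>))"

lemma enc_bound_nonneg: "enc_bound S \<ge> 0"
  by (simp add: enc_bound_def)

lemma block_density_chosen_block:
  "block_density (chosen_block j z) = (\<Prod>t<n. \<Prod>S\<in>set vs. ennreal (\<rho> S (px (fst (z t))) (chosen j (snd (z t)))))"
  unfolding block_density_def joint_density_def by (simp add: chosen_block_nth)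

lemma trial_weight_eq:
  "trial_weight j z = block_density (chosen_block j z) * of_bool (enc_typical_block (chosen_block j z))"
proof -
  have "enc_typical_block (chosen_block j z) \<longleftrightarrow>
      enc_typical n \<theta> (\<lambda>t. px (fst (z t))) (\<lambda>t. chosen j (snd (z t)))"
    unfolding enc_typical_block_def by (rule enc_typical_cong) (simp_all add: chosen_block_nth)
  then show ?thesis by (simp add: trial_weight_def weight_def block_density_chosen_block)
qed

lemma trial_weight_le_block_density: "trial_weight j z \<le> block_density (chosen_block j z)"
  by (simp add: trial_weight_eq)

lemma trial_weight_measurable[measurable]:
  assumes [measurable]: "j \<in> selections"
  shows "trial_weight j \<in> borel_measurable (PiM {..<n} (\<lambda>_. trial_law))"
  unfolding trial_weight_eq[abs_def] by measurable

lemma weight_measurable: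
  assumes j_in[measurable]: "j \<in> selections" and c_space: "c \<in> space (PiM {..<n} (\<lambda>_. codebook_law))"
  shows "(\<lambda>xs. weight j xs c) \<in> borel_measurable (PiM {..<n} (\<lambda>_. SX))"
proof -
  have [measurable]: "(\<lambda>xs. chosen j (c t)) \<in> measurable (PiM {..<n} (\<lambda>_. SX)) (PiM (set vs) q)" if "t < n" for t
    using measurable_space[OF chosen_measurable[OF j_in], of "c t"] c_space that by (auto simp: space_PiM PiE_iff)
  have [measurable]: "Measurable.pred (PiM {..<n} (\<lambda>_. SX)) (\<lambda>xs. enc_typical n \<theta> xs (\<lambda>t. chosen j (c t)))"
    using enc_typical_measurable[of n "\<lambda>t xs. xs t" "PiM {..<n} (\<lambda>_. SX)" "\<lambda>t xs. chosen j (c t)" \<theta>] by simp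
  have [measurable]: "(\<lambda>xs. ennreal (\<rho> S (xs t) (chosen j (c t)))) \<in> borel_measurable (PiM {..<n} (\<lambda>_. SX))"
    if "S \<in> set vs" "t < n" for S t
    using that by (intro measurable_compose[OF rho_comp_measurable measurable_ennreal]) auto
  show ?thesis unfolding weight_def
    by (intro borel_measurable_times_ennreal borel_measurable_prod_ennreal) auto
qed

lemma nn_integral_trial_weight:
  assumes j_in: "j \<in> selections"
  shows "(\<integral>\<^sup>+z. trial_weight j z \<partial>PiM {..<n} (\<lambda>_. trial_law))
    = emeasure (PiM {..<n} (\<lambda>_. joint_law)) {z\<in>space (PiM {..<n} (\<lambda>_. joint_law)). enc_typical_block z}"
  unfolding trial_weight_eq
  by (subst nn_integral_chosen_block[OF j_in]) (simp_all add: nn_integral_of_bool)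

lemma trial_weight_le:
  "trial_weight j z \<le> (\<Prod>S\<in>set vs. if j' S = j S then ennreal (enc_bound S) else 1) *
    (\<Prod>t<n. \<Prod>S\<in>{S\<in>set vs. j S \<noteq> j' S}. ennreal (\<rho> S (px (fst (z t))) (chosen j (snd (z t)))))"
proof (cases "enc_typical_block (chosen_block j z)")
  case False
  then show ?thesis by (simp add: trial_weight_eq)
next
  case True
  let ?r = "\<lambda>S t. ennreal (\<rho> S (px (fst (z t))) (chosen j (snd (z t))))"
  have prod_le: "(\<Prod>t<n. ?r S t) \<le> ennreal (enc_bound S)" if "S \<in> set vs" for S
    using True that by (simp add: enc_typical_block_def enc_typical_def enc_bound_def chosen_block_nth
        prod_ennreal rho_nonneg ennreal_leI)
  have "trial_weight j z = (\<Prod>S\<in>set vs. \<Prod>t<n. ?r S t)"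
    using True by (simp add: trial_weight_eq block_density_chosen_block prod.swap[of _ "{..<n}"])
  also have "\<dots> \<le> (\<Prod>S\<in>set vs. (if j' S = j S then ennreal (enc_bound S) else 1) *
      (if j S \<noteq> j' S then \<Prod>t<n. ?r S t else 1))"
    using prod_le by (intro prod_mono_ennreal) auto
  also have "\<dots> = (\<Prod>S\<in>set vs. if j' S = j S then ennreal (enc_bound S) else 1) *
      (\<Prod>S\<in>{S\<in>set vs. j S \<noteq> j' S}. \<Prod>t<n. ?r S t)"
    by (simp only: prod.distrib prod.inter_filter finite_set)
  finally show ?thesis by (simp add: prod.swap[of _ "{..<n}"])
qed

lemma nn_integral_trial_weight_mult_le:
  assumes j_in[measurable]: "j \<in> selections" and j'_in[measurable]: "j' \<in> selections"
  shows "(\<integral>\<^sup>+z. trial_weight j z * trial_weight j' z \<partial>PiM {..<n} (\<lambda>_. trial_law))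
    \<le> ennreal (\<Prod>S\<in>set vs. if j' S = j S then enc_bound S else 1)"
proof -
  let ?C = "\<Prod>S\<in>set vs. if j' S = j S then ennreal (enc_bound S) else 1"
  define f where "f z = (\<Prod>S\<in>set vs. ennreal (\<rho> S (px (fst z)) (chosen j' (snd z)))) *
    (\<Prod>S\<in>{S\<in>set vs. j S \<noteq> j' S}. ennreal (\<rho> S (px (fst z)) (chosen j (snd z))))" for z
  have f_measurable[measurable]: "f \<in> borel_measurable trial_law"
    unfolding f_def
    by (intro borel_measurable_times_ennreal borel_measurable_prod_ennreal
        measurable_compose[OF rho_comp_measurable measurable_ennreal]) auto
  have "trial_weight j z * trial_weight j' z \<le> ?C * (\<Prod>t<n. f (z t))" for z
    using mult_mono[OF trial_weight_le[of j z j'] trial_weight_le_block_density[of j' z]]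
    by (simp add: block_density_chosen_block f_def prod.distrib mult_ac)
  then have "(\<integral>\<^sup>+z. trial_weight j z * trial_weight j' z \<partial>PiM {..<n} (\<lambda>_. trial_law))
     \<le> ?C * (\<integral>\<^sup>+z. (\<Prod>t<n. f (z t)) \<partial>PiM {..<n} (\<lambda>_. trial_law))"
    by (subst nn_integral_cmult[symmetric]) (auto intro: nn_integral_mono)
  also have "\<dots> \<le> ?C * 1"
    unfolding trial_law_def
  proof (intro mult_left_mono nn_integral_PiM_prod_pair_le_1 prob_space_P prob_space_codebook_law)
    show "(\<integral>\<^sup>+c. f (a, c) \<partial>codebook_law) \<le> 1" if "a \<in> space P" for a
      using nn_integral_two_selections_le_1[OF j_in j'_in measurable_space[OF px_measurable that]]
      by (simp add: f_def)
  qed (use f_measurable in \<open>simp_all add: trial_law_def\<close>)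
  also have "?C = ennreal (\<Prod>S\<in>set vs. if j' S = j S then enc_bound S else 1)"
    by (subst prod_ennreal[symmetric]) (auto simp: enc_bound_nonneg intro!: prod.cong)
  finally show ?thesis by simp
qed

definition selection_prob :: ennreal where
  "selection_prob = ennreal (1 / real (card selections))"

definition mean_weight :: "(nat \<Rightarrow> 'a \<times> ('s \<times> nat \<times> nat \<Rightarrow> 'u)) \<Rightarrow> ennreal" where
  "mean_weight z = (\<Sum>j\<in>selections. selection_prob * trial_weight j z)"

lemma mean_weight_measurable[measurable]: "mean_weight \<in> borel_measurable (PiM {..<n} (\<lambda>_. trial_law))"
  unfolding mean_weight_def by measurable

lemma sum_selection_prob: "(\<Sum>j\<in>selections. selection_prob * r) = r"
proof -
  have "of_nat (card selections) * selection_prob = 1"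
    using card_selections_pos
    by (simp add: selection_prob_def ennreal_of_nat_eq_real_of_nat ennreal_mult'[symmetric])
  then show ?thesis by (simp add: mult.assoc[symmetric])
qed

lemma nn_integral_mean_weight:
  "(\<integral>\<^sup>+z. mean_weight z \<partial>PiM {..<n} (\<lambda>_. trial_law))
    = emeasure (PiM {..<n} (\<lambda>_. joint_law)) {z\<in>space (PiM {..<n} (\<lambda>_. joint_law)). enc_typical_block z}"
  unfolding mean_weight_def
  by (simp add: nn_integral_sum nn_integral_cmult nn_integral_trial_weight sum_selection_prob
      del: sum_constant)

lemma mean_overlap_le:
  assumes j_in: "j \<in> selections"
  shows "(\<Sum>j'\<in>selections. selection_prob * ennreal (\<Prod>S\<in>set vs. if j' S = j S then enc_bound S else 1))
    \<le> ennreal (\<Prod>S\<in>set vs. 1 + enc_bound S / real (A S * B S))"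
proof -
  let ?K = "real (card selections)"
  have overlap_nonneg: "(\<Prod>S\<in>set vs. if j' S = j S then enc_bound S else 1) \<ge> 0" for j'
    by (intro prod_nonneg) (auto simp: enc_bound_nonneg)
  have "(\<Sum>j'\<in>selections. selection_prob * ennreal (\<Prod>S\<in>set vs. if j' S = j S then enc_bound S else 1))
    = ennreal ((\<Sum>j'\<in>selections. \<Prod>S\<in>set vs. if j' S = j S then enc_bound S else 1) / ?K)"
    using overlap_nonneg
    by (simp add: selection_prob_def ennreal_mult'[symmetric] sum_divide_distrib)
  also have "(\<Sum>j'\<in>selections. \<Prod>S\<in>set vs. if j' S = j S then enc_bound S else 1)
    = (\<Prod>S\<in>set vs. enc_bound S + (real (card (word_indices S)) - 1) * 1)"
    unfolding selections_def
    by (rule sum_PiE_prod_if_eq) (use j_in in \<open>auto simp: selections_def word_indices_def\<close>)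
  also have "\<dots> / ?K = (\<Prod>S\<in>set vs. (enc_bound S + (real (A S * B S) - 1)) / real (A S * B S))"
    by (simp add: card_selections prod_dividef word_indices_def card_cartesian_product)
  also have "\<dots> \<le> (\<Prod>S\<in>set vs. 1 + enc_bound S / real (A S * B S))"
  proof (intro prod_mono conjI)
    fix S
    have "real (A S * B S) \<ge> 1"
      using A_pos[of S] B_pos[of S] by (simp add: Suc_le_eq del: of_nat_mult)
    then show "0 \<le> (enc_bound S + (real (A S * B S) - 1)) / real (A S * B S)"
      and "(enc_bound S + (real (A S * B S) - 1)) / real (A S * B S) \<le> 1 + enc_bound S / real (A S * B S)"
      using enc_bound_nonneg[of S] by (auto simp: field_simps)
  qed
  finally show ?thesis by (simp add: ennreal_leI)
qed

lemma nn_integral_mean_weight_squared_le: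
  "(\<integral>\<^sup>+z. mean_weight z * mean_weight z \<partial>PiM {..<n} (\<lambda>_. trial_law))
    \<le> ennreal (\<Prod>S\<in>set vs. 1 + enc_bound S / real (A S * B S))"
proof -
  let ?O = "PiM {..<n} (\<lambda>_. trial_law)"
  have "(\<integral>\<^sup>+z. mean_weight z * mean_weight z \<partial>?O)
    = (\<integral>\<^sup>+z. (\<Sum>j\<in>selections. \<Sum>j'\<in>selections.
        selection_prob * (selection_prob * (trial_weight j z * trial_weight j' z))) \<partial>?O)"
    unfolding mean_weight_def sum_product by (simp only: mult_ac)
  also have "\<dots> = (\<Sum>j\<in>selections. selection_prob *
      (\<Sum>j'\<in>selections. selection_prob * (\<integral>\<^sup>+z. trial_weight j z * trial_weight j' z \<partial>?O)))"
    by (simp add: nn_integral_sum nn_integral_cmult sum_distrib_left)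
  also have "\<dots> \<le> (\<Sum>j\<in>selections. selection_prob * (\<Sum>j'\<in>selections. selection_prob *
      ennreal (\<Prod>S\<in>set vs. if j' S = j S then enc_bound S else 1)))"
    by (intro sum_mono mult_left_mono nn_integral_trial_weight_mult_le) auto
  also have "\<dots> \<le> (\<Sum>j\<in>selections. selection_prob * ennreal (\<Prod>S\<in>set vs. 1 + enc_bound S / real (A S * B S)))"
    by (intro sum_mono mult_left_mono mean_overlap_le) auto
  finally show ?thesis by (simp only: sum_selection_prob)
qed

lemma measure_mean_weight_small_le:
  "measure (PiM {..<n} (\<lambda>_. trial_law)) {z\<in>space (PiM {..<n} (\<lambda>_. trial_law)). 2 * mean_weight z < 1}
    \<le> 8 * measure (PiM {..<n} (\<lambda>_. joint_law)) {z\<in>space (PiM {..<n} (\<lambda>_. joint_law)). \<not> enc_typical_block z}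
      + 4 * ((\<Prod>S\<in>set vs. 1 + enc_bound S / real (A S * B S)) - 1)"
proof -
  let ?O = "PiM {..<n} (\<lambda>_. trial_law)" and ?J = "PiM {..<n} (\<lambda>_. joint_law)"
  interpret J: prob_space ?J by (rule prob_space_PiM) (rule prob_space_joint_law)
  have "measure ?O {z\<in>space ?O. 2 * mean_weight z < 1} + 8 * measure ?J {z\<in>space ?J. enc_typical_block z}
    \<le> 4 * (\<Prod>S\<in>set vs. 1 + enc_bound S / real (A S * B S)) + 4"
    by (rule second_moment_lower_tail[OF _ _ _ nn_integral_mean_weight_squared_le])
      (auto simp: nn_integral_mean_weight J.emeasure_eq_measure enc_bound_nonneg
        intro!: prob_space_PiM prob_space_trial_law prod_nonneg add_nonneg_nonneg divide_nonneg_nonneg)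
  moreover have "measure ?J {z\<in>space ?J. \<not> enc_typical_block z} = 1 - measure ?J {z\<in>space ?J. enc_typical_block z}"
    by (rule J.prob_neg) measurable
  ultimately show ?thesis by simp
qed

subsection \<open>Packing\<close>

definition confused where
  "confused j l b z \<longleftrightarrow>
     dec_typical n \<theta> l (\<lambda>t. py l (fst (z t))) (\<lambda>t. candidate l (\<lambda>S. fst (j S)) b (snd (z t)))"

definition wrong_positions :: "('s \<Rightarrow> nat \<times> nat) \<Rightarrow> nat \<Rightarrow> ('s \<Rightarrow> nat) set" where
  "wrong_positions j l = positions l - {\<lambda>S\<in>DS l. snd (j S)}"

definition confusion_bound :: real where
  "confusion_bound = (\<Sum>l<m. exp (real n * \<theta>) * ((\<Prod>S\<in>DS l. 1 + real (B S - 1) * exp (- real n * R' S)) - 1))"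

lemma wrong_positions_subset: "wrong_positions j l \<subseteq> positions l"
  by (auto simp: wrong_positions_def)

lemma finite_wrong_positions: "l < m \<Longrightarrow> finite (wrong_positions j l)"
  by (rule finite_subset[OF wrong_positions_subset finite_positions])

lemma confused_measurable:
  assumes j_in: "j \<in> selections" and l_less: "l < m" and b_in: "b \<in> positions l"
  shows "Measurable.pred (PiM {..<n} (\<lambda>_. trial_law)) (confused j l b)"
  unfolding confused_def[abs_def]
proof (rule dec_typical_measurable[OF l_less])
  note [measurable] = py_measurable[OF l_less] candidate_measurable[OF j_in l_less b_in]
  fix t assume "t < n"
  then have [measurable]: "(\<lambda>z. z t) \<in> measurable (PiM {..<n} (\<lambda>_. trial_law)) trial_law" by simp
  show "(\<lambda>z. py l (fst (z t))) \<in> measurable (PiM {..<n} (\<lambda>_. trial_law)) (SY l)" by measurable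
  show "(\<lambda>z. candidate l (\<lambda>S. fst (j S)) b (snd (z t))) \<in> measurable (PiM {..<n} (\<lambda>_. trial_law)) (PiM (DS l) q)"
    by measurable
qed

lemma of_bool_confused_le:
  assumes b_in: "b \<in> wrong_positions j l" and D_eq: "D = {S\<in>DS l. b S \<noteq> snd (j S)}"
  shows "of_bool (confused j l b z) \<le> ennreal (exp (- real n * ((\<Sum>S\<in>D. R' S) - \<theta>))) *
    (\<Prod>t<n. \<Prod>S\<in>D. ennreal (g l D S (py l (fst (z t))) (candidate l (\<lambda>S. fst (j S)) b (snd (z t)))))"
proof (cases "confused j l b z")
  case True
  let ?g = "\<lambda>t S. g l D S (py l (fst (z t))) (candidate l (\<lambda>S. fst (j S)) b (snd (z t)))"
  have "D \<noteq> {}"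
  proof
    assume "D = {}"
    then have "b = (\<lambda>S\<in>DS l. snd (j S))"
      using b_in by (intro ext) (auto simp: D_eq wrong_positions_def positions_def PiE_iff extensional_def)
    then show False using b_in by (simp add: wrong_positions_def)
  qed
  then have "exp (real n * ((\<Sum>S\<in>D. R' S) - \<theta>)) \<le> (\<Prod>t<n. \<Prod>S\<in>D. ?g t S)"
    using True unfolding confused_def dec_typical_def by (auto simp: D_eq)
  then have "exp (- real n * ((\<Sum>S\<in>D. R' S) - \<theta>)) * exp (real n * ((\<Sum>S\<in>D. R' S) - \<theta>))
    \<le> exp (- real n * ((\<Sum>S\<in>D. R' S) - \<theta>)) * (\<Prod>t<n. \<Prod>S\<in>D. ?g t S)"
    by (rule mult_left_mono) simp
  then have "1 \<le> exp (- real n * ((\<Sum>S\<in>D. R' S) - \<theta>)) * (\<Prod>t<n. \<Prod>S\<in>D. ?g t S)"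
    unfolding exp_add[symmetric] by simp
  then have "ennreal 1 \<le> ennreal (exp (- real n * ((\<Sum>S\<in>D. R' S) - \<theta>)) * (\<Prod>t<n. \<Prod>S\<in>D. ?g t S))"
    by (rule ennreal_leI)
  also have "\<dots> = ennreal (exp (- real n * ((\<Sum>S\<in>D. R' S) - \<theta>))) * (\<Prod>t<n. \<Prod>S\<in>D. ennreal (?g t S))"
  proof -
    have "(\<Prod>S\<in>D. ennreal (?g t S)) = ennreal (\<Prod>S\<in>D. ?g t S)" for t
      by (rule prod_ennreal) (rule g_nonneg)
    moreover have "(\<Prod>t<n. ennreal (\<Prod>S\<in>D. ?g t S)) = ennreal (\<Prod>t<n. \<Prod>S\<in>D. ?g t S)"
      by (rule prod_ennreal) (intro prod_nonneg g_nonneg)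
    ultimately show ?thesis by (simp only: ennreal_mult'[OF exp_ge_zero])
  qed
  finally show ?thesis using True by simp
qed simp

lemma nn_integral_confused_le:
  assumes j_in[measurable]: "j \<in> selections" and l_less: "l < m" and b_in: "b \<in> wrong_positions j l"
  shows "(\<integral>\<^sup>+z. block_density (chosen_block j z) * of_bool (confused j l b z) \<partial>PiM {..<n} (\<lambda>_. trial_law))
    \<le> ennreal (exp (real n * \<theta>) * (\<Prod>S\<in>DS l. if b S = snd (j S) then 1 else exp (- real n * R' S)))"
proof -
  define D where "D = {S\<in>DS l. b S \<noteq> snd (j S)}"
  define C where "C = exp (- real n * ((\<Sum>S\<in>D. R' S) - \<theta>))"
  have b_pos: "b \<in> positions l" using b_in wrong_positions_subset by auto
  have D_DS: "D \<subseteq> DS l" by (auto simp: D_def)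
  define f where "f z = (\<Prod>S\<in>set vs. ennreal (\<rho> S (px (fst z)) (chosen j (snd z)))) *
    (\<Prod>S\<in>D. ennreal (g l D S (py l (fst z)) (candidate l (\<lambda>S. fst (j S)) b (snd z))))" for z
  note [measurable] = py_measurable[OF l_less] candidate_measurable[OF j_in l_less b_pos]
  have f_measurable[measurable]: "f \<in> borel_measurable trial_law"
    unfolding f_def
    by (intro borel_measurable_times_ennreal borel_measurable_prod_ennreal
        measurable_compose[OF rho_comp_measurable measurable_ennreal]
        measurable_compose[OF g_comp_measurable[OF l_less D_DS] measurable_ennreal]) auto
  have "block_density (chosen_block j z) * of_bool (confused j l b z) \<le> ennreal C * (\<Prod>t<n. f (z t))" for z
    using mult_left_mono[OF of_bool_confused_le[OF b_in D_def], of "block_density (chosen_block j z)"]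
    by (simp add: block_density_chosen_block f_def C_def prod.distrib mult_ac)
  then have "(\<integral>\<^sup>+z. block_density (chosen_block j z) * of_bool (confused j l b z) \<partial>PiM {..<n} (\<lambda>_. trial_law))
     \<le> ennreal C * (\<integral>\<^sup>+z. (\<Prod>t<n. f (z t)) \<partial>PiM {..<n} (\<lambda>_. trial_law))"
    by (subst nn_integral_cmult[symmetric]) (auto intro: nn_integral_mono)
  also have "\<dots> \<le> ennreal C * 1"
    unfolding trial_law_def
  proof (intro mult_left_mono nn_integral_PiM_prod_pair_le_1 prob_space_P prob_space_codebook_law)
    fix a assume a_space: "a \<in> space P"
    show "(\<integral>\<^sup>+c. f (a, c) \<partial>codebook_law) \<le> 1"
      using nn_integral_selection_candidate_le_1[OF j_in l_less b_pos D_def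
          measurable_space[OF px_measurable a_space] measurable_space[OF py_measurable[OF l_less] a_space]]
      by (simp add: f_def)
  qed (use f_measurable in \<open>simp_all add: trial_law_def\<close>)
  also have "C = exp (real n * \<theta>) * (\<Prod>S\<in>DS l. if b S = snd (j S) then 1 else exp (- real n * R' S))"
    unfolding C_def D_def exp_neg_sum_eq_prod[OF finite_DS[OF l_less]]
    by (intro arg_cong2[where f="(*)"] prod.cong) auto
  finally show ?thesis by simp
qed

lemma sum_wrong_positions:
  assumes j_in: "j \<in> selections" and l_less: "l < m"
  shows "(\<Sum>b\<in>wrong_positions j l. \<Prod>S\<in>DS l. if b S = snd (j S) then 1 else exp (- real n * R' S))
    = (\<Prod>S\<in>DS l. 1 + real (B S - 1) * exp (- real n * R' S)) - 1"
proof -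
  let ?b = "\<lambda>S\<in>DS l. snd (j S)"
  let ?h = "\<lambda>b. \<Prod>S\<in>DS l. if b S = snd (j S) then 1 else exp (- real n * R' S)"
  have position_in: "snd (j S) \<in> {..<B S}" if "S \<in> DS l" for S
    using that j_in DS_subset[OF l_less] by (auto simp: selections_def word_indices_def PiE_iff mem_Times_iff)
  have "sum ?h (positions l) = (\<Prod>S\<in>DS l. 1 + (real (card {..<B S}) - 1) * exp (- real n * R' S))"
    unfolding positions_def by (rule sum_PiE_prod_if_eq) (use position_in finite_DS[OF l_less] in auto)
  moreover have "sum ?h (positions l) = ?h ?b + sum ?h (wrong_positions j l)"
    unfolding wrong_positions_def
    by (rule sum.remove[OF finite_positions[OF l_less]]) (use position_in in \<open>auto simp: positions_def\<close>)
  moreover have "?h ?b = 1" by (intro prod.neutral) auto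
  ultimately show ?thesis using B_pos by (simp add: of_nat_diff Suc_le_eq)
qed

lemma confusion_bound_nonneg: "confusion_bound \<ge> 0"
  unfolding confusion_bound_def
  by (intro sum_nonneg mult_nonneg_nonneg) (auto intro!: prod_ge_1)

lemma sum_nn_integral_confused_le:
  assumes j_in: "j \<in> selections"
  shows "(\<Sum>l<m. \<Sum>b\<in>wrong_positions j l.
      \<integral>\<^sup>+z. block_density (chosen_block j z) * of_bool (confused j l b z) \<partial>PiM {..<n} (\<lambda>_. trial_law))
    \<le> ennreal confusion_bound"
proof -
  let ?c = "\<lambda>l b. exp (real n * \<theta>) * (\<Prod>S\<in>DS l. if b S = snd (j S) then 1 else exp (- real n * R' S))"
  have c_nonneg: "?c l b \<ge> 0" for l b by (intro mult_nonneg_nonneg prod_nonneg) auto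
  have "(\<Sum>l<m. \<Sum>b\<in>wrong_positions j l.
      \<integral>\<^sup>+z. block_density (chosen_block j z) * of_bool (confused j l b z) \<partial>PiM {..<n} (\<lambda>_. trial_law))
    \<le> (\<Sum>l<m. \<Sum>b\<in>wrong_positions j l. ennreal (?c l b))"
    by (intro sum_mono nn_integral_confused_le[OF j_in]) auto
  also have "\<dots> = ennreal (\<Sum>l<m. \<Sum>b\<in>wrong_positions j l. ?c l b)"
    using c_nonneg by (simp add: sum_nonneg)
  also have "(\<Sum>l<m. \<Sum>b\<in>wrong_positions j l. ?c l b) = confusion_bound"
    unfolding confusion_bound_def
    by (intro sum.cong refl) (simp add: sum_distrib_left[symmetric] sum_wrong_positions[OF j_in])
  finally show ?thesis .
qed

subsection \<open>The failure event\<close>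

definition acceptable :: "(nat \<Rightarrow> 'a \<times> ('s \<Rightarrow> 'u)) \<Rightarrow> bool" where
  "acceptable z \<longleftrightarrow> accept z \<and>
     (\<forall>l<m. dec_typical n \<theta> l (\<lambda>t. py l (fst (z t))) (\<lambda>t. restrict (snd (z t)) (DS l)))"

definition failure where
  "failure j z \<longleftrightarrow> \<not> acceptable (chosen_block j z) \<or> (\<exists>l<m. \<exists>b\<in>wrong_positions j l. confused j l b z)"

lemma acceptable_measurable[measurable]: "Measurable.pred (PiM {..<n} (\<lambda>_. indep_law)) acceptable"
proof -
  note [measurable] = dec_typical_restrict_measurable
  show ?thesis unfolding acceptable_def by measurable
qed

lemma failure_measurable[measurable]:
  assumes j_in[measurable]: "j \<in> selections"
  shows "Measurable.pred (PiM {..<n} (\<lambda>_. trial_law)) (failure j)"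
proof -
  note [measurable] = confused_measurable[OF j_in]
  have [measurable]: "Measurable.pred (PiM {..<n} (\<lambda>_. trial_law)) (\<lambda>z. \<exists>b\<in>wrong_positions j l. confused j l b z)"
    if "l < m" for l
    using finite_wrong_positions[OF that] wrong_positions_subset[of j l] that
    by (intro pred_intros_finite) auto
  show ?thesis unfolding failure_def by measurable
qed

lemma of_bool_failure_le:
  "(of_bool (failure j z) :: ennreal) \<le> of_bool (\<not> acceptable (chosen_block j z)) +
    (\<Sum>l<m. \<Sum>b\<in>wrong_positions j l. of_bool (confused j l b z))"
proof (cases "\<exists>l<m. \<exists>b\<in>wrong_positions j l. confused j l b z")
  case True
  then obtain l b where l_less: "l < m" and "b \<in> wrong_positions j l" and "confused j l b z" by blast
  then have "1 \<le> (\<Sum>b\<in>wrong_positions j l. of_bool (confused j l b z) :: ennreal)"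
    using member_le_sum[of b "wrong_positions j l" "\<lambda>b. of_bool (confused j l b z) :: ennreal"]
      finite_wrong_positions[OF l_less] by simp
  also have "\<dots> \<le> (\<Sum>l<m. \<Sum>b\<in>wrong_positions j l. of_bool (confused j l b z))"
    using l_less by (intro member_le_sum[where f="\<lambda>l. \<Sum>b\<in>wrong_positions j l. of_bool (confused j l b z)"]) auto
  finally show ?thesis by (simp add: of_bool_def add_increasing)
qed (auto simp: failure_def)

lemma nn_integral_failure_le:
  assumes j_in[measurable]: "j \<in> selections"
  shows "(\<integral>\<^sup>+z. block_density (chosen_block j z) * of_bool (failure j z) \<partial>PiM {..<n} (\<lambda>_. trial_law))
    \<le> ennreal (measure (PiM {..<n} (\<lambda>_. joint_law)) {z\<in>space (PiM {..<n} (\<lambda>_. joint_law)). \<not> acceptable z}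
        + confusion_bound)"
proof -
  let ?O = "PiM {..<n} (\<lambda>_. trial_law)" and ?J = "PiM {..<n} (\<lambda>_. joint_law)"
  let ?w = "\<lambda>z. block_density (chosen_block j z)"
  interpret J: prob_space ?J by (rule prob_space_PiM) (rule prob_space_joint_law)
  have [measurable]: "Measurable.pred ?O (confused j l b)" if "l < m" "b \<in> wrong_positions j l" for l b
    using confused_measurable[OF j_in] wrong_positions_subset that by blast
  have "(\<integral>\<^sup>+z. ?w z * of_bool (failure j z) \<partial>?O) \<le> (\<integral>\<^sup>+z. ?w z * of_bool (\<not> acceptable (chosen_block j z)) +
      (\<Sum>l<m. \<Sum>b\<in>wrong_positions j l. ?w z * of_bool (confused j l b z)) \<partial>?O)"
    unfolding sum_distrib_left[symmetric] distrib_left[symmetric]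
    by (intro nn_integral_mono mult_left_mono of_bool_failure_le) simp
  also have "\<dots> = (\<integral>\<^sup>+z. ?w z * of_bool (\<not> acceptable (chosen_block j z)) \<partial>?O) +
      (\<Sum>l<m. \<Sum>b\<in>wrong_positions j l. \<integral>\<^sup>+z. ?w z * of_bool (confused j l b z) \<partial>?O)"
    by (subst nn_integral_add) (auto intro!: nn_integral_sum[THEN trans] sum.cong borel_measurable_sum)
  also have "(\<integral>\<^sup>+z. ?w z * of_bool (\<not> acceptable (chosen_block j z)) \<partial>?O)
    = ennreal (measure ?J {z\<in>space ?J. \<not> acceptable z})"
    by (subst nn_integral_chosen_block[OF j_in]) (simp_all add: nn_integral_of_bool J.emeasure_eq_measure)
  finally show ?thesis
    using sum_nn_integral_confused_le[OF j_in] confusion_bound_nonneg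
    by (simp add: ennreal_plus add_left_mono order_trans)
qed

subsection \<open>Existence of a good codebook and encoder\<close>

definition zip_block where
  "zip_block a c = (\<lambda>t\<in>{..<n}. (a t, c t))"

definition selection_cost :: "(nat \<Rightarrow> 'a \<times> ('s \<times> nat \<times> nat \<Rightarrow> 'u)) \<Rightarrow> ennreal" where
  "selection_cost z = of_bool (2 * mean_weight z < 1) +
     2 * (\<Sum>j\<in>selections. selection_prob * (block_density (chosen_block j z) * of_bool (failure j z)))"

lemma zip_block_measurable:
  assumes c_space: "c \<in> space (PiM {..<n} (\<lambda>_. codebook_law))"
  shows "(\<lambda>a. zip_block a c) \<in> measurable (PiM {..<n} (\<lambda>_. P)) (PiM {..<n} (\<lambda>_. trial_law))"
  unfolding zip_block_def trial_law_def
proof (intro measurable_restrict measurable_Pair)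
  show "(\<lambda>a. c t) \<in> measurable (PiM {..<n} (\<lambda>_. P)) codebook_law" if "t \<in> {..<n}" for t
    using c_space that by (auto simp: space_PiM PiE_iff)
qed simp

lemma selection_cost_measurable[measurable]: "selection_cost \<in> borel_measurable (PiM {..<n} (\<lambda>_. trial_law))"
  unfolding selection_cost_def by measurable

lemma nn_integral_selection_cost_le:
  "(\<integral>\<^sup>+z. selection_cost z \<partial>PiM {..<n} (\<lambda>_. trial_law))
    \<le> ennreal (8 * measure (PiM {..<n} (\<lambda>_. joint_law)) {z\<in>space (PiM {..<n} (\<lambda>_. joint_law)). \<not> enc_typical_block z}
      + 4 * ((\<Prod>S\<in>set vs. 1 + enc_bound S / real (A S * B S)) - 1)
      + 2 * (measure (PiM {..<n} (\<lambda>_. joint_law)) {z\<in>space (PiM {..<n} (\<lambda>_. joint_law)). \<not> acceptable z} + confusion_bound))"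
proof -
  let ?O = "PiM {..<n} (\<lambda>_. trial_law)" and ?J = "PiM {..<n} (\<lambda>_. joint_law)"
  let ?fail = "measure ?J {z\<in>space ?J. \<not> acceptable z} + confusion_bound"
  interpret O: prob_space ?O by (rule prob_space_PiM) (rule prob_space_trial_law)
  have fail_nonneg: "0 \<le> ?fail" using confusion_bound_nonneg by simp
  have "(\<integral>\<^sup>+z. selection_cost z \<partial>?O) = emeasure ?O {z\<in>space ?O. 2 * mean_weight z < 1} + 2 *
      (\<Sum>j\<in>selections. selection_prob * (\<integral>\<^sup>+z. block_density (chosen_block j z) * of_bool (failure j z) \<partial>?O))"
    unfolding selection_cost_def
    by (simp add: nn_integral_add nn_integral_of_bool nn_integral_cmult nn_integral_sum)
  also have "\<dots> \<le> emeasure ?O {z\<in>space ?O. 2 * mean_weight z < 1} + 2 * (\<Sum>j\<in>selections. selection_prob * ennreal ?fail)"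
    by (intro add_left_mono mult_left_mono sum_mono nn_integral_failure_le) auto
  also have "\<dots> = ennreal (measure ?O {z\<in>space ?O. 2 * mean_weight z < 1} + 2 * ?fail)"
  proof -
    have "2 * ennreal r = ennreal (2 * r)" if "r \<ge> 0" for r using that by (simp add: ennreal_mult')
    then show ?thesis
      unfolding sum_selection_prob O.emeasure_eq_measure using fail_nonneg by (subst ennreal_plus) auto
  qed
  finally show ?thesis
    using measure_mean_weight_small_le by (auto elim!: order_trans intro!: ennreal_leI)
qed

lemma codebook_selection_cost_less:
  assumes "(\<integral>\<^sup>+z. selection_cost z \<partial>PiM {..<n} (\<lambda>_. trial_law)) < e"
  shows "\<exists>c\<in>space (PiM {..<n} (\<lambda>_. codebook_law)).
    (\<integral>\<^sup>+a. selection_cost (zip_block a c) \<partial>PiM {..<n} (\<lambda>_. P)) < e"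
proof -
  let ?PP = "PiM {..<n} (\<lambda>_. P)" and ?CC = "PiM {..<n} (\<lambda>_. codebook_law)" and ?O = "PiM {..<n} (\<lambda>_. trial_law)"
  interpret PP: prob_space ?PP by (rule prob_space_PiM) (rule prob_space_P)
  interpret CC: prob_space ?CC by (rule prob_space_PiM) (rule prob_space_codebook_law)
  interpret PC: pair_prob_space ?PP ?CC ..
  have zip: "(\<lambda>z. zip_block (fst z) (snd z)) \<in> measurable (?PP \<Otimes>\<^sub>M ?CC) ?O"
    unfolding zip_block_def trial_law_def by measurable
  have "(\<integral>\<^sup>+c. \<integral>\<^sup>+a. selection_cost (zip_block a c) \<partial>?PP \<partial>?CC)
    = (\<integral>\<^sup>+z. selection_cost (zip_block (fst z) (snd z)) \<partial>(?PP \<Otimes>\<^sub>M ?CC))"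
    using PC.nn_integral_snd[OF measurable_compose[OF zip selection_cost_measurable]] by simp
  also have "\<dots> = (\<integral>\<^sup>+z. selection_cost z \<partial>distr (?PP \<Otimes>\<^sub>M ?CC) ?O (\<lambda>z. zip_block (fst z) (snd z)))"
    by (rule nn_integral_distr[OF zip, symmetric]) simp
  also have "distr (?PP \<Otimes>\<^sub>M ?CC) ?O (\<lambda>z. zip_block (fst z) (snd z)) = ?O"
    unfolding zip_block_def trial_law_def
    by (rule distr_pair_PiM) (simp_all add: prob_space_P prob_space_codebook_law)
  finally show ?thesis
    using assms by (intro prob_space_nn_integral_less[OF CC.prob_space_axioms]) simp
qed

lemma encoder_exists:
  assumes c_space: "c \<in> space (PiM {..<n} (\<lambda>_. codebook_law))"
  shows "\<exists>f\<in>measurable (PiM {..<n} (\<lambda>_. SX)) (count_space selections).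
    {a\<in>space (PiM {..<n} (\<lambda>_. P)). failure (f (\<lambda>t\<in>{..<n}. px (a t))) (zip_block a c)} \<in> sets (PiM {..<n} (\<lambda>_. P)) \<and>
    emeasure (PiM {..<n} (\<lambda>_. P)) {a\<in>space (PiM {..<n} (\<lambda>_. P)). failure (f (\<lambda>t\<in>{..<n}. px (a t))) (zip_block a c)}
      \<le> (\<integral>\<^sup>+a. selection_cost (zip_block a c) \<partial>PiM {..<n} (\<lambda>_. P))"
proof -
  let ?PP = "PiM {..<n} (\<lambda>_. P)" and ?XX = "PiM {..<n} (\<lambda>_. SX)"
  let ?x = "\<lambda>a. \<lambda>t\<in>{..<n}. px (a t)"
  define fail where "fail j = {a\<in>space ?PP. failure j (zip_block a c)}" for j
  note [measurable] = zip_block_measurable[OF c_space]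
  have fail_sets: "fail j \<in> sets ?PP" if [measurable]: "j \<in> selections" for j
    unfolding fail_def by measurable
  have block_measurable: "?x \<in> measurable ?PP ?XX" by measurable
  have nonempty: "selections \<noteq> {}" using card_selections_pos by auto
  have weight_eq: "weight j (?x a) c = trial_weight j (zip_block a c)" for j a
    unfolding trial_weight_def weight_def
    by (intro arg_cong2[where f="(*)"] prod.cong arg_cong[where f=of_bool] enc_typical_cong)
      (simp_all add: zip_block_def)
  have "\<exists>f\<in>measurable ?XX (count_space selections). {a\<in>space ?PP. a \<in> fail (f (?x a))} \<in> sets ?PP \<and>
      emeasure ?PP {a\<in>space ?PP. a \<in> fail (f (?x a))}
        \<le> emeasure ?PP {a\<in>space ?PP. 2 * (\<Sum>j\<in>selections. selection_prob * weight j (?x a) c) < 1}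
          + 2 * (\<Sum>j\<in>selections. \<integral>\<^sup>+a. selection_prob * weight j (?x a) c * indicator (fail j) a \<partial>?PP)"
    by (rule argmin_encoder_exists[OF prob_space_PiM block_measurable finite_selections nonempty fail_sets])
      (auto intro!: prob_space_P borel_measurable_times_ennreal weight_measurable c_space)
  then obtain f where f_encoder: "f \<in> measurable ?XX (count_space selections)" 
    "{a\<in>space ?PP. a \<in> fail (f (?x a))} \<in> sets ?PP"
    "emeasure ?PP {a\<in>space ?PP. a \<in> fail (f (?x a))} \<le> emeasure ?PP {a\<in>space ?PP. 2 * mean_weight (zip_block a c) < 1}
      + 2 * (\<Sum>j\<in>selections. \<integral>\<^sup>+a. selection_prob * trial_weight j (zip_block a c) * indicator (fail j) a \<partial>?PP)"
    unfolding weight_eq mean_weight_def by blast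
  note f_encoder(3)
  also have "\<dots> \<le> emeasure ?PP {a\<in>space ?PP. 2 * mean_weight (zip_block a c) < 1}
      + 2 * (\<Sum>j\<in>selections. \<integral>\<^sup>+a. selection_prob *
          (block_density (chosen_block j (zip_block a c)) * of_bool (failure j (zip_block a c))) \<partial>?PP)"
    unfolding mult.assoc
    by (intro add_left_mono mult_left_mono sum_mono nn_integral_mono mult_mono trial_weight_le_block_density)
      (auto simp: fail_def indicator_def)
  also have "\<dots> = (\<integral>\<^sup>+a. selection_cost (zip_block a c) \<partial>?PP)"
    unfolding selection_cost_def
    by (simp add: nn_integral_add nn_integral_of_bool nn_integral_cmult nn_integral_sum)
  finally show ?thesis using f_encoder(1,2) unfolding fail_def by (intro bexI[of _ f]) auto
qed

lemma codebook_exists: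
  assumes "8 * measure (PiM {..<n} (\<lambda>_. joint_law)) {z\<in>space (PiM {..<n} (\<lambda>_. joint_law)). \<not> enc_typical_block z}
      + 4 * ((\<Prod>S\<in>set vs. 1 + enc_bound S / real (A S * B S)) - 1)
      + 2 * (measure (PiM {..<n} (\<lambda>_. joint_law)) {z\<in>space (PiM {..<n} (\<lambda>_. joint_law)). \<not> acceptable z} + confusion_bound)
    < \<eta>" and "\<eta> > 0"
  shows "\<exists>c\<in>space (PiM {..<n} (\<lambda>_. codebook_law)). \<exists>f\<in>measurable (PiM {..<n} (\<lambda>_. SX)) (count_space selections).
    {a\<in>space (PiM {..<n} (\<lambda>_. P)). failure (f (\<lambda>t\<in>{..<n}. px (a t))) (zip_block a c)} \<in> sets (PiM {..<n} (\<lambda>_. P)) \<and>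
    measure (PiM {..<n} (\<lambda>_. P))
      {a\<in>space (PiM {..<n} (\<lambda>_. P)). failure (f (\<lambda>t\<in>{..<n}. px (a t))) (zip_block a c)} < \<eta>"
proof -
  interpret PP: prob_space "PiM {..<n} (\<lambda>_. P)" by (rule prob_space_PiM) (rule prob_space_P)
  have "(\<integral>\<^sup>+z. selection_cost z \<partial>PiM {..<n} (\<lambda>_. trial_law)) < ennreal \<eta>"
    by (rule le_less_trans[OF nn_integral_selection_cost_le]) (use assms in \<open>simp only: ennreal_lessI\<close>)
  then obtain c where c_space: "c \<in> space (PiM {..<n} (\<lambda>_. codebook_law))"
    and "(\<integral>\<^sup>+a. selection_cost (zip_block a c) \<partial>PiM {..<n} (\<lambda>_. P)) < ennreal \<eta>"
    using codebook_selection_cost_less by blast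
  moreover obtain f where "f \<in> measurable (PiM {..<n} (\<lambda>_. SX)) (count_space selections)"
    "{a\<in>space (PiM {..<n} (\<lambda>_. P)). failure (f (\<lambda>t\<in>{..<n}. px (a t))) (zip_block a c)} \<in> sets (PiM {..<n} (\<lambda>_. P))"
    "emeasure (PiM {..<n} (\<lambda>_. P)) {a\<in>space (PiM {..<n} (\<lambda>_. P)). failure (f (\<lambda>t\<in>{..<n}. px (a t))) (zip_block a c)}
      \<le> (\<integral>\<^sup>+a. selection_cost (zip_block a c) \<partial>PiM {..<n} (\<lambda>_. P))"
    using encoder_exists[OF c_space] by blast
  ultimately show ?thesis
    unfolding PP.emeasure_eq_measure using c_space \<open>\<eta> > 0\<close> by (meson ennreal_less_iff le_less_trans measure_nonneg)
qed

subsection \<open>Decoding the codewords\<close>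

definition bins :: "('s \<Rightarrow> nat) set" where
  "bins = PiE (set vs) (\<lambda>S. {..<A S})"

definition bin_of :: "('s \<Rightarrow> nat \<times> nat) \<Rightarrow> 's \<Rightarrow> nat" where
  "bin_of j = (\<lambda>S\<in>set vs. fst (j S))"

definition position_of :: "nat \<Rightarrow> ('s \<Rightarrow> nat \<times> nat) \<Rightarrow> 's \<Rightarrow> nat" where
  "position_of l j = (\<lambda>S\<in>DS l. snd (j S))"

lemma finite_bins: "finite bins"
  by (simp add: bins_def finite_PiE)

lemma bins_nonempty: "bins \<noteq> {}"
  using A_pos by (auto simp: bins_def PiE_eq_empty_iff)

lemma bin_of_in_bins: "j \<in> selections \<Longrightarrow> bin_of j \<in> bins"
  by (auto simp: selections_def word_indices_def bins_def bin_of_def PiE_iff mem_Times_iff)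

lemma position_of_in_positions: "j \<in> selections \<Longrightarrow> l < m \<Longrightarrow> position_of l j \<in> positions l"
  using DS_subset[of l]
  by (auto simp: selections_def word_indices_def positions_def position_of_def PiE_iff mem_Times_iff)

lemma candidate_bin_of: "l < m \<Longrightarrow> candidate l (bin_of j) = candidate l (\<lambda>S. fst (j S))"
  using DS_subset[of l] by (auto simp: candidate_def bin_of_def fun_eq_iff)

lemma candidate_position_of: "l < m \<Longrightarrow> candidate l (bin_of j) (position_of l j) c = restrict (chosen j c) (DS l)"
  using DS_subset[of l] by (auto simp: candidate_def bin_of_def position_of_def chosen_def fun_eq_iff)

lemma candidate_space:
  assumes "a \<in> bins" "l < m" "b \<in> positions l" "c \<in> space codebook_law"
  shows "candidate l a b c \<in> space (PiM (DS l) q)"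
  using assms DS_subset[of l]
  by (auto simp: candidate_def codebook_law_def codebook_indices_def word_indices_def bins_def positions_def
      space_PiM PiE_iff)

lemma not_failure_imp_dec_typical:
  assumes "\<not> failure j (zip_block z c)" and l_less: "l < m"
  shows "dec_typical n \<theta> l (\<lambda>t\<in>{..<n}. py l (z t)) (\<lambda>t. candidate l (bin_of j) (position_of l j) (c t))"
proof -
  let ?z = "chosen_block j (zip_block z c)"
  have "dec_typical n \<theta> l (\<lambda>t. py l (fst (?z t))) (\<lambda>t. restrict (snd (?z t)) (DS l))"
    using assms by (auto simp: failure_def acceptable_def)
  also have "?this \<longleftrightarrow> ?thesis"
    by (rule dec_typical_cong) (simp_all add: chosen_block_nth zip_block_def candidate_position_of l_less)
  finally show ?thesis .
qed

lemma not_failure_imp_unique_position: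
  assumes "\<not> failure j (zip_block z c)" and l_less: "l < m" and b_in: "b \<in> positions l"
    and typical: "dec_typical n \<theta> l (\<lambda>t\<in>{..<n}. py l (z t)) (\<lambda>t. candidate l (bin_of j) b (c t))"
  shows "b = position_of l j"
proof (rule ccontr)
  assume "b \<noteq> position_of l j"
  then have "b \<in> wrong_positions j l" using b_in by (simp add: wrong_positions_def position_of_def)
  moreover have "confused j l b (zip_block z c)"
    using typical unfolding confused_def
    by (rule dec_typical_cong[THEN iffD1, rotated -1]) (simp_all add: zip_block_def candidate_bin_of l_less)
  ultimately show False using assms(1) l_less by (auto simp: failure_def)
qed

lemma block_decoder_exists:
  assumes c_space: "c \<in> space (PiM {..<n} (\<lambda>_. codebook_law))" and l_less: "l < m"
  shows "\<exists>dec. (\<forall>a\<in>bins. \<forall>t<n. dec a t \<in> measurable (PiM {..<n} (\<lambda>_. SY l)) (PiM (DS l) q)) \<and>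
    (\<forall>j\<in>selections. \<forall>z\<in>space (PiM {..<n} (\<lambda>_. P)). \<not> failure j (zip_block z c) \<longrightarrow>
      (\<forall>t<n. dec (bin_of j) t (\<lambda>t\<in>{..<n}. py l (z t)) = restrict (chosen j (c t)) (DS l)))"
proof -
  let ?Y = "PiM {..<n} (\<lambda>_. SY l)"
  let ?typ = "\<lambda>a b ys. dec_typical n \<theta> l ys (\<lambda>t. candidate l a b (c t))"
  have candidate: "candidate l a b (c t) \<in> space (PiM (DS l) q)" if "a \<in> bins" "b \<in> positions l" "t < n" for a b t
    using candidate_space[OF that(1) l_less that(2)] c_space that(3) by (auto simp: space_PiM PiE_iff)
  have nonempty: "positions l \<noteq> {}" using B_pos by (auto simp: positions_def PiE_eq_empty_iff)
  have "\<exists>s\<in>measurable ?Y (count_space (positions l)). \<forall>ys. (\<exists>b\<in>positions l. ?typ a b ys) \<longrightarrow> ?typ a (s ys) ys"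
    if "a \<in> bins" for a
  proof (rule measurable_finite_selector_exists[OF finite_positions[OF l_less] nonempty])
    show "Measurable.pred ?Y (?typ a b)" if "b \<in> positions l" for b
      by (rule dec_typical_measurable[OF l_less]) (use candidate \<open>a \<in> bins\<close> that in auto)
  qed
  then obtain s where s_measurable: "\<And>a. a \<in> bins \<Longrightarrow> s a \<in> measurable ?Y (count_space (positions l))"
    and s_typ: "\<And>a b ys. a \<in> bins \<Longrightarrow> b \<in> positions l \<Longrightarrow> ?typ a b ys \<Longrightarrow> ?typ a (s a ys) ys"
    by metis
  show ?thesis
  proof (intro exI[of _ "\<lambda>a t ys. candidate l a (s a ys) (c t)"] conjI ballI allI impI)
    fix a t assume "a \<in> bins" "t < n"
    then show "(\<lambda>ys. candidate l a (s a ys) (c t)) \<in> measurable ?Y (PiM (DS l) q)"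
      using candidate by (intro measurable_compose[OF s_measurable]) simp_all
  next
    fix j z t assume j_in: "j \<in> selections" and z_space: "z \<in> space (PiM {..<n} (\<lambda>_. P))"
      and no_failure: "\<not> failure j (zip_block z c)" and "t < n"
    let ?y = "\<lambda>t\<in>{..<n}. py l (z t)"
    have "?y \<in> space ?Y"
      using z_space measurable_space[OF py_measurable[OF l_less]] by (auto simp: space_PiM PiE_iff)
    then have "s (bin_of j) ?y \<in> positions l"
      using measurable_space[OF s_measurable[OF bin_of_in_bins[OF j_in]]] by auto
    moreover have "?typ (bin_of j) (s (bin_of j) ?y) ?y"
      by (rule s_typ[OF bin_of_in_bins[OF j_in] position_of_in_positions[OF j_in l_less]
            not_failure_imp_dec_typical[OF no_failure l_less]])
    ultimately have "s (bin_of j) ?y = position_of l j"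
      by (rule not_failure_imp_unique_position[OF no_failure l_less])
    then show "candidate l (bin_of j) (s (bin_of j) ?y) (c t) = restrict (chosen j (c t)) (DS l)"
      by (simp only: candidate_position_of[OF l_less])
  qed
qed

end

section \<open>Vanishing error probability\<close>

definition exp_size :: "real \<Rightarrow> nat \<Rightarrow> nat" where
  "exp_size r n = nat \<lceil>exp (real n * r)\<rceil>"

lemma exp_size_pos: "exp_size r n > 0"
  by (simp add: exp_size_def)

lemma exp_size_ge: "exp (real n * r) \<le> real (exp_size r n)"
  unfolding exp_size_def by linarith

lemma exp_size_minus_1_le: "real (exp_size r n - 1) \<le> exp (real n * r)"
proof -
  have "real (exp_size r n) \<le> exp (real n * r) + 1"
    unfolding exp_size_def using exp_ge_zero[of "real n * r"] by linarith
  then show ?thesis using exp_size_pos[of r n] by (simp add: of_nat_diff)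
qed

lemma ln_exp_size_le:
  assumes "r \<ge> 0" shows "ln (real (exp_size r n)) \<le> real n * r + ln 2"
proof -
  have "real (exp_size r n) \<le> exp (real n * r) + 1"
    using exp_size_minus_1_le[of r n] exp_size_pos[of r n] by (simp add: of_nat_diff)
  also have "\<dots> \<le> exp (real n * r) * 2" using assms by simp
  finally have "ln (real (exp_size r n)) \<le> ln (exp (real n * r) * 2)"
    using exp_size_pos[of r n] by (intro ln_mono) auto
  then show ?thesis by (simp add: ln_mult)
qed

lemma ln_card_PiE_exp_size_le:
  assumes finite_V: "finite V" and r_nonneg: "\<And>S. S \<in> V \<Longrightarrow> r S \<ge> 0" and n_pos: "n > 0"
  shows "ln (real (card (PiE V (\<lambda>S. {..<exp_size (r S) n})))) / real n
    \<le> (\<Sum>S\<in>V. r S) + real (card V) * (ln 2 / real n)"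
proof -
  have "ln (real (card (PiE V (\<lambda>S. {..<exp_size (r S) n})))) = (\<Sum>S\<in>V. ln (real (exp_size (r S) n)))"
    using finite_V exp_size_pos by (simp add: card_PiE) (rule ln_prod, auto simp: less_imp_neq[THEN not_sym])
  also have "\<dots> \<le> (\<Sum>S\<in>V. real n * r S + ln 2)" using r_nonneg by (intro sum_mono ln_exp_size_le)
  also have "\<dots> = real n * ((\<Sum>S\<in>V. r S) + real (card V) * (ln 2 / real n))"
    using n_pos by (simp add: sum.distrib sum_distrib_left[symmetric] field_simps)
  finally show ?thesis using n_pos by (simp add: divide_le_eq mult.commute)
qed

lemma covering_error_tendsto_0:
  fixes r a b :: "'s \<Rightarrow> real"
  assumes less: "\<And>S. S \<in> V \<Longrightarrow> r S < a S + b S"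
  shows "(\<lambda>n. (\<Prod>S\<in>V. 1 + exp (real n * r S) / real (exp_size (a S) n * exp_size (b S) n)) - 1) \<longlonglongrightarrow> 0"
proof -
  have "(\<lambda>n. exp (real n * r S) / real (exp_size (a S) n * exp_size (b S) n)) \<longlonglongrightarrow> 0" if "S \<in> V" for S
  proof (rule tendsto_sandwich[OF _ _ tendsto_const])
    define \<delta> where "\<delta> = a S + b S - r S"
    have "\<delta> > 0" using less[OF that] by (simp add: \<delta>_def)
    then show "(\<lambda>n. exp (- \<delta> * real n)) \<longlonglongrightarrow> 0" by real_asymp
    have "exp (real n * r S) / real (exp_size (a S) n * exp_size (b S) n)
      \<le> exp (real n * r S) / (exp (real n * a S) * exp (real n * b S))" for n
      using exp_size_pos by (intro divide_left_mono) (auto intro!: mult_mono exp_size_ge)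
    also have "exp (real n * r S) / (exp (real n * a S) * exp (real n * b S)) = exp (- \<delta> * real n)" for n
      unfolding \<delta>_def exp_add[symmetric] exp_diff[symmetric] by (simp add: algebra_simps)
    finally show "\<forall>\<^sub>F n in sequentially.
        exp (real n * r S) / real (exp_size (a S) n * exp_size (b S) n) \<le> exp (- \<delta> * real n)"
      by (intro always_eventually allI)
  qed simp
  then have "(\<lambda>n. (\<Prod>S\<in>V. 1 + exp (real n * r S) / real (exp_size (a S) n * exp_size (b S) n)) - 1)
    \<longlonglongrightarrow> (\<Prod>S\<in>V. 1 + 0) - 1"
    by (intro tendsto_intros)
  then show ?thesis by simp
qed

lemma packing_error_tendsto_0:
  fixes r b :: "'s \<Rightarrow> real"
  assumes \<theta>_pos: "\<theta> > 0" and rate_le: "\<And>S. S \<in> V \<Longrightarrow> b S + 2 * \<theta> \<le> r S"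
  shows "(\<lambda>n. exp (real n * \<theta>) * ((\<Prod>S\<in>V. 1 + real (exp_size (b S) n - 1) * exp (- real n * r S)) - 1)) \<longlonglongrightarrow> 0"
    (is "(\<lambda>n. exp (real n * \<theta>) * (?p n - 1)) \<longlonglongrightarrow> 0")
proof (rule tendsto_sandwich[OF _ _ tendsto_const])
  define d where "d = real (card V)"
  show "(\<lambda>n. exp (real n * \<theta>) * (exp (d * exp (- 2 * \<theta> * real n)) - 1)) \<longlonglongrightarrow> 0"
    using \<theta>_pos by real_asymp
  have factor: "1 + real (exp_size (b S) n - 1) * exp (- real n * r S) \<le> exp (exp (- 2 * \<theta> * real n))"
    if "S \<in> V" for S n
  proof -
    have "real (exp_size (b S) n - 1) * exp (- real n * r S) \<le> exp (real n * b S) * exp (- real n * r S)"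
      by (intro mult_right_mono exp_size_minus_1_le) auto
    also have "\<dots> = exp (real n * (b S - r S))" unfolding exp_add[symmetric] by (simp add: algebra_simps)
    also have "\<dots> \<le> exp (real n * (- 2 * \<theta>))" unfolding exp_le_cancel_iff
      using rate_le[OF that] by (intro mult_left_mono) auto
    also have "\<dots> = exp (- 2 * \<theta> * real n)" by (simp add: mult.commute)
    finally show ?thesis using exp_ge_add_one_self[of "exp (- 2 * \<theta> * real n)"] by linarith
  qed
  have "?p n \<le> (\<Prod>S\<in>V. exp (exp (- 2 * \<theta> * real n)))" for n
    by (intro prod_mono conjI factor) simp_all
  then have "?p n \<le> exp (d * exp (- 2 * \<theta> * real n))" for n by (simp add: d_def exp_of_nat_mult)
  then show "\<forall>\<^sub>F n in sequentially.
      exp (real n * \<theta>) * (?p n - 1) \<le> exp (real n * \<theta>) * (exp (d * exp (- 2 * \<theta> * real n)) - 1)"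
    by (intro always_eventually allI mult_left_mono diff_right_mono) auto
  show "\<forall>\<^sub>F n in sequentially. 0 \<le> exp (real n * \<theta>) * (?p n - 1)"
    by (intro always_eventually allI mult_nonneg_nonneg) (auto intro!: prod_ge_1)
qed

context codebook_densities
begin

lemma enc_atypical_tendsto_0:
  assumes joint: "prob_space joint_law" and \<theta>_pos: "\<theta> > 0"
    and ln_rho: "\<And>S. S \<in> set vs \<Longrightarrow> integrable joint_law (\<lambda>z. ln (\<rho> S (px (fst z)) (snd z)))"
    and mean: "\<And>S. S \<in> set vs \<Longrightarrow> (\<integral>z. ln (\<rho> S (px (fst z)) (snd z)) \<partial>joint_law) \<le> R S + R' S"
  shows "(\<lambda>n. measure (PiM {..<n} (\<lambda>_. joint_law)) {z\<in>space (PiM {..<n} (\<lambda>_. joint_law)).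
      \<not> enc_typical n \<theta> (\<lambda>t. px (fst (z t))) (\<lambda>t. snd (z t))}) \<longlonglongrightarrow> 0"
proof -
  let ?J = "\<lambda>n. PiM {..<n::nat} (\<lambda>_. joint_law)"
  let ?bad = "\<lambda>S n. {z\<in>space (?J n).
    exp (real n * (R S + R' S + \<theta>)) < (\<Prod>t<n. \<rho> S (px (fst (z t))) (snd (z t)))}"
  have "(\<lambda>n. measure (?J n) (\<Union>S\<in>set vs. ?bad S n)) \<longlonglongrightarrow> 0"
  proof (rule measure_UN_tendsto_0)
    show "finite_measure (?J n)" for n by (intro prob_space.finite_measure prob_space_PiM joint)
    fix S assume S_in: "S \<in> set vs"
    have [measurable]: "(\<lambda>z. \<rho> S (px (fst z)) (snd z)) \<in> borel_measurable joint_law"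
      using rho_comp_measurable[OF S_in, of "\<lambda>z. px (fst z)" joint_law snd] by measurable
    show "?bad S n \<in> sets (?J n)" for n by measurable
    show "(\<lambda>n. measure (?J n) (?bad S n)) \<longlonglongrightarrow> 0"
      by (rule measure_PiM_prod_gt_exp_tendsto_0[OF joint rho_nonneg ln_rho[OF S_in] mean[OF S_in] \<theta>_pos])
  qed simp
  also have "(\<lambda>n. \<Union>S\<in>set vs. ?bad S n) = (\<lambda>n. {z\<in>space (?J n).
      \<not> enc_typical n \<theta> (\<lambda>t. px (fst (z t))) (\<lambda>t. snd (z t))})"
    by (auto simp: enc_typical_def not_le)
  finally show ?thesis .
qed

lemma dec_atypical_tendsto_0:
  assumes joint: "prob_space joint_law" and \<theta>_pos: "\<theta> > 0"
    and ln_g: "\<And>l D. l < m \<Longrightarrow> D \<subseteq> DS l \<Longrightarrow> D \<noteq> {} \<Longrightarrow>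
      ln_mean_ge joint_law (\<lambda>z. \<Prod>S\<in>D. g l D S (py l (fst z)) (restrict (snd z) (DS l))) (\<Sum>S\<in>D. R' S)"
  shows "(\<lambda>n. measure (PiM {..<n} (\<lambda>_. joint_law)) {z\<in>space (PiM {..<n} (\<lambda>_. joint_law)).
      \<not> (\<forall>l<m. dec_typical n \<theta> l (\<lambda>t. py l (fst (z t))) (\<lambda>t. restrict (snd (z t)) (DS l)))}) \<longlonglongrightarrow> 0"
proof -
  let ?J = "\<lambda>n. PiM {..<n::nat} (\<lambda>_. joint_law)"
  let ?G = "\<lambda>p z. \<Prod>S\<in>snd p. g (fst p) (snd p) S (py (fst p) (fst z)) (restrict (snd z) (DS (fst p)))"
  let ?bad = "\<lambda>p n. {z\<in>space (?J n). (\<Prod>t<n. ?G p (z t)) < exp (real n * ((\<Sum>S\<in>snd p. R' S) - \<theta>))}"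
  define I where "I = Sigma {..<m} (\<lambda>l. Pow (DS l) - {{}})"
  have "(\<lambda>n. measure (?J n) (\<Union>p\<in>I. ?bad p n)) \<longlonglongrightarrow> 0"
  proof (rule measure_UN_tendsto_0)
    show "finite_measure (?J n)" for n by (intro prob_space.finite_measure prob_space_PiM joint)
    show "finite I" unfolding I_def using finite_DS by auto
    fix p assume "p \<in> I"
    then obtain l D where p_eq: "p = (l, D)" and l_less: "l < m" and D_props: "D \<subseteq> DS l" "D \<noteq> {}"
      by (auto simp: I_def)
    note [measurable] = py_measurable[OF l_less] measurable_restrict_subset[OF DS_subset[OF l_less], of q]
    have "(\<lambda>z. restrict (snd z) (DS l)) \<in> measurable joint_law (PiM (DS l) q)"
      by (rule measurable_compose[OF _ measurable_restrict_subset[OF DS_subset[OF l_less]]]) measurable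
    then have [measurable]: "?G p \<in> borel_measurable joint_law"
      unfolding p_eq fst_conv snd_conv
      by (intro borel_measurable_prod g_comp_measurable[OF l_less D_props(1)]) measurable
    show "?bad p n \<in> sets (?J n)" for n by measurable
    show "(\<lambda>n. measure (?J n) (?bad p n)) \<longlonglongrightarrow> 0"
      using measure_PiM_prod_less_exp_tendsto_0[OF joint ln_g[OF l_less D_props] \<theta>_pos] by (simp add: p_eq)
  qed
  moreover have "(\<Union>p\<in>I. ?bad p n) = {z\<in>space (?J n).
      \<not> (\<forall>l<m. dec_typical n \<theta> l (\<lambda>t. py l (fst (z t))) (\<lambda>t. restrict (snd (z t)) (DS l)))}" for n
  proof (intro set_eqI iffI)
    fix z assume "z \<in> {z\<in>space (?J n).
      \<not> (\<forall>l<m. dec_typical n \<theta> l (\<lambda>t. py l (fst (z t))) (\<lambda>t. restrict (snd (z t)) (DS l)))}"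
    then obtain l D where "l < m" "D \<in> Pow (DS l) - {{}}" "z \<in> ?bad (l, D) n"
      by (auto simp: dec_typical_def not_le)
    then show "z \<in> (\<Union>p\<in>I. ?bad p n)" by (intro UN_I[of "(l, D)"]) (auto simp: I_def)
  next
    fix z assume "z \<in> (\<Union>p\<in>I. ?bad p n)"
    then obtain l D where "l < m" "D \<in> Pow (DS l) - {{}}" "z \<in> ?bad (l, D) n"
      unfolding I_def by (elim UN_E SigmaE) simp
    then show "z \<in> {z\<in>space (?J n).
        \<not> (\<forall>l<m. dec_typical n \<theta> l (\<lambda>t. py l (fst (z t))) (\<lambda>t. restrict (snd (z t)) (DS l)))}"
      unfolding dec_typical_def by (simp add: not_le) blast
  qed
  ultimately show ?thesis by simp
qed

end

section \<open>Information densities\<close>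

lemma distr_fst_density:
  assumes "sigma_finite_measure N" and h_measurable[measurable]: "h \<in> borel_measurable (M \<Otimes>\<^sub>M N)"
  shows "distr (density (M \<Otimes>\<^sub>M N) h) M fst = density M (\<lambda>x. \<integral>\<^sup>+y. h (x, y) \<partial>N)"
proof (rule measure_eqI)
  interpret sigma_finite_measure N by fact
  fix C assume "C \<in> sets (distr (density (M \<Otimes>\<^sub>M N) h) M fst)"
  then have C_sets[measurable]: "C \<in> sets M" by simp
  have "emeasure (distr (density (M \<Otimes>\<^sub>M N) h) M fst) C
    = (\<integral>\<^sup>+z. h z * indicator (fst -` C \<inter> space (M \<Otimes>\<^sub>M N)) z \<partial>(M \<Otimes>\<^sub>M N))"
    by (subst emeasure_distr) (auto simp: emeasure_density)
  also have "\<dots> = (\<integral>\<^sup>+z. h z * indicator C (fst z) \<partial>(M \<Otimes>\<^sub>M N))"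
    by (intro nn_integral_cong) (auto simp: indicator_def)
  also have "\<dots> = (\<integral>\<^sup>+x. (\<integral>\<^sup>+y. h (x, y) \<partial>N) * indicator C x \<partial>M)"
    by (subst nn_integral_fst[symmetric]) (auto intro!: nn_integral_cong nn_integral_multc)
  finally show "emeasure (distr (density (M \<Otimes>\<^sub>M N) h) M fst) C = emeasure (density M (\<lambda>x. \<integral>\<^sup>+y. h (x, y) \<partial>N)) C"
    by (simp add: emeasure_density)
qed simp

lemma (in pair_sigma_finite) distr_snd_density:
  assumes h_measurable[measurable]: "h \<in> borel_measurable (M1 \<Otimes>\<^sub>M M2)"
  shows "distr (density (M1 \<Otimes>\<^sub>M M2) h) M2 snd = density M2 (\<lambda>y. \<integral>\<^sup>+x. h (x, y) \<partial>M1)"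
proof (rule measure_eqI)
  fix C assume "C \<in> sets (distr (density (M1 \<Otimes>\<^sub>M M2) h) M2 snd)"
  then have C_sets[measurable]: "C \<in> sets M2" by simp
  have "emeasure (distr (density (M1 \<Otimes>\<^sub>M M2) h) M2 snd) C
    = (\<integral>\<^sup>+z. h z * indicator (snd -` C \<inter> space (M1 \<Otimes>\<^sub>M M2)) z \<partial>(M1 \<Otimes>\<^sub>M M2))"
    by (subst emeasure_distr) (auto simp: emeasure_density)
  also have "\<dots> = (\<integral>\<^sup>+z. h z * indicator C (snd z) \<partial>(M1 \<Otimes>\<^sub>M M2))"
    by (intro nn_integral_cong) (auto simp: indicator_def)
  also have "\<dots> = (\<integral>\<^sup>+y. (\<integral>\<^sup>+x. h (x, y) \<partial>M1) * indicator C y \<partial>M2)"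
    by (subst nn_integral_snd[symmetric]) (auto intro!: nn_integral_cong nn_integral_multc)
  finally show "emeasure (distr (density (M1 \<Otimes>\<^sub>M M2) h) M2 snd) C
    = emeasure (density M2 (\<lambda>y. \<integral>\<^sup>+x. h (x, y) \<partial>M1)) C"
    by (simp add: emeasure_density)
qed simp

lemma AE_density_pos:
  assumes "f \<in> borel_measurable M" shows "AE x in density M f. 0 < f x"
  using assms by (simp add: AE_density)

lemma absolutely_continuous_marginals:
  assumes "prob_space \<alpha>" and "prob_space \<beta>" and "prob_space J"
    and sets_J: "sets J = sets (\<alpha> \<Otimes>\<^sub>M \<beta>)" and absolutely_continuous: "absolutely_continuous (\<alpha> \<Otimes>\<^sub>M \<beta>) J"
  shows "absolutely_continuous (distr J \<alpha> fst \<Otimes>\<^sub>M distr J \<beta> snd) J"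
proof -
  interpret \<alpha>: prob_space \<alpha> by fact
  interpret \<beta>: prob_space \<beta> by fact
  interpret J: prob_space J by fact
  interpret pair_prob_space \<alpha> \<beta> ..
  note [measurable_cong] = sets_J
  interpret A: prob_space "distr J \<alpha> fst" by (rule J.prob_space_distr) measurable
  interpret B: prob_space "distr J \<beta> snd" by (rule J.prob_space_distr) measurable
  define h where "h = RN_deriv (\<alpha> \<Otimes>\<^sub>M \<beta>) J"
  have [measurable]: "h \<in> borel_measurable (\<alpha> \<Otimes>\<^sub>M \<beta>)" by (simp add: h_def)
  have J_eq: "J = density (\<alpha> \<Otimes>\<^sub>M \<beta>) h"
    unfolding h_def using density_RN_deriv[OF absolutely_continuous sets_J] by simp
  define hA where "hA x = (\<integral>\<^sup>+y. h (x, y) \<partial>\<beta>)" for x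
  define hB where "hB y = (\<integral>\<^sup>+x. h (x, y) \<partial>\<alpha>)" for y
  have [measurable]: "hA \<in> borel_measurable \<alpha>" "hB \<in> borel_measurable \<beta>"
    unfolding hA_def hB_def by measurable
  have margA: "distr J \<alpha> fst = density \<alpha> hA" and margB: "distr J \<beta> snd = density \<beta> hB"
    unfolding hA_def hB_def
    by (simp_all add: J_eq distr_fst_density distr_snd_density \<beta>.sigma_finite_measure_axioms)
  have prod: "distr J \<alpha> fst \<Otimes>\<^sub>M distr J \<beta> snd = density (\<alpha> \<Otimes>\<^sub>M \<beta>) (\<lambda>(x, y). hA x * hB y)"
    unfolding margA margB
    by (rule pair_measure_density)
      (use A.sigma_finite_measure_axioms B.sigma_finite_measure_axioms in
        \<open>auto simp: margA margB \<beta>.sigma_finite_measure_axioms\<close>)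
  have "AE x in distr J \<alpha> fst. 0 < hA x" "AE y in distr J \<beta> snd. 0 < hB y"
    unfolding margA margB by (rule AE_density_pos, measurable)+
  then have marginal_density_pos: "AE z in J. 0 < hA (fst z)" "AE z in J. 0 < hB (snd z)"
    by (auto dest!: AE_distrD[rotated])
  show ?thesis
  proof (unfold absolutely_continuous_def, safe)
    fix N assume N_in: "N \<in> null_sets (distr J \<alpha> fst \<Otimes>\<^sub>M distr J \<beta> snd)"
    then have [measurable]: "N \<in> sets J" by (auto simp: null_sets_def sets_J cong: sets_pair_measure_cong)
    have "AE z in \<alpha> \<Otimes>\<^sub>M \<beta>. 0 < hA (fst z) * hB (snd z) \<longrightarrow> z \<notin> N"
      using AE_not_in[OF N_in] unfolding prod by (subst (asm) AE_density) (auto simp: case_prod_beta')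
    then have "AE z in J. 0 < hA (fst z) * hB (snd z) \<longrightarrow> z \<notin> N"
      by (rule absolutely_continuous_AE[OF sets_J absolutely_continuous])
    with marginal_density_pos have "AE z in J. z \<notin> N" by eventually_elim (auto simp: ennreal_zero_less_mult_iff)
    then show "N \<in> null_sets J" by (simp add: AE_iff_null_sets)
  qed
qed

definition kl_fun :: "real \<Rightarrow> real" where
  "kl_fun x = x * ln x - x + 1"

lemma kl_fun_nonneg:
  assumes "x \<ge> 0" shows "kl_fun x \<ge> 0"
proof (cases "x = 0")
  case False
  then have x_pos: "x > 0" using assms by simp
  then have "x * (- ln x) \<le> x * (1/x - 1)"
    using ln_le_minus_one[of "1/x"] by (intro mult_left_mono) (auto simp: ln_div)
  then show ?thesis using x_pos by (simp add: kl_fun_def right_diff_distrib)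
qed (simp add: kl_fun_def)

definition kl_trunc :: "nat \<Rightarrow> real \<Rightarrow> real" where
  "kl_trunc n x = x * min (ln x) (real (Suc n)) - x + 1"

lemma kl_trunc_nonneg:
  assumes "x \<ge> 0" shows "kl_trunc n x \<ge> 0"
proof (cases "ln x \<le> real (Suc n)")
  case True
  then show ?thesis using kl_fun_nonneg[OF assms] by (simp add: kl_trunc_def kl_fun_def min_def)
next
  case False
  then have "kl_trunc n x = x * real n + 1" by (simp add: kl_trunc_def min_def algebra_simps)
  then show ?thesis using assms by simp
qed

lemma kl_trunc_mono: "x \<ge> 0 \<Longrightarrow> n \<le> n' \<Longrightarrow> kl_trunc n x \<le> kl_trunc n' x"
  unfolding kl_trunc_def by (intro add_right_mono diff_right_mono mult_left_mono) auto

lemma kl_trunc_le_kl_fun: "x \<ge> 0 \<Longrightarrow> kl_trunc n x \<le> kl_fun x"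
  unfolding kl_trunc_def kl_fun_def by (intro add_right_mono diff_right_mono mult_left_mono) auto

lemma kl_fun_eq_SUP_kl_trunc:
  assumes "x \<ge> 0" shows "ennreal (kl_fun x) = (SUP n. ennreal (kl_trunc n x))"
proof (rule antisym)
  obtain N :: nat where "ln x \<le> real N" using real_arch_simple by blast
  then have "kl_fun x = kl_trunc N x" by (simp add: kl_fun_def kl_trunc_def min_def)
  then show "ennreal (kl_fun x) \<le> (SUP n. ennreal (kl_trunc n x))" by (auto intro: SUP_upper2[of N])
qed (auto intro!: SUP_least ennreal_leI kl_trunc_le_kl_fun assms)

lemma borel_measurable_kl[measurable (raw)]:
  assumes [measurable]: "f \<in> borel_measurable M"
  shows "(\<lambda>x. kl_fun (f x)) \<in> borel_measurable M" and "(\<lambda>x. kl_trunc n (f x)) \<in> borel_measurable M"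
  unfolding kl_fun_def kl_trunc_def by measurable

lemma mutual_info_nonneg: "mutual_info M SA SB A B \<ge> 0"
  by (simp add: mutual_info_def Let_def)

lemma mutual_info_finite_imp_ac:
  "mutual_info M SA SB A B < \<infinity> \<Longrightarrow>
    absolutely_continuous (distr M SA A \<Otimes>\<^sub>M distr M SB B) (distr M (SA \<Otimes>\<^sub>M SB) (\<lambda>\<omega>. (A \<omega>, B \<omega>)))"
  by (auto simp: mutual_info_def Let_def split: if_splits)

lemma mutual_info_cong_sets:
  assumes [simp]: "sets SA = sets SA'" "sets SB = sets SB'"
  shows "mutual_info M SA SB A B = mutual_info M SA' SB' A B"
proof -
  have "distr M SA A = distr M SA' A" "distr M SB B = distr M SB' B"
    "distr M (SA \<Otimes>\<^sub>M SB) (\<lambda>\<omega>. (A \<omega>, B \<omega>)) = distr M (SA' \<Otimes>\<^sub>M SB') (\<lambda>\<omega>. (A \<omega>, B \<omega>))"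
    by (intro distr_cong refl sets_pair_measure_cong assms)+
  then show ?thesis by (simp add: mutual_info_def)
qed

text \<open>The density is set to 0 on the sections on which its integral exceeds 1. These form a null set,
  and discarding them makes the integrals over both coordinates at most 1 everywhere.\<close>
definition info_density where
  "info_density M SA SB A B =
    (let f = \<lambda>z. enn2real (RN_deriv (distr M SA A \<Otimes>\<^sub>M distr M SB B) (distr M (SA \<Otimes>\<^sub>M SB) (\<lambda>\<omega>. (A \<omega>, B \<omega>))) z)
     in (\<lambda>z. if (\<integral>\<^sup>+a. ennreal (f (a, snd z)) \<partial>distr M SA A) \<le> 1 \<and>
         (\<integral>\<^sup>+b. ennreal (f (fst z, b)) \<partial>distr M SB B) \<le> 1 then f z else 0))"

lemma info_density_nonneg: "info_density M SA SB A B z \<ge> 0"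
  by (simp add: info_density_def Let_def)

lemma nn_integral_info_density_fst_le_1:
  "(\<integral>\<^sup>+a. ennreal (info_density M SA SB A B (a, b)) \<partial>distr M SA A) \<le> 1"
proof -
  let ?f = "\<lambda>z. enn2real (RN_deriv (distr M SA A \<Otimes>\<^sub>M distr M SB B) (distr M (SA \<Otimes>\<^sub>M SB) (\<lambda>\<omega>. (A \<omega>, B \<omega>))) z)"
  show ?thesis
  proof (cases "(\<integral>\<^sup>+a. ennreal (?f (a, b)) \<partial>distr M SA A) \<le> 1")
    case True
    have "(\<integral>\<^sup>+a. ennreal (info_density M SA SB A B (a, b)) \<partial>distr M SA A) \<le> (\<integral>\<^sup>+a. ennreal (?f (a, b)) \<partial>distr M SA A)"
      by (intro nn_integral_mono) (simp add: info_density_def Let_def)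
    then show ?thesis using True by simp
  qed (simp add: info_density_def Let_def)
qed

lemma nn_integral_info_density_snd_le_1:
  "(\<integral>\<^sup>+b. ennreal (info_density M SA SB A B (a, b)) \<partial>distr M SB B) \<le> 1"
proof -
  let ?f = "\<lambda>z. enn2real (RN_deriv (distr M SA A \<Otimes>\<^sub>M distr M SB B) (distr M (SA \<Otimes>\<^sub>M SB) (\<lambda>\<omega>. (A \<omega>, B \<omega>))) z)"
  show ?thesis
  proof (cases "(\<integral>\<^sup>+b. ennreal (?f (a, b)) \<partial>distr M SB B) \<le> 1")
    case True
    have "(\<integral>\<^sup>+b. ennreal (info_density M SA SB A B (a, b)) \<partial>distr M SB B) \<le> (\<integral>\<^sup>+b. ennreal (?f (a, b)) \<partial>distr M SB B)"
      by (intro nn_integral_mono) (simp add: info_density_def Let_def)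
    then show ?thesis using True by simp
  qed (simp add: info_density_def Let_def)
qed

lemma
  assumes [measurable]: "Z \<in> measurable M N" "A \<in> measurable N SA" "B \<in> measurable N SB"
  shows mutual_info_distr: "mutual_info (distr M N Z) SA SB A B = mutual_info M SA SB (\<lambda>\<omega>. A (Z \<omega>)) (\<lambda>\<omega>. B (Z \<omega>))"
    and info_density_distr: "info_density (distr M N Z) SA SB A B = info_density M SA SB (\<lambda>\<omega>. A (Z \<omega>)) (\<lambda>\<omega>. B (Z \<omega>))"
proof -
  have "distr (distr M N Z) SA A = distr M SA (\<lambda>\<omega>. A (Z \<omega>))" "distr (distr M N Z) SB B = distr M SB (\<lambda>\<omega>. B (Z \<omega>))"
    "distr (distr M N Z) (SA \<Otimes>\<^sub>M SB) (\<lambda>z. (A z, B z)) = distr M (SA \<Otimes>\<^sub>M SB) (\<lambda>\<omega>. (A (Z \<omega>), B (Z \<omega>)))"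
    by (simp_all add: distr_distr comp_def)
  then show "mutual_info (distr M N Z) SA SB A B = mutual_info M SA SB (\<lambda>\<omega>. A (Z \<omega>)) (\<lambda>\<omega>. B (Z \<omega>))"
    and "info_density (distr M N Z) SA SB A B = info_density M SA SB (\<lambda>\<omega>. A (Z \<omega>)) (\<lambda>\<omega>. B (Z \<omega>))"
    by (simp_all only: mutual_info_def info_density_def)
qed

locale random_pair = prob_space M for M :: "'a measure" +
  fixes SA :: "'b measure" and SB :: "'c measure" and A B
  assumes A_measurable[measurable]: "A \<in> measurable M SA"
    and B_measurable[measurable]: "B \<in> measurable M SB"
begin

abbreviation "PA \<equiv> distr M SA A"
abbreviation "PB \<equiv> distr M SB B"
abbreviation "PAB \<equiv> distr M (SA \<Otimes>\<^sub>M SB) (\<lambda>\<omega>. (A \<omega>, B \<omega>))"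
abbreviation "raw_density z \<equiv> enn2real (RN_deriv (PA \<Otimes>\<^sub>M PB) PAB z)"
abbreviation "i_dens \<equiv> info_density M SA SB A B"

lemma pair_prob_space_marginals: "pair_prob_space PA PB"
  by (intro pair_prob_space.intro pair_sigma_finite.intro prob_space_imp_sigma_finite prob_space_distr) auto

sublocale AB: pair_prob_space PA PB by (rule pair_prob_space_marginals)

sublocale J: prob_space PAB by (rule prob_space_distr) measurable

lemma sets_PA_PB[measurable_cong]: "sets (PA \<Otimes>\<^sub>M PB) = sets (SA \<Otimes>\<^sub>M SB)"
  by (simp cong: sets_pair_measure_cong)

lemma info_density_measurable[measurable]: "i_dens \<in> borel_measurable (SA \<Otimes>\<^sub>M SB)"
  unfolding info_density_def Let_def by measurable

context
  assumes ac: "absolutely_continuous (PA \<Otimes>\<^sub>M PB) PAB"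
begin

lemma PAB_eq_density_raw: "PAB = density (PA \<Otimes>\<^sub>M PB) (\<lambda>z. ennreal (raw_density z))"
proof -
  have sets_PAB: "sets PAB = sets (PA \<Otimes>\<^sub>M PB)" by (simp add: sets_PA_PB)
  have "AE z in PA \<Otimes>\<^sub>M PB. RN_deriv (PA \<Otimes>\<^sub>M PB) PAB z = ennreal (raw_density z)"
    using AB.RN_deriv_finite[OF J.sigma_finite_measure_axioms ac sets_PAB]
    by eventually_elim (auto simp: ennreal_enn2real_if)
  then have "density (PA \<Otimes>\<^sub>M PB) (RN_deriv (PA \<Otimes>\<^sub>M PB) PAB) = density (PA \<Otimes>\<^sub>M PB) (\<lambda>z. ennreal (raw_density z))"
    by (intro density_cong) auto
  then show ?thesis using AB.density_RN_deriv[OF ac sets_PAB] by simp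
qed

lemma AE_nn_integral_raw_density_eq_1:
  shows "AE a in PA. (\<integral>\<^sup>+b. ennreal (raw_density (a, b)) \<partial>PB) = 1"
    and "AE b in PB. (\<integral>\<^sup>+a. ennreal (raw_density (a, b)) \<partial>PA) = 1"
proof -
  have "density PA (\<lambda>a. \<integral>\<^sup>+b. ennreal (raw_density (a, b)) \<partial>PB) = distr PAB PA fst"
    by (subst PAB_eq_density_raw)
      (rule distr_fst_density[OF AB.M2.sigma_finite_measure_axioms, symmetric], measurable)
  also have "\<dots> = distr PAB SA fst" by (rule distr_cong) simp_all
  also have "\<dots> = PA" by (subst distr_distr) (auto simp: comp_def)
  also have "\<dots> = density PA (\<lambda>_. 1)" by (simp add: density_1)
  finally show "AE a in PA. (\<integral>\<^sup>+b. ennreal (raw_density (a, b)) \<partial>PB) = 1"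
    by (subst (asm) AB.M1.density_unique_iff) auto
  have "density PB (\<lambda>b. \<integral>\<^sup>+a. ennreal (raw_density (a, b)) \<partial>PA) = distr PAB PB snd"
    by (subst PAB_eq_density_raw) (rule AB.distr_snd_density[symmetric], measurable)
  also have "\<dots> = distr PAB SB snd" by (rule distr_cong) simp_all
  also have "\<dots> = PB" by (subst distr_distr) (auto simp: comp_def)
  also have "\<dots> = density PB (\<lambda>_. 1)" by (simp add: density_1)
  finally show "AE b in PB. (\<integral>\<^sup>+a. ennreal (raw_density (a, b)) \<partial>PA) = 1"
    by (subst (asm) AB.M2.density_unique_iff) auto
qed

lemma AE_info_density_eq_raw: "AE z in PA \<Otimes>\<^sub>M PB. i_dens z = raw_density z"
proof -
  have "AE z in PA \<Otimes>\<^sub>M PB. (\<integral>\<^sup>+b. ennreal (raw_density (fst z, b)) \<partial>PB) = 1"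
    by (rule AB.AE_pair_measure, measurable) (use AE_nn_integral_raw_density_eq_1(1) in simp)
  moreover have "AE z in PA \<Otimes>\<^sub>M PB. (\<integral>\<^sup>+a. ennreal (raw_density (a, snd z)) \<partial>PA) = 1"
    by (rule AB.AE_pair_measure, measurable) (use AE_nn_integral_raw_density_eq_1(2) in simp)
  ultimately show ?thesis by eventually_elim (simp add: info_density_def)
qed

lemma PAB_eq_density: "PAB = density (PA \<Otimes>\<^sub>M PB) (\<lambda>z. ennreal (i_dens z))"
  by (subst PAB_eq_density_raw, rule density_cong) (use AE_info_density_eq_raw in auto)

lemma AE_info_density_pos: "AE \<omega> in M. i_dens (A \<omega>, B \<omega>) > 0"
proof -
  have "AE z in PAB. i_dens z > 0" by (subst PAB_eq_density, subst AE_density) auto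
  then show ?thesis by (subst (asm) AE_distr_iff) auto
qed

lemma mutual_info_eq_nn_integral_kl:
  "mutual_info M SA SB A B = enn2ereal (\<integral>\<^sup>+z. ennreal (kl_fun (i_dens z)) \<partial>(PA \<Otimes>\<^sub>M PB))"
proof -
  have "(\<integral>\<^sup>+z. ennreal (kl_fun (raw_density z)) \<partial>(PA \<Otimes>\<^sub>M PB)) = (\<integral>\<^sup>+z. ennreal (kl_fun (i_dens z)) \<partial>(PA \<Otimes>\<^sub>M PB))"
    by (rule nn_integral_cong_AE) (use AE_info_density_eq_raw in auto)
  then show ?thesis using ac by (simp add: mutual_info_def Let_def kl_fun_def)
qed

lemma integrable_info_density: "integrable (PA \<Otimes>\<^sub>M PB) i_dens"
  and integral_info_density: "integral\<^sup>L (PA \<Otimes>\<^sub>M PB) i_dens = 1"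
proof -
  have "(\<integral>\<^sup>+z. ennreal (i_dens z) \<partial>(PA \<Otimes>\<^sub>M PB)) = (\<integral>\<^sup>+z. 1 \<partial>density (PA \<Otimes>\<^sub>M PB) (\<lambda>z. ennreal (i_dens z)))"
    by (simp add: nn_integral_density del: nn_integral_const)
  also have "\<dots> = 1" unfolding PAB_eq_density[symmetric] using J.emeasure_space_1 by simp
  finally have int: "(\<integral>\<^sup>+z. ennreal (i_dens z) \<partial>(PA \<Otimes>\<^sub>M PB)) = 1" .
  then show "integrable (PA \<Otimes>\<^sub>M PB) i_dens"
    by (intro integrableI_nonneg) (auto simp: info_density_nonneg)
  show "integral\<^sup>L (PA \<Otimes>\<^sub>M PB) i_dens = 1"
    using int by (simp add: integral_eq_nn_integral info_density_nonneg)
qed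

lemma
  fixes F :: "'b \<times> 'c \<Rightarrow> real"
  assumes F_measurable[measurable]: "F \<in> borel_measurable (SA \<Otimes>\<^sub>M SB)"
  shows integrable_pair_iff: "integrable M (\<lambda>\<omega>. F (A \<omega>, B \<omega>)) \<longleftrightarrow> integrable (PA \<Otimes>\<^sub>M PB) (\<lambda>z. i_dens z * F z)"
    and integral_pair: "(\<integral>\<omega>. F (A \<omega>, B \<omega>) \<partial>M) = (\<integral>z. i_dens z * F z \<partial>(PA \<Otimes>\<^sub>M PB))"
proof -
  have "integrable M (\<lambda>\<omega>. F (A \<omega>, B \<omega>)) \<longleftrightarrow> integrable PAB F"
    by (rule integrable_distr_eq[symmetric]) measurable
  also have "\<dots> \<longleftrightarrow> integrable (PA \<Otimes>\<^sub>M PB) (\<lambda>z. i_dens z * F z)"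
    by (subst PAB_eq_density, rule integrable_real_density) (auto simp: info_density_nonneg)
  finally show "integrable M (\<lambda>\<omega>. F (A \<omega>, B \<omega>)) \<longleftrightarrow> integrable (PA \<Otimes>\<^sub>M PB) (\<lambda>z. i_dens z * F z)" .
  have "(\<integral>\<omega>. F (A \<omega>, B \<omega>) \<partial>M) = integral\<^sup>L PAB F" by (rule integral_distr[symmetric]) measurable
  also have "\<dots> = (\<integral>z. i_dens z * F z \<partial>(PA \<Otimes>\<^sub>M PB))"
    by (subst PAB_eq_density, rule integral_real_density) (auto simp: info_density_nonneg)
  finally show "(\<integral>\<omega>. F (A \<omega>, B \<omega>) \<partial>M) = (\<integral>z. i_dens z * F z \<partial>(PA \<Otimes>\<^sub>M PB))" .
qed

lemma
  assumes finite: "mutual_info M SA SB A B < \<infinity>"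
  shows integrable_ln_info_density: "integrable M (\<lambda>\<omega>. ln (i_dens (A \<omega>, B \<omega>)))"
    and integral_ln_info_density: "ereal (\<integral>\<omega>. ln (i_dens (A \<omega>, B \<omega>)) \<partial>M) = mutual_info M SA SB A B"
proof -
  let ?Q = "PA \<Otimes>\<^sub>M PB"
  have "(\<integral>\<^sup>+z. ennreal (kl_fun (i_dens z)) \<partial>?Q) < \<infinity>"
    using finite unfolding mutual_info_eq_nn_integral_kl
    by (cases "\<integral>\<^sup>+z. ennreal (kl_fun (i_dens z)) \<partial>?Q") auto
  then have kl_integrable: "integrable ?Q (\<lambda>z. kl_fun (i_dens z))"
    by (intro integrableI_nonneg) (auto simp: kl_fun_nonneg info_density_nonneg)
  have expand: "(\<lambda>z. i_dens z * ln (i_dens z)) = (\<lambda>z. kl_fun (i_dens z) + i_dens z - 1)"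
    by (auto simp: kl_fun_def)
  show "integrable M (\<lambda>\<omega>. ln (i_dens (A \<omega>, B \<omega>)))"
    using kl_integrable integrable_info_density integrable_pair_iff[of "\<lambda>z. ln (i_dens z)"] by (simp add: expand)
  have "(\<integral>\<omega>. ln (i_dens (A \<omega>, B \<omega>)) \<partial>M) = (\<integral>z. kl_fun (i_dens z) \<partial>?Q)"
    using kl_integrable integrable_info_density integral_info_density integral_pair[of "\<lambda>z. ln (i_dens z)"]
    by (simp add: expand AB.prob_space)
  moreover have "(\<integral>\<^sup>+z. ennreal (kl_fun (i_dens z)) \<partial>?Q) = ennreal (\<integral>z. kl_fun (i_dens z) \<partial>?Q)"
    by (rule nn_integral_eq_integral[OF kl_integrable]) (simp add: kl_fun_nonneg info_density_nonneg)
  ultimately show "ereal (\<integral>\<omega>. ln (i_dens (A \<omega>, B \<omega>)) \<partial>M) = mutual_info M SA SB A B"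
    unfolding mutual_info_eq_nn_integral_kl
    by (simp add: enn2ereal_ennreal kl_fun_nonneg info_density_nonneg)
qed

lemma integrable_kl_trunc: "integrable (PA \<Otimes>\<^sub>M PB) (\<lambda>z. kl_trunc n (i_dens z))"
proof (rule Bochner_Integration.integrable_bound[where f="\<lambda>z. i_dens z * real (Suc n) + 1"])
  show "AE z in PA \<Otimes>\<^sub>M PB. norm (kl_trunc n (i_dens z)) \<le> norm (i_dens z * real (Suc n) + 1)"
  proof (rule AE_I2)
    fix z
    have "kl_trunc n (i_dens z) \<le> i_dens z * real (Suc n) - 0 + 1"
      unfolding kl_trunc_def by (intro add_mono diff_mono mult_left_mono) (auto simp: info_density_nonneg)
    then show "norm (kl_trunc n (i_dens z)) \<le> norm (i_dens z * real (Suc n) + 1)"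
      using kl_trunc_nonneg[OF info_density_nonneg, of n M SA SB A B z] by simp
  qed
qed (use integrable_info_density in auto)

lemma integrable_min_ln_info_density: "integrable M (\<lambda>\<omega>. min (ln (i_dens (A \<omega>, B \<omega>))) (real (Suc n)))"
  and integral_min_ln_info_density:
    "(\<integral>\<omega>. min (ln (i_dens (A \<omega>, B \<omega>))) (real (Suc n)) \<partial>M) = (\<integral>z. kl_trunc n (i_dens z) \<partial>(PA \<Otimes>\<^sub>M PB))"
proof -
  let ?F = "\<lambda>z. min (ln (i_dens z)) (real (Suc n))"
  have expand: "(\<lambda>z. i_dens z * ?F z) = (\<lambda>z. kl_trunc n (i_dens z) + i_dens z - 1)"
    by (auto simp: kl_trunc_def)
  have min_ln_measurable: "?F \<in> borel_measurable (SA \<Otimes>\<^sub>M SB)" by measurable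
  show "integrable M (\<lambda>\<omega>. ?F (A \<omega>, B \<omega>))"
    unfolding integrable_pair_iff[OF min_ln_measurable] expand using integrable_kl_trunc integrable_info_density
    by auto
  show "(\<integral>\<omega>. ?F (A \<omega>, B \<omega>) \<partial>M) = (\<integral>z. kl_trunc n (i_dens z) \<partial>(PA \<Otimes>\<^sub>M PB))"
    unfolding integral_pair[OF min_ln_measurable] expand
    using integrable_kl_trunc integrable_info_density by (simp add: integral_info_density AB.prob_space)
qed

lemma truncated_ln_info_density:
  assumes less: "ereal r < mutual_info M SA SB A B"
  shows "\<exists>n. r \<le> (\<integral>\<omega>. min (ln (i_dens (A \<omega>, B \<omega>))) (real (Suc n)) \<partial>M)"
  unfolding integral_min_ln_info_density
proof (cases "r < 0")
  case True
  moreover have "(\<integral>z. kl_trunc 0 (i_dens z) \<partial>(PA \<Otimes>\<^sub>M PB)) \<ge> 0"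
    by (intro integral_nonneg_AE AE_I2 kl_trunc_nonneg info_density_nonneg)
  ultimately show "\<exists>n. r \<le> (\<integral>z. kl_trunc n (i_dens z) \<partial>(PA \<Otimes>\<^sub>M PB))" by (intro exI[of _ 0]) auto
next
  case False
  let ?Q = "PA \<Otimes>\<^sub>M PB"
  have "(\<integral>\<^sup>+z. ennreal (kl_fun (i_dens z)) \<partial>?Q) = (SUP n. \<integral>\<^sup>+z. ennreal (kl_trunc n (i_dens z)) \<partial>?Q)"
    unfolding kl_fun_eq_SUP_kl_trunc[OF info_density_nonneg]
    by (rule nn_integral_monotone_convergence_SUP)
      (auto simp: incseq_def le_fun_def info_density_nonneg intro!: ennreal_leI kl_trunc_mono)
  then have "ennreal r < (SUP n. \<integral>\<^sup>+z. ennreal (kl_trunc n (i_dens z)) \<partial>?Q)"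
    using less False unfolding mutual_info_eq_nn_integral_kl
    by (simp add: less_ennreal.rep_eq enn2ereal_ennreal)
  then obtain n where "ennreal r < (\<integral>\<^sup>+z. ennreal (kl_trunc n (i_dens z)) \<partial>?Q)" by (auto simp: less_SUP_iff)
  also have "\<dots> = ennreal (\<integral>z. kl_trunc n (i_dens z) \<partial>?Q)"
    by (rule nn_integral_eq_integral[OF integrable_kl_trunc]) (simp add: kl_trunc_nonneg info_density_nonneg)
  finally show "\<exists>n. r \<le> (\<integral>z. kl_trunc n (i_dens z) \<partial>?Q)"
    using False by (auto simp: ennreal_less_iff intro: less_imp_le)
qed

end

end

lemma ereal_sum_lower_approx:
  fixes \<mu> :: "'s \<Rightarrow> ereal"
  assumes D_props: "finite D" "D \<noteq> {}" and \<mu>_nonneg: "\<And>S. S \<in> D \<Longrightarrow> \<mu> S \<ge> 0" and r_le: "ereal r \<le> (\<Sum>S\<in>D. \<mu> S)"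
    and e_pos: "e > 0"
  shows "\<exists>c. (\<forall>S\<in>D. ereal (c S) < \<mu> S) \<and> r - e \<le> (\<Sum>S\<in>D. c S)"
proof (cases "\<forall>S\<in>D. \<mu> S < \<infinity>")
  case True
  have card: "real (card D) > 0" using D_props by (simp add: card_gt_0_iff)
  have \<mu>_finite: "\<mu> S = ereal (real_of_ereal (\<mu> S))" if "S \<in> D" for S
    using True \<mu>_nonneg[OF that] that by (cases "\<mu> S") auto
  have "(\<Sum>S\<in>D. \<mu> S) = (\<Sum>S\<in>D. ereal (real_of_ereal (\<mu> S)))" by (rule sum.cong[OF refl \<mu>_finite])
  then have r_le_sum: "r \<le> (\<Sum>S\<in>D. real_of_ereal (\<mu> S))" using r_le by simp
  show ?thesis
  proof (intro exI[of _ "\<lambda>S. real_of_ereal (\<mu> S) - e / real (card D)"] conjI ballI)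
    fix S assume S_in: "S \<in> D"
    have "ereal (real_of_ereal (\<mu> S) - e / real (card D)) < ereal (real_of_ereal (\<mu> S))" using e_pos card by simp
    then show "ereal (real_of_ereal (\<mu> S) - e / real (card D)) < \<mu> S" using \<mu>_finite[OF S_in] by simp
  next
    show "r - e \<le> (\<Sum>S\<in>D. real_of_ereal (\<mu> S) - e / real (card D))" using r_le_sum card by (simp add: sum_subtractf)
  qed
next
  case False
  then obtain S0 where S0_infinite: "S0 \<in> D" "\<mu> S0 = \<infinity>" by auto
  define c where "c S = (if S = S0 then r + real (card D) else - 1)" for S
  have "(\<Sum>S\<in>D. c S) = (r + real (card D)) + (\<Sum>S\<in>D - {S0}. - 1)"
    using sum.remove[OF D_props(1) S0_infinite(1), of c] by (simp add: c_def)
  also have "\<dots> \<ge> r - e" using e_pos S0_infinite D_props by (simp add: of_nat_diff card_gt_0_iff)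
  finally have "r - e \<le> (\<Sum>S\<in>D. c S)" .
  moreover have "ereal (c S) < \<mu> S" if "S \<in> D" for S
    using \<mu>_nonneg[OF that] S0_infinite by (auto simp: c_def intro: less_le_trans[of _ "0::ereal"])
  ultimately show ?thesis by blast
qed

lemma ln_mean_ge_prod_info_density:
  assumes prob_space_M: "prob_space M" and D_props: "finite D" "D \<noteq> {}"
    and meas: "\<And>S. S \<in> D \<Longrightarrow> A S \<in> measurable M (SA S)" "\<And>S. S \<in> D \<Longrightarrow> B S \<in> measurable M (SB S)"
    and absolutely_continuous: "\<And>S. S \<in> D \<Longrightarrow> absolutely_continuous (distr M (SA S) (A S) \<Otimes>\<^sub>M distr M (SB S) (B S))
      (distr M (SA S \<Otimes>\<^sub>M SB S) (\<lambda>\<omega>. (A S \<omega>, B S \<omega>)))"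
    and r_le: "ereal r \<le> (\<Sum>S\<in>D. mutual_info M (SA S) (SB S) (A S) (B S))"
  shows "ln_mean_ge M (\<lambda>\<omega>. \<Prod>S\<in>D. info_density M (SA S) (SB S) (A S) (B S) (A S \<omega>, B S \<omega>)) r"
proof -
  let ?f = "\<lambda>S \<omega>. info_density M (SA S) (SB S) (A S) (B S) (A S \<omega>, B S \<omega>)"
  have pair: "random_pair M (SA S) (SB S) (A S) (B S)" if "S \<in> D" for S
    using prob_space_M meas that by (simp add: random_pair_def random_pair_axioms_def)
  have "AE \<omega> in M. \<forall>S\<in>D. ?f S \<omega> > 0"
    using random_pair.AE_info_density_pos[OF pair absolutely_continuous] D_props(1) by (simp add: AE_finite_all)
  then have product_pos: "AE \<omega> in M. (\<Prod>S\<in>D. ?f S \<omega>) > 0 \<and> (\<Sum>S\<in>D. ln (?f S \<omega>)) = ln (\<Prod>S\<in>D. ?f S \<omega>)"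
    by eventually_elim (auto intro!: prod_pos ln_prod[symmetric] D_props(1) dest: bspec)
  have "\<exists>h. integrable M h \<and> (AE \<omega> in M. h \<omega> \<le> ln (\<Prod>S\<in>D. ?f S \<omega>)) \<and> r - e \<le> integral\<^sup>L M h"
    if e_pos: "e > 0" for e
  proof -
    obtain c where c_approx: "\<And>S. S \<in> D \<Longrightarrow> ereal (c S) < mutual_info M (SA S) (SB S) (A S) (B S)" "r - e \<le> (\<Sum>S\<in>D. c S)"
      using ereal_sum_lower_approx[OF D_props mutual_info_nonneg r_le e_pos] by blast
    have "\<forall>S\<in>D. \<exists>n. c S \<le> (\<integral>\<omega>. min (ln (?f S \<omega>)) (real (Suc n)) \<partial>M)"
      using random_pair.truncated_ln_info_density[OF pair absolutely_continuous] c_approx(1) by blast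
    then obtain N where c_le_truncated: "\<And>S. S \<in> D \<Longrightarrow> c S \<le> (\<integral>\<omega>. min (ln (?f S \<omega>)) (real (Suc (N S))) \<partial>M)" by metis
    define h where "h \<omega> = (\<Sum>S\<in>D. min (ln (?f S \<omega>)) (real (Suc (N S))))" for \<omega>
    have trunc: "integrable M (\<lambda>\<omega>. min (ln (?f S \<omega>)) (real (Suc (N S))))" if "S \<in> D" for S
      by (rule random_pair.integrable_min_ln_info_density[OF pair absolutely_continuous]) fact+
    have "integrable M h" unfolding h_def by (intro Bochner_Integration.integrable_sum trunc)
    moreover have "integral\<^sup>L M h = (\<Sum>S\<in>D. \<integral>\<omega>. min (ln (?f S \<omega>)) (real (Suc (N S))) \<partial>M)"
      unfolding h_def by (intro Bochner_Integration.integral_sum trunc)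
    then have "r - e \<le> integral\<^sup>L M h" using order_trans[OF c_approx(2) sum_mono[OF c_le_truncated]] by (simp only:)
    moreover have h_le: "h \<omega> \<le> (\<Sum>S\<in>D. ln (?f S \<omega>))" for \<omega> unfolding h_def by (intro sum_mono) simp
    have "AE \<omega> in M. h \<omega> \<le> ln (\<Prod>S\<in>D. ?f S \<omega>)" using product_pos
    proof eventually_elim
      case (elim \<omega>)
      then show ?case using h_le[of \<omega>] by linarith
    qed
    ultimately show ?thesis by blast
  qed
  then show ?thesis using product_pos unfolding ln_mean_ge_def by auto
qed

lemma absolutely_continuous_distr:
  assumes absolutely_continuous: "absolutely_continuous R N" and sets_N: "sets N = sets R"
    and f_measurable[measurable]: "f \<in> measurable R K"
  shows "absolutely_continuous (distr R K f) (distr N K f)"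
proof -
  note [measurable_cong] = sets_N
  have space_N: "space N = space R" by (rule sets_eq_imp_space_eq[OF sets_N])
  show ?thesis
    using absolutely_continuous by (auto simp: absolutely_continuous_def null_sets_distr_iff space_N)
qed

lemma distr_coordinate_pair:
  assumes "prob_space P" and prob_space_q: "\<And>S. prob_space (q S)" and I_finite: "finite I" "S \<in> I"
    and B_measurable[measurable]: "B \<in> measurable (P \<Otimes>\<^sub>M PiM I q) SB" and inv: "\<And>a. ignores (\<lambda>u. B (a, u)) S"
  shows "distr (P \<Otimes>\<^sub>M PiM I q) (q S \<Otimes>\<^sub>M SB) (\<lambda>z. (snd z S, B z)) = q S \<Otimes>\<^sub>M distr (P \<Otimes>\<^sub>M PiM I q) SB B"
proof -
  let ?R = "P \<Otimes>\<^sub>M PiM I q"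
  interpret P: prob_space P by fact
  interpret Pq: prob_space "PiM I q" by (rule prob_space_PiM) (rule prob_space_q)
  interpret Ppq: pair_prob_space P "PiM I q" ..
  interpret qS: prob_space "q S" by (rule prob_space_q)
  interpret B: prob_space "distr ?R SB B" by (rule Ppq.P.prob_space_distr) (rule B_measurable)
  have [measurable]: "(\<lambda>u. u S) \<in> measurable (PiM I q) (q S)" using I_finite by simp
  have pair[measurable]: "(\<lambda>z. (snd z S, B z)) \<in> measurable ?R (q S \<Otimes>\<^sub>M SB)" by measurable
  show ?thesis
  proof (rule pair_measure_eqI[symmetric])
    fix C E assume C_sets[measurable]: "C \<in> sets (q S)" and "E \<in> sets (distr ?R SB B)"
    then have E_sets[measurable]: "E \<in> sets SB" by simp
    have slice: "(\<integral>\<^sup>+u. indicator C (u S) * indicator E (B (a, u)) \<partial>PiM I q)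
        = emeasure (q S) C * (\<integral>\<^sup>+u. indicator E (B (a, u)) \<partial>PiM I q)" if [simp]: "a \<in> space P" for a
    proof -
      have [measurable]: "(\<lambda>u. B (a, u)) \<in> measurable (PiM I q) SB" by simp
      have "(\<integral>\<^sup>+u. indicator C (u S) * indicator E (B (a, u)) \<partial>PiM I q)
         = (\<integral>\<^sup>+u. \<integral>\<^sup>+v. indicator C v * indicator E (B (a, u)) \<partial>q S \<partial>PiM I q)"
        by (subst nn_integral_PiM_fun_upd[OF prob_space_q I_finite]) (measurable, simp add: ignoresD[OF inv])
      then show ?thesis by (simp add: nn_integral_multc nn_integral_cmult)
    qed
    have "emeasure (distr ?R (q S \<Otimes>\<^sub>M SB) (\<lambda>z. (snd z S, B z))) (C \<times> E)
      = (\<integral>\<^sup>+z. indicator (C \<times> E) z \<partial>distr ?R (q S \<Otimes>\<^sub>M SB) (\<lambda>z. (snd z S, B z)))" by simp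
    also have "\<dots> = (\<integral>\<^sup>+z. indicator C (snd z S) * indicator E (B z) \<partial>?R)"
      by (subst nn_integral_distr) (auto simp: indicator_times)
    also have "\<dots> = (\<integral>\<^sup>+a. emeasure (q S) C * (\<integral>\<^sup>+u. indicator E (B (a, u)) \<partial>PiM I q) \<partial>P)"
      by (subst Pq.nn_integral_fst[symmetric]) (auto intro!: nn_integral_cong slice)
    also have "\<dots> = emeasure (q S) C * (\<integral>\<^sup>+z. indicator E (B z) \<partial>?R)"
      by (simp add: nn_integral_cmult Pq.nn_integral_fst[of "\<lambda>z. indicator E (B z)"])
    also have "(\<integral>\<^sup>+z. indicator E (B z) \<partial>?R) = (\<integral>\<^sup>+y. indicator E y \<partial>distr ?R SB B)"
      by (subst nn_integral_distr) auto
    finally show "emeasure (q S) C * emeasure (distr ?R SB B) E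
      = emeasure (distr ?R (q S \<Otimes>\<^sub>M SB) (\<lambda>z. (snd z S, B z))) (C \<times> E)" by simp
  qed (auto simp: qS.sigma_finite_measure_axioms B.sigma_finite_measure_axioms cong: sets_pair_measure_cong)
qed

lemma absolutely_continuous_coordinate:
  assumes prob_space_P: "prob_space P" and prob_space_q: "\<And>S. prob_space (q S)" and I_finite: "finite I" "S \<in> I"
    and B_measurable[measurable]: "B \<in> measurable (P \<Otimes>\<^sub>M PiM I q) SB" and inv: "\<And>a. ignores (\<lambda>u. B (a, u)) S"
    and "prob_space M" and Z_measurable[measurable]: "Z \<in> measurable M (P \<Otimes>\<^sub>M PiM I q)"
    and absolutely_continuous: "absolutely_continuous (P \<Otimes>\<^sub>M PiM I q) (distr M (P \<Otimes>\<^sub>M PiM I q) Z)"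
  shows "absolutely_continuous (distr M (q S) (\<lambda>\<omega>. snd (Z \<omega>) S) \<Otimes>\<^sub>M distr M SB (\<lambda>\<omega>. B (Z \<omega>)))
     (distr M (q S \<Otimes>\<^sub>M SB) (\<lambda>\<omega>. (snd (Z \<omega>) S, B (Z \<omega>))))"
proof -
  let ?R = "P \<Otimes>\<^sub>M PiM I q" and ?C = "\<lambda>z. (snd z S, B z)"
  let ?J = "distr M (q S \<Otimes>\<^sub>M SB) (\<lambda>\<omega>. ?C (Z \<omega>))"
  interpret R: prob_space ?R by (intro prob_space_pair prob_space_P prob_space_PiM prob_space_q)
  interpret M: prob_space M by fact
  have [measurable]: "(\<lambda>u. u S) \<in> measurable (PiM I q) (q S)" using I_finite by simp
  have pair_measurable[measurable]: "?C \<in> measurable ?R (q S \<Otimes>\<^sub>M SB)" by measurable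
  have "?J = distr (distr M ?R Z) (q S \<Otimes>\<^sub>M SB) ?C"
    by (subst distr_distr[OF pair_measurable Z_measurable]) (simp add: comp_def)
  then have "absolutely_continuous (q S \<Otimes>\<^sub>M distr ?R SB B) ?J"
    using absolutely_continuous_distr[OF absolutely_continuous _ pair_measurable]
      distr_coordinate_pair[OF prob_space_P prob_space_q I_finite B_measurable inv] by simp
  then have "absolutely_continuous (distr ?J (q S) fst \<Otimes>\<^sub>M distr ?J (distr ?R SB B) snd) ?J"
    by (intro absolutely_continuous_marginals prob_space_q R.prob_space_distr M.prob_space_distr B_measurable)
      (auto cong: sets_pair_measure_cong)
  moreover have "distr ?J (q S) fst = distr M (q S) (\<lambda>\<omega>. snd (Z \<omega>) S)"
    by (subst distr_distr) (auto simp: comp_def)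
  moreover have "distr ?J (distr ?R SB B) snd = distr ?J SB snd" by (rule distr_cong) simp_all
  then have "distr ?J (distr ?R SB B) snd = distr M SB (\<lambda>\<omega>. B (Z \<omega>))"
    by (simp, subst distr_distr) (auto simp: comp_def)
  ultimately show ?thesis by simp
qed

section \<open>Chain rule and Markov property for densities\<close>

definition predecessors :: "'s list \<Rightarrow> 's \<Rightarrow> 's set" where
  "predecessors xs x = set (takeWhile (\<lambda>y. y \<noteq> x) xs)"

lemma predecessors_append_left: "x \<in> set xs \<Longrightarrow> predecessors (xs @ ys) x = predecessors xs x"
  by (simp add: predecessors_def)

lemma predecessors_split:
  assumes "x \<notin> set xs" shows "predecessors (xs @ x # ys) x = set xs"
proof -
  have "takeWhile (\<lambda>y. y \<noteq> x) (xs @ x # ys) = xs @ takeWhile (\<lambda>y. y \<noteq> x) (x # ys)"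
    using assms by (intro takeWhile_append2) auto
  then show ?thesis by (simp add: predecessors_def)
qed

lemma predecessors_subset: "predecessors xs x \<subseteq> set xs"
  by (auto simp: predecessors_def dest: set_takeWhileD)

lemma not_in_predecessors: "x \<notin> predecessors xs x"
  by (auto simp: predecessors_def dest: set_takeWhileD)

lemma sorted_wrt_predecessors:
  "distinct xs \<Longrightarrow> sorted_wrt (\<lambda>x y. y \<notin> predecessors xs x \<and> y \<noteq> x) xs"
proof (induction xs rule: rev_induct)
  case (snoc y xs)
  have "sorted_wrt (\<lambda>x z. z \<notin> predecessors (xs @ [y]) x \<and> z \<noteq> x) xs"
    by (rule sorted_wrt_mono_rel[OF _ snoc.IH]) (use snoc.prems in \<open>auto simp: predecessors_append_left\<close>)
  then show ?case
    using snoc.prems predecessors_subset[of xs]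
    by (auto simp: sorted_wrt_append predecessors_append_left)
qed simp

lemma nn_integral_conditional_density:
  assumes Z_measurable[measurable]: "Z \<in> measurable M SZ" and U_measurable[measurable]: "U \<in> measurable M N"
    and "prob_space N"
    and f_measurable[measurable]: "f \<in> borel_measurable (SZ \<Otimes>\<^sub>M N)"
    and F_measurable[measurable]: "F \<in> borel_measurable (SZ \<Otimes>\<^sub>M N)"
    and law: "distr M (SZ \<Otimes>\<^sub>M N) (\<lambda>\<omega>. (Z \<omega>, U \<omega>)) = density (distr M SZ Z \<Otimes>\<^sub>M N) f"
  shows "(\<integral>\<^sup>+\<omega>. F (Z \<omega>, U \<omega>) \<partial>M) = (\<integral>\<^sup>+\<omega>. \<integral>\<^sup>+v. f (Z \<omega>, v) * F (Z \<omega>, v) \<partial>N \<partial>M)"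
proof -
  interpret N: prob_space N by fact
  have "(\<integral>\<^sup>+\<omega>. F (Z \<omega>, U \<omega>) \<partial>M) = (\<integral>\<^sup>+z. F z \<partial>distr M (SZ \<Otimes>\<^sub>M N) (\<lambda>\<omega>. (Z \<omega>, U \<omega>)))"
    by (subst nn_integral_distr) auto
  also have "\<dots> = (\<integral>\<^sup>+z. f z * F z \<partial>(distr M SZ Z \<Otimes>\<^sub>M N))"
    unfolding law by (rule nn_integral_density) measurable
  also have "\<dots> = (\<integral>\<^sup>+z. \<integral>\<^sup>+v. f (z, v) * F (z, v) \<partial>N \<partial>distr M SZ Z)"
    by (rule N.nn_integral_fst[symmetric]) measurable
  also have "\<dots> = (\<integral>\<^sup>+\<omega>. \<integral>\<^sup>+v. f (Z \<omega>, v) * F (Z \<omega>, v) \<partial>N \<partial>M)"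
    by (rule nn_integral_distr) measurable
  finally show ?thesis .
qed

lemma nn_integral_PiM_snoc_density:
  fixes f :: "'s \<Rightarrow> ('x \<times> ('s \<Rightarrow> 'u)) \<times> 'u \<Rightarrow> ennreal"
  assumes prob_space_q: "\<And>T. prob_space (q T)" and S_notin: "S \<notin> set ws" and x_space: "x \<in> space SX"
    and f_measurable: "\<And>T. T \<in> set (ws @ [S]) \<Longrightarrow>
      f T \<in> borel_measurable ((SX \<Otimes>\<^sub>M PiM (predecessors (ws @ [S]) T) q) \<Otimes>\<^sub>M q T)"
    and F_measurable: "F \<in> borel_measurable (SX \<Otimes>\<^sub>M PiM (insert S (set ws)) q)"
  shows "(\<integral>\<^sup>+u. F (x, u) * (\<Prod>T\<in>insert S (set ws). f T ((x, restrict u (predecessors (ws @ [S]) T)), u T))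
      \<partial>PiM (insert S (set ws)) q) =
    (\<integral>\<^sup>+u. (\<integral>\<^sup>+v. f S ((x, u), v) * F (x, u(S := v)) \<partial>q S) *
      (\<Prod>T\<in>set ws. f T ((x, restrict u (predecessors ws T)), u T)) \<partial>PiM (set ws) q)"
proof -
  let ?W = "set ws" and ?pre = "predecessors (ws @ [S])"
  let ?p = "\<lambda>T u. f T ((x, restrict u (?pre T)), u T)"
  have pre_S: "?pre S = ?W" using predecessors_split[of S ws "[]"] S_notin by simp
  have pre: "?pre T = predecessors ws T" if "T \<in> ?W" for T
    using that by (rule predecessors_append_left)
  have factor_measurable: "?p T \<in> borel_measurable (PiM (insert S ?W) q)" if T_in: "T \<in> insert S ?W" for T
  proof -
    have "?pre T \<subseteq> insert S ?W" using predecessors_subset[of "ws @ [S]" T] by simp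
    then have "(\<lambda>u. ((x, restrict u (?pre T)), u T))
        \<in> measurable (PiM (insert S ?W) q) ((SX \<Otimes>\<^sub>M PiM (?pre T) q) \<Otimes>\<^sub>M q T)"
      using T_in x_space
      by (intro measurable_Pair measurable_restrict_subset measurable_const measurable_component_singleton) auto
    from measurable_compose[OF this f_measurable] show ?thesis using T_in by simp
  qed
  have "ignores (?p T) S" if "T \<in> ?W" for T
  proof -
    have "S \<notin> predecessors ws T" and "T \<noteq> S" using that S_notin predecessors_subset[of ws T] by auto
    then have "restrict (u(S := v)) (predecessors ws T) = restrict u (predecessors ws T)"
      for u :: "'s \<Rightarrow> 'u" and v by (auto simp: restrict_def fun_eq_iff)
    then show ?thesis using \<open>T \<noteq> S\<close> by (simp add: ignores_def pre[OF that])
  qed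
  with factor_measurable F_measurable x_space have "(\<integral>\<^sup>+u. F (x, u) * (\<Prod>T\<in>insert S ?W. ?p T u) \<partial>PiM (insert S ?W) q)
    = (\<integral>\<^sup>+u. (\<integral>\<^sup>+v. ?p S (u(S := v)) * F (x, u(S := v)) \<partial>q S) * (\<Prod>T\<in>?W. ?p T u) \<partial>PiM ?W q)"
    by (intro nn_integral_PiM_insert_prod prob_space_q S_notin) auto
  also have "\<dots> = (\<integral>\<^sup>+u. (\<integral>\<^sup>+v. f S ((x, u), v) * F (x, u(S := v)) \<partial>q S) *
      (\<Prod>T\<in>?W. f T ((x, restrict u (predecessors ws T)), u T)) \<partial>PiM ?W q)"
  proof (intro nn_integral_cong arg_cong2[where f="(*)"] prod.cong refl)
    fix u v assume "u \<in> space (PiM ?W q)"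
    then have "restrict (u(S := v)) ?W = u"
      using S_notin by (auto simp: space_PiM PiE_iff restrict_def fun_eq_iff extensional_def)
    then show "?p S (u(S := v)) = f S ((x, u), v)" by (simp add: pre_S)
  qed (simp add: pre)
  finally show ?thesis .
qed

lemma measurable_append_coordinate:
  "(\<lambda>z. (fst (fst z), (snd (fst z))(S := snd z)))
    \<in> measurable ((SX \<Otimes>\<^sub>M PiM W q) \<Otimes>\<^sub>M q S) (SX \<Otimes>\<^sub>M PiM (insert S W) q)"
  by (intro measurable_Pair measurable_fun_upd[where J=W]) auto

lemma nn_integral_chain_density:
  fixes U :: "'s \<Rightarrow> 'a \<Rightarrow> 'u" and f :: "'s \<Rightarrow> ('x \<times> ('s \<Rightarrow> 'u)) \<times> 'u \<Rightarrow> ennreal"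
  assumes "prob_space M" and X_measurable[measurable]: "X \<in> measurable M SX" and prob_space_q: "\<And>S. prob_space (q S)"
    and distinct_ws: "distinct ws" and U_measurable: "\<And>S. S \<in> set ws \<Longrightarrow> U S \<in> measurable M (q S)"
    and f_measurable: "\<And>S. S \<in> set ws \<Longrightarrow> f S \<in> borel_measurable ((SX \<Otimes>\<^sub>M PiM (predecessors ws S) q) \<Otimes>\<^sub>M q S)"
    and law: "\<And>S. S \<in> set ws \<Longrightarrow>
      distr M ((SX \<Otimes>\<^sub>M PiM (predecessors ws S) q) \<Otimes>\<^sub>M q S) (\<lambda>\<omega>. ((X \<omega>, \<lambda>T\<in>predecessors ws S. U T \<omega>), U S \<omega>)) =
      density (distr M (SX \<Otimes>\<^sub>M PiM (predecessors ws S) q) (\<lambda>\<omega>. (X \<omega>, \<lambda>T\<in>predecessors ws S. U T \<omega>)) \<Otimes>\<^sub>M q S) (f S)"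
    and F_measurable: "F \<in> borel_measurable (SX \<Otimes>\<^sub>M PiM (set ws) q)"
  shows "(\<integral>\<^sup>+\<omega>. F (X \<omega>, \<lambda>S\<in>set ws. U S \<omega>) \<partial>M) = (\<integral>\<^sup>+x. \<integral>\<^sup>+u. F (x, u) *
      (\<Prod>S\<in>set ws. f S ((x, restrict u (predecessors ws S)), u S)) \<partial>PiM (set ws) q \<partial>distr M SX X)"
  using distinct_ws U_measurable f_measurable law F_measurable
proof (induction ws arbitrary: F rule: rev_induct)
  case Nil
  interpret q: product_prob_space q by (rule product_prob_spaceI) (rule prob_space_q)
  have "(\<lambda>x. F (x, \<lambda>_. undefined)) \<in> borel_measurable SX" using Nil.prems(5) by simp
  then show ?case by (simp add: q.nn_integral_empty restrict_def nn_integral_distr)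
next
  case (snoc S ws)
  let ?W = "set ws" and ?Z = "\<lambda>\<omega>. (X \<omega>, \<lambda>T\<in>set ws. U T \<omega>)"
  have S_notin: "S \<notin> ?W" using snoc.prems(1) by auto
  have pre_S: "predecessors (ws @ [S]) S = ?W" using predecessors_split[of S ws "[]"] S_notin by simp
  note pre = predecessors_append_left[of _ ws "[S]"]
  have U_S: "U S \<in> measurable M (q S)" using snoc.prems(2) by simp
  have past_measurable: "?Z \<in> measurable M (SX \<Otimes>\<^sub>M PiM ?W q)"
    using snoc.prems(2) by (intro measurable_Pair X_measurable measurable_restrict) auto
  have f_S[measurable]: "f S \<in> borel_measurable ((SX \<Otimes>\<^sub>M PiM ?W q) \<Otimes>\<^sub>M q S)"
    using snoc.prems(3)[of S] by (simp add: pre_S)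
  have F_measurable: "F \<in> borel_measurable (SX \<Otimes>\<^sub>M PiM (insert S ?W) q)" using snoc.prems(5) by simp
  note F_upd = measurable_compose[OF measurable_append_coordinate F_measurable]
  interpret qS: prob_space "q S" by (rule prob_space_q)
  define G where "G z = (\<integral>\<^sup>+v. f S (z, v) * F (fst z, (snd z)(S := v)) \<partial>q S)" for z
  have "(\<lambda>T\<in>set (ws @ [S]). U T \<omega>) = (\<lambda>T\<in>?W. U T \<omega>)(S := U S \<omega>)" for \<omega> by auto
  then have "(\<integral>\<^sup>+\<omega>. F (X \<omega>, \<lambda>T\<in>set (ws @ [S]). U T \<omega>) \<partial>M) = (\<integral>\<^sup>+\<omega>. G (?Z \<omega>) \<partial>M)"
    unfolding G_def
    using nn_integral_conditional_density[OF past_measurable U_S prob_space_q f_S F_upd] snoc.prems(4)[of S]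
    by (simp del: restrict_apply add: pre_S)
  also have "\<dots> = (\<integral>\<^sup>+x. \<integral>\<^sup>+u. G (x, u) *
      (\<Prod>T\<in>?W. f T ((x, restrict u (predecessors ws T)), u T)) \<partial>PiM ?W q \<partial>distr M SX X)"
  proof (rule snoc.IH)
    show "G \<in> borel_measurable (SX \<Otimes>\<^sub>M PiM ?W q)"
      unfolding G_def by (rule qS.borel_measurable_nn_integral) (use F_upd in \<open>simp add: case_prod_beta'\<close>)
    fix T assume "T \<in> ?W"
    then show "f T \<in> borel_measurable ((SX \<Otimes>\<^sub>M PiM (predecessors ws T) q) \<Otimes>\<^sub>M q T)"
      and "distr M ((SX \<Otimes>\<^sub>M PiM (predecessors ws T) q) \<Otimes>\<^sub>M q T) (\<lambda>\<omega>. ((X \<omega>, \<lambda>R\<in>predecessors ws T. U R \<omega>), U T \<omega>)) =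
        density (distr M (SX \<Otimes>\<^sub>M PiM (predecessors ws T) q) (\<lambda>\<omega>. (X \<omega>, \<lambda>R\<in>predecessors ws T. U R \<omega>)) \<Otimes>\<^sub>M q T) (f T)"
      using snoc.prems(3,4)[of T] by (simp_all del: restrict_apply add: pre)
  qed (use snoc.prems(1,2) in auto)
  also have "\<dots> = (\<integral>\<^sup>+x. \<integral>\<^sup>+u. F (x, u) *
      (\<Prod>T\<in>insert S ?W. f T ((x, restrict u (predecessors (ws @ [S]) T)), u T)) \<partial>PiM (insert S ?W) q \<partial>distr M SX X)"
    unfolding G_def using nn_integral_PiM_snoc_density[OF prob_space_q S_notin _ snoc.prems(3) F_measurable]
    by (intro nn_integral_cong) simp
  finally show ?case by (simp del: restrict_apply)
qed

lemma subalgebra_vimage_algebra: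
  assumes X_measurable: "X \<in> measurable M SX" shows "subalgebra M (vimage_algebra (space M) X SX)"
  unfolding subalgebra_def using measurable_sets[OF X_measurable] measurable_space[OF X_measurable]
  by (auto simp: sets_vimage_algebra2)

lemma AE_real_cond_exp_indicator_eq:
  assumes "prob_space M" and X_measurable[measurable]: "X \<in> measurable M SX" and E_sets[measurable]: "E \<in> sets M"
    and h_measurable[measurable]: "h \<in> borel_measurable SX"
    and kernel: "\<And>D. D \<in> sets SX \<Longrightarrow>
      (\<integral>\<^sup>+\<omega>. indicator D (X \<omega>) * indicator E \<omega> \<partial>M) = (\<integral>\<^sup>+\<omega>. indicator D (X \<omega>) * h (X \<omega>) \<partial>M)"
  shows "integrable M (\<lambda>\<omega>. enn2real (h (X \<omega>)))" and "AE \<omega> in M. ennreal (enn2real (h (X \<omega>))) = h (X \<omega>)"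
    and "AE \<omega> in M. real_cond_exp M (vimage_algebra (space M) X SX) (indicator E) \<omega> = enn2real (h (X \<omega>))"
proof -
  let ?F = "vimage_algebra (space M) X SX" and ?h = "\<lambda>\<omega>. enn2real (h (X \<omega>))"
  interpret prob_space M by fact
  interpret finite_measure_subalgebra M ?F by unfold_locales (rule subalgebra_vimage_algebra[OF X_measurable])
  have "(\<integral>\<^sup>+\<omega>. h (X \<omega>) \<partial>M) = (\<integral>\<^sup>+\<omega>. indicator (space SX) (X \<omega>) * h (X \<omega>) \<partial>M)"
    using measurable_space[OF X_measurable] by (intro nn_integral_cong) auto
  also have "\<dots> = (\<integral>\<^sup>+\<omega>. indicator (space SX) (X \<omega>) * indicator E \<omega> \<partial>M)" by (simp add: kernel)
  also have "\<dots> \<le> (\<integral>\<^sup>+\<omega>. 1 \<partial>M)" by (intro nn_integral_mono) (auto simp: indicator_def)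
  finally have h_le: "(\<integral>\<^sup>+\<omega>. h (X \<omega>) \<partial>M) \<le> 1" by (simp add: emeasure_space_1)
  then have "AE \<omega> in M. h (X \<omega>) \<noteq> \<infinity>"
    by (intro nn_integral_noteq_infinite) (auto simp: top_unique)
  then show h_AE: "AE \<omega> in M. ennreal (?h \<omega>) = h (X \<omega>)"
    by eventually_elim (auto simp: ennreal_enn2real_if)
  then have "(\<integral>\<^sup>+\<omega>. ennreal (?h \<omega>) \<partial>M) = (\<integral>\<^sup>+\<omega>. h (X \<omega>) \<partial>M)" by (rule nn_integral_cong_AE)
  then show h_int: "integrable M ?h"
    by (intro integrableI_nonneg) (use h_le in \<open>auto intro: le_less_trans\<close>)
  show "AE \<omega> in M. real_cond_exp M ?F (indicator E) \<omega> = ?h \<omega>"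
  proof (rule real_cond_exp_charact[OF _ _ h_int])
    show E_int: "integrable M (indicator E :: _ \<Rightarrow> real)"
      by (rule integrable_const_bound[where B=1]) (auto simp: indicator_def)
    have "X \<in> measurable ?F SX" by (rule measurable_vimage_algebra1) (use measurable_space[OF X_measurable] in auto)
    then show "?h \<in> borel_measurable ?F" by measurable
    fix C assume "C \<in> sets ?F"
    then obtain D where [measurable]: "D \<in> sets SX" and C_eq: "C = X -` D \<inter> space M"
      using measurable_space[OF X_measurable] by (auto simp: sets_vimage_algebra2)
    have C_sets[measurable]: "C \<in> sets M" unfolding C_eq by measurable
    have "ennreal (\<integral>\<omega>. indicator C \<omega> * indicator E \<omega> \<partial>M) = (\<integral>\<^sup>+\<omega>. ennreal (indicator C \<omega> * indicator E \<omega>) \<partial>M)"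
      by (rule nn_integral_eq_integral[symmetric])
        (use E_int in \<open>auto intro!: integrable_real_mult_indicator simp: mult.commute[of "indicator C _"]\<close>)
    also have "\<dots> = (\<integral>\<^sup>+\<omega>. indicator D (X \<omega>) * indicator E \<omega> \<partial>M)"
      by (intro nn_integral_cong) (auto simp: C_eq indicator_def)
    also have "\<dots> = (\<integral>\<^sup>+\<omega>. ennreal (indicator C \<omega> * ?h \<omega>) \<partial>M)"
      unfolding kernel[OF \<open>D \<in> sets SX\<close>]
      by (rule nn_integral_cong_AE) (use h_AE AE_space in \<open>eventually_elim, auto simp: C_eq indicator_def\<close>)
    also have "\<dots> = ennreal (\<integral>\<omega>. indicator C \<omega> * ?h \<omega> \<partial>M)"
      by (rule nn_integral_eq_integral)
         (use h_int in \<open>auto intro!: integrable_real_mult_indicator simp: mult.commute[of "indicator C _"]\<close>)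
    finally show "(\<integral>\<omega>\<in>C. indicator E \<omega> \<partial>M) = (\<integral>\<omega>\<in>C. ?h \<omega> \<partial>M)"
      by (subst (asm) ennreal_inj) (auto intro!: integral_nonneg_AE simp: set_lebesgue_integral_def)
  qed
qed

lemma markov_chain_rectangle:
  assumes prob_space_M: "prob_space M" and X_measurable[measurable]: "X \<in> measurable M SX"
    and Y_measurable[measurable]: "Y \<in> measurable M SY"
    and V_measurable[measurable]: "V \<in> measurable M SV" and markov: "markov_chain M SV V SX X SY Y"
    and A_sets[measurable]: "A \<in> sets SX" and B_sets[measurable]: "B \<in> sets SY" and C_sets[measurable]: "C \<in> sets SV"
    and h_measurable[measurable]: "h \<in> borel_measurable SX"
    and kernel: "\<And>D. D \<in> sets SX \<Longrightarrow>
      (\<integral>\<^sup>+\<omega>. indicator D (X \<omega>) * indicator C (V \<omega>) \<partial>M) = (\<integral>\<^sup>+\<omega>. indicator D (X \<omega>) * h (X \<omega>) \<partial>M)"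
  shows "emeasure M {\<omega>\<in>space M. X \<omega> \<in> A \<and> Y \<omega> \<in> B \<and> V \<omega> \<in> C}
    = (\<integral>\<^sup>+\<omega>. indicator A (X \<omega>) * indicator B (Y \<omega>) * h (X \<omega>) \<partial>M)"
proof -
  let ?F = "vimage_algebra (space M) X SX" and ?h = "\<lambda>\<omega>. enn2real (h (X \<omega>))"
  let ?a = "\<lambda>\<omega>. indicator A (X \<omega>) :: real"
  let ?V = "{\<omega>\<in>space M. V \<omega> \<in> C}" and ?Y = "{\<omega>\<in>space M. Y \<omega> \<in> B}" and ?VY = "{\<omega>\<in>space M. V \<omega> \<in> C \<and> Y \<omega> \<in> B}"
  interpret prob_space M by fact
  interpret finite_measure_subalgebra M ?F by unfold_locales (rule subalgebra_vimage_algebra[OF X_measurable])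
  have "(\<integral>\<^sup>+\<omega>. indicator D (X \<omega>) * indicator ?V \<omega> \<partial>M) = (\<integral>\<^sup>+\<omega>. indicator D (X \<omega>) * h (X \<omega>) \<partial>M)"
    if "D \<in> sets SX" for D
    unfolding kernel[OF that, symmetric] by (intro nn_integral_cong) (auto simp: indicator_def)
  note h_facts = AE_real_cond_exp_indicator_eq[OF prob_space_M X_measurable _ h_measurable this]
  have h_int: "integrable M ?h" by (rule h_facts(1)) measurable
  have h_AE: "AE \<omega> in M. ennreal (?h \<omega>) = h (X \<omega>)" by (rule h_facts(2)) measurable
  have cond_V: "AE \<omega> in M. real_cond_exp M ?F (indicator ?V) \<omega> = ?h \<omega>" by (rule h_facts(3)) measurable
  have factor: "AE \<omega> in M. real_cond_exp M ?F (indicator ?VY) \<omega> =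
      real_cond_exp M ?F (indicator ?V) \<omega> * real_cond_exp M ?F (indicator ?Y) \<omega>"
    using markov B_sets C_sets unfolding markov_chain_def by blast
  have "X \<in> measurable ?F SX" by (rule measurable_vimage_algebra1) (use measurable_space[OF X_measurable] in auto)
  then have a_F: "?a \<in> borel_measurable ?F" and ah_F: "(\<lambda>\<omega>. ?a \<omega> * ?h \<omega>) \<in> borel_measurable ?F" by measurable
  have aVY: "integrable M (\<lambda>\<omega>. ?a \<omega> * indicator ?VY \<omega>)"
    by (rule integrable_const_bound[where B=1]) (auto simp: indicator_def)
  have ahY: "integrable M (\<lambda>\<omega>. ?a \<omega> * ?h \<omega> * indicator ?Y \<omega>)"
    by (rule Bochner_Integration.integrable_bound[OF h_int]) (auto simp: indicator_def)
  have "(\<integral>\<omega>. ?a \<omega> * indicator ?VY \<omega> \<partial>M) = (\<integral>\<omega>. ?a \<omega> * real_cond_exp M ?F (indicator ?VY) \<omega> \<partial>M)"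
    by (rule real_cond_exp_intg(2)[symmetric, OF aVY a_F]) measurable
  also have "\<dots> = (\<integral>\<omega>. (?a \<omega> * ?h \<omega>) * real_cond_exp M ?F (indicator ?Y) \<omega> \<partial>M)"
    by (rule integral_cong_AE) (auto intro!: borel_measurable_times borel_measurable_cond_exp2
      eventually_mono[OF eventually_conj[OF factor cond_V]])
  also have "\<dots> = (\<integral>\<omega>. (?a \<omega> * ?h \<omega>) * indicator ?Y \<omega> \<partial>M)"
    by (rule real_cond_exp_intg(2)[OF ahY ah_F]) measurable
  finally have integral_eq: "(\<integral>\<omega>. ?a \<omega> * indicator ?VY \<omega> \<partial>M) = (\<integral>\<omega>. (?a \<omega> * ?h \<omega>) * indicator ?Y \<omega> \<partial>M)" .
  have "emeasure M {\<omega>\<in>space M. X \<omega> \<in> A \<and> Y \<omega> \<in> B \<and> V \<omega> \<in> C}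
    = (\<integral>\<^sup>+\<omega>. indicator {\<omega>\<in>space M. X \<omega> \<in> A \<and> Y \<omega> \<in> B \<and> V \<omega> \<in> C} \<omega> \<partial>M)" by simp
  also have "\<dots> = (\<integral>\<^sup>+\<omega>. ennreal (?a \<omega> * indicator ?VY \<omega>) \<partial>M)"
    by (intro nn_integral_cong) (auto split: split_indicator)
  also have "\<dots> = ennreal (\<integral>\<omega>. ?a \<omega> * indicator ?VY \<omega> \<partial>M)"
    by (rule nn_integral_eq_integral[OF aVY]) auto
  also have "\<dots> = (\<integral>\<^sup>+\<omega>. ennreal ((?a \<omega> * ?h \<omega>) * indicator ?Y \<omega>) \<partial>M)"
    unfolding integral_eq by (rule nn_integral_eq_integral[OF ahY, symmetric]) auto
  also have "\<dots> = (\<integral>\<^sup>+\<omega>. indicator A (X \<omega>) * indicator B (Y \<omega>) * h (X \<omega>) \<partial>M)"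
    by (rule nn_integral_cong_AE) (use h_AE AE_space in \<open>eventually_elim, auto simp: indicator_def\<close>)
  finally show ?thesis .
qed

lemma markov_chain_density:
  assumes prob_space_M: "prob_space M" and X_measurable[measurable]: "X \<in> measurable M SX"
    and Y_measurable[measurable]: "Y \<in> measurable M SY"
    and "prob_space Q" and V_measurable[measurable]: "V \<in> measurable M Q" and markov: "markov_chain M Q V SX X SY Y"
    and w_measurable[measurable]: "w \<in> borel_measurable (SX \<Otimes>\<^sub>M Q)"
    and law: "\<And>F. F \<in> borel_measurable (SX \<Otimes>\<^sub>M Q) \<Longrightarrow>
      (\<integral>\<^sup>+\<omega>. F (X \<omega>, V \<omega>) \<partial>M) = (\<integral>\<^sup>+x. \<integral>\<^sup>+v. F (x, v) * w (x, v) \<partial>Q \<partial>distr M SX X)"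
  shows "distr M ((SX \<Otimes>\<^sub>M SY) \<Otimes>\<^sub>M Q) (\<lambda>\<omega>. ((X \<omega>, Y \<omega>), V \<omega>))
    = density (distr M (SX \<Otimes>\<^sub>M SY) (\<lambda>\<omega>. (X \<omega>, Y \<omega>)) \<Otimes>\<^sub>M Q) (\<lambda>z. w (fst (fst z), snd z))"
    (is "?L = density (?P \<Otimes>\<^sub>M Q) ?w")
proof (rule measure_eqI_triple_rectangles)
  interpret M: prob_space M by fact
  interpret Q: prob_space Q by fact
  show "finite_measure ?L" by (intro prob_space.finite_measure M.prob_space_distr) measurable
  fix A B C assume [measurable]: "A \<in> sets SX" "B \<in> sets SY" and C_sets[measurable]: "C \<in> sets Q"
  define h where "h x = (\<integral>\<^sup>+v. indicator C v * w (x, v) \<partial>Q)" for x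
  have h_measurable[measurable]: "h \<in> borel_measurable SX" unfolding h_def by measurable
  have kernel: "(\<integral>\<^sup>+\<omega>. indicator D (X \<omega>) * indicator C (V \<omega>) \<partial>M) = (\<integral>\<^sup>+\<omega>. indicator D (X \<omega>) * h (X \<omega>) \<partial>M)"
    if [measurable]: "D \<in> sets SX" for D
  proof -
    have "(\<integral>\<^sup>+\<omega>. indicator D (X \<omega>) * indicator C (V \<omega>) \<partial>M)
      = (\<integral>\<^sup>+x. \<integral>\<^sup>+v. (indicator D x * indicator C v) * w (x, v) \<partial>Q \<partial>distr M SX X)"
      using law[of "\<lambda>z. indicator D (fst z) * indicator C (snd z)"] by simp
    also have "\<dots> = (\<integral>\<^sup>+x. indicator D x * h x \<partial>distr M SX X)"
      unfolding h_def by (intro nn_integral_cong) (auto simp: mult.assoc intro!: nn_integral_cmult)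
    finally show ?thesis by (simp add: nn_integral_distr)
  qed
  have "emeasure ?L ((A \<times> B) \<times> C) = emeasure M {\<omega>\<in>space M. X \<omega> \<in> A \<and> Y \<omega> \<in> B \<and> V \<omega> \<in> C}"
    by (subst emeasure_distr) (auto intro!: arg_cong[where f="emeasure M"])
  also have "\<dots> = (\<integral>\<^sup>+\<omega>. indicator A (X \<omega>) * indicator B (Y \<omega>) * h (X \<omega>) \<partial>M)"
    by (rule markov_chain_rectangle[OF prob_space_M X_measurable Y_measurable V_measurable markov _ _ C_sets
          h_measurable kernel]) measurable
  also have "\<dots> = (\<integral>\<^sup>+p. indicator (A \<times> B) p * h (fst p) \<partial>?P)"
    by (subst nn_integral_distr) (auto simp: indicator_times)
  also have "\<dots> = (\<integral>\<^sup>+p. \<integral>\<^sup>+v. ?w (p, v) * indicator ((A \<times> B) \<times> C) (p, v) \<partial>Q \<partial>?P)"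
    unfolding h_def
    by (intro nn_integral_cong, subst nn_integral_cmult[symmetric])
      (auto simp: space_pair_measure indicator_times mult_ac intro!: nn_integral_cong)
  also have "\<dots> = (\<integral>\<^sup>+z. ?w z * indicator ((A \<times> B) \<times> C) z \<partial>(?P \<Otimes>\<^sub>M Q))"
    by (rule Q.nn_integral_fst) measurable
  also have "\<dots> = emeasure (density (?P \<Otimes>\<^sub>M Q) ?w) ((A \<times> B) \<times> C)"
    by (rule emeasure_density[symmetric]) measurable
  finally show "emeasure ?L ((A \<times> B) \<times> C) = emeasure (density (?P \<Otimes>\<^sub>M Q) ?w) ((A \<times> B) \<times> C)" .
qed (simp_all cong: sets_pair_measure_cong)

section \<open>Codes from codebooks\<close>

lemma is_code_mono:
  assumes "is_code m k kY P n M D f h" and D_le: "\<And>i c. i < m \<Longrightarrow> c < k \<Longrightarrow> D i c \<le> D' i c"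
  shows "is_code m k kY P n M D' f h"
  using assms(1) unfolding is_code_def by (auto elim!: order_trans intro!: ennreal_leI D_le)

lemma mse_achievable_limit:
  assumes "\<And>\<epsilon>. \<epsilon> > 0 \<Longrightarrow> mse_achievable m k kY P (\<lambda>i c. D i c + \<epsilon>) R"
  shows "mse_achievable m k kY P D R"
  unfolding mse_achievable_def
proof (intro allI impI)
  fix \<epsilon> :: real assume "\<epsilon> > 0"
  then obtain N where codes_from_N: "\<forall>n\<ge>N. \<exists>M f g. n > 0 \<and> is_code m k kY P n M (\<lambda>i c. D i c + \<epsilon> / 2 + \<epsilon> / 2) f g \<and>
      ln (real M) / real n \<le> R + \<epsilon> / 2"
    using assms[of "\<epsilon> / 2"] unfolding mse_achievable_def by (meson half_gt_zero)
  have "\<exists>M f g. n > 0 \<and> is_code m k kY P n M (\<lambda>i c. D i c + \<epsilon>) f g \<and> ln (real M) / real n \<le> R + \<epsilon>" if "n \<ge> N" for n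
  proof -
    obtain M f g where "n > 0" "is_code m k kY P n M (\<lambda>i c. D i c + \<epsilon> / 2 + \<epsilon> / 2) f g"
      "ln (real M) / real n \<le> R + \<epsilon> / 2"
      using codes_from_N \<open>n \<ge> N\<close> by blast
    then show ?thesis using \<open>\<epsilon> > 0\<close> by (intro exI[of _ M] exI[of _ f] exI[of _ g]) (simp add: add.assoc)
  qed
  then show "\<exists>N. \<forall>n\<ge>N. \<exists>M f g. n > 0 \<and> is_code m k kY P n M (\<lambda>i c. D i c + \<epsilon>) f g \<and> ln (real M) / real n \<le> R + \<epsilon>"
    by blast
qed

lemma power2_diff_le_tail:
  fixes x h :: real
  assumes "\<bar>h\<bar> \<le> \<beta>" and "C \<ge> 0"
  shows "(x - h)\<^sup>2 \<le> 2 * \<beta>\<^sup>2 + 2 * C + 2 * (x\<^sup>2 * of_bool (C < x\<^sup>2))"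
proof -
  have "h\<^sup>2 \<le> \<beta>\<^sup>2" using assms(1) by (simp add: abs_le_square_iff[symmetric])
  moreover have "(x - h)\<^sup>2 \<le> 2 * x\<^sup>2 + 2 * h\<^sup>2" by (rule power2_diff_le)
  ultimately show ?thesis using assms(2) by auto
qed

lemma sum_square_error_le:
  fixes x h :: "nat \<Rightarrow> real"
  assumes h_le: "\<And>t. \<bar>h t\<bar> \<le> \<beta>" and C_nonneg: "C \<ge> 0"
    and good: "\<omega> \<notin> E \<Longrightarrow> (\<Sum>t<n. (x t - h t)\<^sup>2) \<le> real n * \<Delta>"
  shows "(\<Sum>t<n. ennreal ((x t - h t)\<^sup>2)) \<le> ennreal (real n * \<Delta>)
    + ennreal (real n * (2 * \<beta>\<^sup>2 + 2 * C)) * indicator E \<omega> + (\<Sum>t<n. 2 * ennreal ((x t)\<^sup>2 * of_bool (C < (x t)\<^sup>2)))"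
proof (cases "\<omega> \<in> E")
  case False
  then have "(\<Sum>t<n. ennreal ((x t - h t)\<^sup>2)) \<le> ennreal (real n * \<Delta>)"
    using good by (simp add: ennreal_leI)
  then show ?thesis by (simp add: False add_increasing2)
next
  case True
  have "(\<Sum>t<n. ennreal ((x t - h t)\<^sup>2)) \<le> (\<Sum>t<n. ennreal (2 * \<beta>\<^sup>2 + 2 * C + 2 * ((x t)\<^sup>2 * of_bool (C < (x t)\<^sup>2))))"
    by (intro sum_mono ennreal_leI power2_diff_le_tail h_le C_nonneg)
  also have "\<dots> = (\<Sum>t<n. ennreal (2 * \<beta>\<^sup>2 + 2 * C) + 2 * ennreal ((x t)\<^sup>2 * of_bool (C < (x t)\<^sup>2)))"
    using C_nonneg by (simp add: ennreal_mult')
  also have "\<dots> = ennreal (real n * (2 * \<beta>\<^sup>2 + 2 * C)) + (\<Sum>t<n. 2 * ennreal ((x t)\<^sup>2 * of_bool (C < (x t)\<^sup>2)))"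
    using C_nonneg by (simp add: sum.distrib ennreal_mult' ennreal_of_nat_eq_real_of_nat)
  finally show ?thesis using True by (simp add: add_increasing add.assoc)
qed

text \<open>
  Off the exceptional event \<open>E\<close> the error is controlled by \<open>\<Delta>\<close>; on \<open>E\<close>, only the large values of \<open>x\<close>
  are not bounded.
\<close>
lemma nn_integral_sum_square_error_le:
  fixes P :: "'a measure" and n :: nat and x :: "'a \<Rightarrow> real" and h :: "nat \<Rightarrow> (nat \<Rightarrow> 'a) \<Rightarrow> real"
  defines "PP \<equiv> PiM {..<n} (\<lambda>_. P)"
  assumes prob_space_P: "prob_space P" and x_measurable[measurable]: "x \<in> borel_measurable P"
    and h_measurable[measurable]: "\<And>t. t < n \<Longrightarrow> h t \<in> borel_measurable PP" and h_le: "\<And>t \<omega>. \<bar>h t \<omega>\<bar> \<le> \<beta>"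
    and E_sets[measurable]: "E \<in> sets PP" and E_le: "measure PP E \<le> \<eta>"
    and good: "\<And>\<omega>. \<omega> \<in> space PP \<Longrightarrow> \<omega> \<notin> E \<Longrightarrow> (\<Sum>t<n. (x (\<omega> t) - h t \<omega>)\<^sup>2) \<le> real n * \<Delta>"
    and tail: "(\<integral>\<^sup>+z. ennreal ((x z)\<^sup>2) * indicator {z. C < (x z)\<^sup>2} z \<partial>P) \<le> ennreal \<kappa>"
    and nonneg: "C \<ge> 0" "\<kappa> \<ge> 0" "\<Delta> \<ge> 0"
  shows "(\<Sum>t<n. \<integral>\<^sup>+\<omega>. ennreal ((x (\<omega> t) - h t \<omega>)\<^sup>2) \<partial>PP)
    \<le> ennreal (real n * (\<Delta> + (2 * \<beta>\<^sup>2 + 2 * C) * \<eta> + 2 * \<kappa>))"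
proof -
  define large where "large z = ennreal ((x z)\<^sup>2 * of_bool (C < (x z)\<^sup>2))" for z
  let ?b = "2 * \<beta>\<^sup>2 + 2 * C"
  interpret PP: prob_space PP unfolding PP_def by (rule prob_space_PiM) (rule prob_space_P)
  have large[measurable]: "large \<in> borel_measurable P" unfolding large_def by measurable
  have [measurable]: "(\<lambda>\<omega>. \<omega> t) \<in> measurable PP P" if "t < n" for t using that by (simp add: PP_def)
  have "ennreal ((x z)\<^sup>2) * indicator {z. C < (x z)\<^sup>2} z = large z" for z by (simp add: large_def)
  then have "(\<integral>\<^sup>+z. large z \<partial>P) \<le> ennreal \<kappa>" using tail by (simp only:)
  then have "(\<integral>\<^sup>+\<omega>. large (\<omega> t) \<partial>PP) \<le> ennreal \<kappa>" if "t < n" for t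
    using that nn_integral_PiM_component[of "{..<n}" "\<lambda>_. P" t large, OF prob_space_P] large by (simp add: PP_def)
  then have large_le: "(\<Sum>t<n. 2 * (\<integral>\<^sup>+\<omega>. large (\<omega> t) \<partial>PP)) \<le> (\<Sum>t<n. 2 * ennreal \<kappa>)"
    by (intro sum_mono mult_left_mono) auto
  have nn_integral_large: "(\<integral>\<^sup>+\<omega>. (\<Sum>t<n. 2 * large (\<omega> t)) \<partial>PP) = (\<Sum>t<n. 2 * (\<integral>\<^sup>+\<omega>. large (\<omega> t) \<partial>PP))"
    by (subst nn_integral_sum) (auto intro!: sum.cong nn_integral_cmult)
  have "(\<Sum>t<n. \<integral>\<^sup>+\<omega>. ennreal ((x (\<omega> t) - h t \<omega>)\<^sup>2) \<partial>PP) = (\<integral>\<^sup>+\<omega>. (\<Sum>t<n. ennreal ((x (\<omega> t) - h t \<omega>)\<^sup>2)) \<partial>PP)"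
    by (rule nn_integral_sum[symmetric]) measurable
  also have "\<dots> \<le> (\<integral>\<^sup>+\<omega>. ennreal (real n * \<Delta>) + ennreal (real n * ?b) * indicator E \<omega> + (\<Sum>t<n. 2 * large (\<omega> t)) \<partial>PP)"
    unfolding large_def by (intro nn_integral_mono sum_square_error_le h_le good nonneg)
  also have "\<dots> = ennreal (real n * \<Delta>) + ennreal (real n * ?b) * emeasure PP E + (\<Sum>t<n. 2 * (\<integral>\<^sup>+\<omega>. large (\<omega> t) \<partial>PP))"
    by (subst nn_integral_add)
      (auto simp: nn_integral_add nn_integral_cmult_indicator PP.emeasure_space_1 nn_integral_large)
  also have "\<dots> \<le> ennreal (real n * \<Delta>) + ennreal (real n * ?b) * ennreal \<eta> + (\<Sum>t<n. 2 * ennreal \<kappa>)"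
    using E_le by (intro add_mono mult_left_mono large_le) (auto simp: PP.emeasure_eq_measure intro: ennreal_leI)
  also have "\<dots> = ennreal (real n * (\<Delta> + ?b * \<eta> + 2 * \<kappa>))"
  proof -
    have "\<eta> \<ge> 0" using E_le measure_nonneg order_trans by blast
    then have "ennreal (real n * \<Delta>) + ennreal (real n * ?b) * ennreal \<eta> + ennreal (real n * (2 * \<kappa>))
        = ennreal (real n * \<Delta> + real n * ?b * \<eta> + real n * (2 * \<kappa>))"
      using nonneg by (simp add: ennreal_mult ennreal_plus)
    then show ?thesis using nonneg(2) by (simp add: ennreal_mult' ennreal_of_nat_eq_real_of_nat algebra_simps)
  qed
  finally show ?thesis .
qed

text \<open>A codebook and an encoder for which the reconstruction \<open>\<phi>\<close> meets the distortion \<open>\<Delta>\<close> unless they fail.\<close>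
locale block_code = random_codebook P "vecM k" fst q vs \<rho> m DS "\<lambda>l. vecM (kY l)" "\<lambda>l z. snd z l" g R R' n A B \<theta> accept
  for P :: "((nat \<Rightarrow> real) \<times> (nat \<Rightarrow> nat \<Rightarrow> real)) measure" and k
    and q :: "'s \<Rightarrow> 'u measure" and vs and \<rho> and m and DS and kY and g and R R' and n and A B and \<theta> and accept +
  fixes \<phi> :: "nat \<Rightarrow> nat \<Rightarrow> ('s \<Rightarrow> 'u) \<times> (nat \<Rightarrow> real) \<Rightarrow> real" and \<beta> :: real and \<Delta> :: "nat \<Rightarrow> nat \<Rightarrow> real"
    and c and enc and \<eta> :: real
  assumes n_pos: "n > 0"
    and phi_measurable: "\<And>i e. i < m \<Longrightarrow> e < k \<Longrightarrow> \<phi> i e \<in> borel_measurable (PiM (DS i) q \<Otimes>\<^sub>M vecM (kY i))"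
    and phi_bound: "\<And>i e z. \<bar>\<phi> i e z\<bar> \<le> \<beta>"
    and accept_distortion: "\<And>z i e. accept z \<Longrightarrow> i < m \<Longrightarrow> e < k \<Longrightarrow>
      (\<Sum>t<n. (fst (fst (z t)) e - \<phi> i e (restrict (snd (z t)) (DS i), snd (fst (z t)) i))\<^sup>2) \<le> real n * \<Delta> i e"
    and \<Delta>_nonneg: "\<And>i e. i < m \<Longrightarrow> e < k \<Longrightarrow> \<Delta> i e \<ge> 0"
    and codebook: "c \<in> space (PiM {..<n} (\<lambda>_. codebook_law))"
    and enc_measurable: "enc \<in> measurable (PiM {..<n} (\<lambda>_. vecM k)) (count_space selections)"
    and failure_sets: "{a\<in>space (PiM {..<n} (\<lambda>_. P)). failure (enc (\<lambda>t\<in>{..<n}. fst (a t))) (zip_block a c)}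
      \<in> sets (PiM {..<n} (\<lambda>_. P))"
    and failure_le: "measure (PiM {..<n} (\<lambda>_. P))
      {a\<in>space (PiM {..<n} (\<lambda>_. P)). failure (enc (\<lambda>t\<in>{..<n}. fst (a t))) (zip_block a c)} \<le> \<eta>"
begin

definition aux_decoder :: "nat \<Rightarrow> ('s \<Rightarrow> nat) \<Rightarrow> nat \<Rightarrow> (nat \<Rightarrow> nat \<Rightarrow> real) \<Rightarrow> 's \<Rightarrow> 'u" where
  "aux_decoder i = (SOME dec. (\<forall>a\<in>bins. \<forall>t<n. dec a t \<in> measurable (PiM {..<n} (\<lambda>_. vecM (kY i))) (PiM (DS i) q)) \<and>
    (\<forall>j\<in>selections. \<forall>z\<in>space (PiM {..<n} (\<lambda>_. P)). \<not> failure j (zip_block z c) \<longrightarrow>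
      (\<forall>t<n. dec (bin_of j) t (\<lambda>t\<in>{..<n}. snd (z t) i) = restrict (chosen j (c t)) (DS i))))"

definition encode :: "(nat \<Rightarrow> nat \<Rightarrow> real) \<Rightarrow> nat" where
  "encode xs = Suc (to_nat_on bins (bin_of (enc xs)))"

definition reconstruct :: "nat \<Rightarrow> nat \<Rightarrow> (nat \<Rightarrow> nat \<Rightarrow> real) \<Rightarrow> nat \<Rightarrow> nat \<Rightarrow> real" where
  "reconstruct i w ys t e = \<phi> i e (aux_decoder i (from_nat_into bins (w - 1)) t ys, ys t)"

lemma
  assumes "i < m"
  shows aux_decoder_measurable: "a \<in> bins \<Longrightarrow> t < n \<Longrightarrow>
      aux_decoder i a t \<in> measurable (PiM {..<n} (\<lambda>_. vecM (kY i))) (PiM (DS i) q)"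
    and aux_decoder_bin_of: "j \<in> selections \<Longrightarrow> z \<in> space (PiM {..<n} (\<lambda>_. P)) \<Longrightarrow> \<not> failure j (zip_block z c) \<Longrightarrow>
      t < n \<Longrightarrow> aux_decoder i (bin_of j) t (\<lambda>t\<in>{..<n}. snd (z t) i) = restrict (chosen j (c t)) (DS i)"
proof -
  note decoder = someI_ex[OF block_decoder_exists[OF codebook assms], folded aux_decoder_def]
  show "aux_decoder i a t \<in> measurable (PiM {..<n} (\<lambda>_. vecM (kY i))) (PiM (DS i) q)" if "a \<in> bins" "t < n"
    using decoder[THEN conjunct1] that by blast
  show "aux_decoder i (bin_of j) t (\<lambda>t\<in>{..<n}. snd (z t) i) = restrict (chosen j (c t)) (DS i)"
    if "j \<in> selections" "z \<in> space (PiM {..<n} (\<lambda>_. P))" "\<not> failure j (zip_block z c)" "t < n"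
    using decoder[THEN conjunct2, THEN bspec, THEN bspec] that by simp
qed

lemma enc_in_selections: "xs \<in> space (PiM {..<n} (\<lambda>_. vecM k)) \<Longrightarrow> enc xs \<in> selections"
  using measurable_space[OF enc_measurable] by simp

lemma encode_measurable: "encode \<in> measurable (PiM {..<n} (\<lambda>_. vecM k)) (count_space UNIV)"
  unfolding encode_def[abs_def] by (rule measurable_compose[OF enc_measurable]) simp

lemma encode_range:
  assumes "xs \<in> space (PiM {..<n} (\<lambda>_. vecM k))" shows "encode xs \<in> {1..card bins}"
  using bij_betwE[OF to_nat_on_finite[OF finite_bins]] bin_of_in_bins[OF enc_in_selections[OF assms]]
  by (auto simp: encode_def Suc_le_eq)

lemma reconstruct_measurable:
  assumes i_less: "i < m" and t_less: "t < n" and e_less: "e < k"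
  shows "(\<lambda>p. reconstruct i (fst p) (snd p) t e)
    \<in> borel_measurable (count_space UNIV \<Otimes>\<^sub>M PiM {..<n} (\<lambda>_. vecM (kY i)))"
proof (rule measurable_pair_measure_countable1)
  fix w :: nat
  have "(\<lambda>ys. (aux_decoder i (from_nat_into bins (w - 1)) t ys, ys t))
      \<in> measurable (PiM {..<n} (\<lambda>_. vecM (kY i))) (PiM (DS i) q \<Otimes>\<^sub>M vecM (kY i))"
    using t_less by (intro measurable_Pair aux_decoder_measurable[OF i_less] from_nat_into bins_nonempty) auto
  from measurable_compose[OF this phi_measurable[OF i_less e_less]]
  show "(\<lambda>ys. reconstruct i (fst (w, ys)) (snd (w, ys)) t e) \<in> borel_measurable (PiM {..<n} (\<lambda>_. vecM (kY i)))"
    by (simp add: reconstruct_def)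
qed simp

lemma source_block_measurable[measurable]:
  shows "(\<lambda>a. \<lambda>t\<in>{..<n}. fst (a t)) \<in> measurable (PiM {..<n} (\<lambda>_. P)) (PiM {..<n} (\<lambda>_. vecM k))"
    and "i < m \<Longrightarrow> (\<lambda>a. \<lambda>t\<in>{..<n}. snd (a t) i) \<in> measurable (PiM {..<n} (\<lambda>_. P)) (PiM {..<n} (\<lambda>_. vecM (kY i)))"
proof -
  have letter: "(\<lambda>a. a t) \<in> measurable (PiM {..<n} (\<lambda>_. P)) P" if "t \<in> {..<n}" for t using that by simp
  show "(\<lambda>a. \<lambda>t\<in>{..<n}. fst (a t)) \<in> measurable (PiM {..<n} (\<lambda>_. P)) (PiM {..<n} (\<lambda>_. vecM k))"
    by (intro measurable_restrict measurable_compose[OF letter px_measurable])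
  show "(\<lambda>a. \<lambda>t\<in>{..<n}. snd (a t) i) \<in> measurable (PiM {..<n} (\<lambda>_. P)) (PiM {..<n} (\<lambda>_. vecM (kY i)))" if "i < m"
    by (intro measurable_restrict measurable_compose[OF letter py_measurable[OF that]])
qed

lemma sum_square_error_off_failure_le:
  assumes a_space: "a \<in> space (PiM {..<n} (\<lambda>_. P))" and i_less: "i < m" and e_less: "e < k"
    and no_failure: "\<not> failure (enc (\<lambda>t\<in>{..<n}. fst (a t))) (zip_block a c)"
  shows "(\<Sum>t<n. (fst (a t) e - reconstruct i (encode (\<lambda>s\<in>{..<n}. fst (a s))) (\<lambda>s\<in>{..<n}. snd (a s) i) t e)\<^sup>2)
    \<le> real n * \<Delta> i e"
proof -
  let ?j = "enc (\<lambda>t\<in>{..<n}. fst (a t))"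
  let ?z = "chosen_block ?j (zip_block a c)"
  have j_in: "?j \<in> selections"
    using measurable_space[OF source_block_measurable(1) a_space] by (rule enc_in_selections)
  have "accept ?z" using no_failure by (simp add: failure_def acceptable_def)
  from accept_distortion[OF this i_less e_less] show ?thesis
    by (simp add: chosen_block_nth zip_block_def reconstruct_def encode_def from_nat_into_to_nat_on countable_finite
        finite_bins bin_of_in_bins[OF j_in]
        aux_decoder_bin_of[OF i_less j_in a_space no_failure])
qed

lemma is_code:
  assumes coordinate: "\<And>e. e < k \<Longrightarrow> (\<lambda>z. fst z e) \<in> borel_measurable P"
    and tail: "\<And>e. e < k \<Longrightarrow> (\<integral>\<^sup>+z. ennreal ((fst z e)\<^sup>2) * indicator {z. C < (fst z e)\<^sup>2} z \<partial>P) \<le> ennreal \<kappa>"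
    and nonneg: "C \<ge> 0" "\<kappa> \<ge> 0"
  shows "is_code m k kY P n (card bins) (\<lambda>i e. \<Delta> i e + (2 * \<beta>\<^sup>2 + 2 * C) * \<eta> + 2 * \<kappa>) encode reconstruct"
  unfolding is_code_def
proof (intro conjI allI impI ballI encode_measurable encode_range reconstruct_measurable)
  fix i e assume i_less: "i < m" and e_less: "e < k"
  let ?h = "\<lambda>t \<omega>. reconstruct i (encode (\<lambda>s\<in>{..<n}. fst (\<omega> s))) (\<lambda>s\<in>{..<n}. snd (\<omega> s) i) t e"
  let ?d = "\<Delta> i e + (2 * \<beta>\<^sup>2 + 2 * C) * \<eta> + 2 * \<kappa>"
  have "(\<Sum>t<n. \<integral>\<^sup>+\<omega>. ennreal ((fst (\<omega> t) e - ?h t \<omega>)\<^sup>2) \<partial>PiM {..<n} (\<lambda>_. P)) \<le> ennreal (real n * ?d)"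
  proof (rule nn_integral_sum_square_error_le[OF prob_space_P coordinate[OF e_less] _ _ failure_sets failure_le
        sum_square_error_off_failure_le[OF _ i_less e_less] tail[OF e_less] nonneg \<Delta>_nonneg[OF i_less e_less]])
    show "?h t \<in> borel_measurable (PiM {..<n} (\<lambda>_. P))" if "t < n" for t
      using measurable_compose[OF measurable_Pair[OF
            measurable_compose[OF source_block_measurable(1) encode_measurable] source_block_measurable(2)[OF i_less]]
          reconstruct_measurable[OF i_less that e_less]] by simp
    show "\<bar>?h t \<omega>\<bar> \<le> \<beta>" for t \<omega> unfolding reconstruct_def by (rule phi_bound)
  qed auto
  then have "ennreal (1 / real n) * (\<Sum>t<n. \<integral>\<^sup>+\<omega>. ennreal ((fst (\<omega> t) e - ?h t \<omega>)\<^sup>2) \<partial>PiM {..<n} (\<lambda>_. P))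
      \<le> ennreal (1 / real n) * ennreal (real n * ?d)"
    by (rule mult_left_mono) simp
  also have "\<dots> = ennreal ?d"
    using n_pos by (subst ennreal_mult'[symmetric]) auto
  finally show "ennreal (1 / real n) * (\<Sum>t<n. \<integral>\<^sup>+\<omega>. ennreal ((fst (\<omega> t) e - ?h t \<omega>)\<^sup>2) \<partial>PiM {..<n} (\<lambda>_. P))
      \<le> ennreal ?d" .
qed

end

section \<open>Codes of large block length\<close>

locale block_source = codebook_densities P "vecM k" fst q vs \<rho> m DS "\<lambda>l. vecM (kY l)" "\<lambda>l z. snd z l" g R R'
  for P :: "((nat \<Rightarrow> real) \<times> (nat \<Rightarrow> nat \<Rightarrow> real)) measure" and k
    and q :: "'s \<Rightarrow> 'u measure" and vs and \<rho> and m and DS and kY and g and R R' +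
  fixes \<phi> :: "nat \<Rightarrow> nat \<Rightarrow> ('s \<Rightarrow> 'u) \<times> (nat \<Rightarrow> real) \<Rightarrow> real" and \<beta> :: real and \<Delta> :: "nat \<Rightarrow> nat \<Rightarrow> real"
  assumes prob_space_joint_law: "prob_space joint_law"
    and R_nonneg: "\<And>S. S \<in> set vs \<Longrightarrow> R S \<ge> 0"
    and ln_rho_integrable: "\<And>S. S \<in> set vs \<Longrightarrow> integrable joint_law (\<lambda>z. ln (\<rho> S (fst (fst z)) (snd z)))"
    and mean_ln_rho_le: "\<And>S. S \<in> set vs \<Longrightarrow> (\<integral>z. ln (\<rho> S (fst (fst z)) (snd z)) \<partial>joint_law) \<le> R S + R' S"
    and mean_ln_g_ge: "\<And>l D. l < m \<Longrightarrow> D \<subseteq> DS l \<Longrightarrow> D \<noteq> {} \<Longrightarrow>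
      ln_mean_ge joint_law (\<lambda>z. \<Prod>S\<in>D. g l D S (snd (fst z) l) (restrict (snd z) (DS l))) (\<Sum>S\<in>D. R' S)"
    and phi_measurable: "\<And>i e. i < m \<Longrightarrow> e < k \<Longrightarrow> \<phi> i e \<in> borel_measurable (PiM (DS i) q \<Otimes>\<^sub>M vecM (kY i))"
    and phi_bound: "\<And>i e z. \<bar>\<phi> i e z\<bar> \<le> \<beta>"
    and distortion_integrable: "\<And>i e. i < m \<Longrightarrow> e < k \<Longrightarrow>
      integrable joint_law (\<lambda>z. (fst (fst z) e - \<phi> i e (restrict (snd z) (DS i), snd (fst z) i))\<^sup>2)"
    and mean_distortion_le: "\<And>i e. i < m \<Longrightarrow> e < k \<Longrightarrow>
      (\<integral>z. (fst (fst z) e - \<phi> i e (restrict (snd z) (DS i), snd (fst z) i))\<^sup>2 \<partial>joint_law) \<le> \<Delta> i e"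
    and square_integrable: "\<And>e. e < k \<Longrightarrow> integrable P (\<lambda>z. (fst z e)\<^sup>2)"
    and coordinate_measurable: "\<And>e. e < k \<Longrightarrow> (\<lambda>z. fst z e) \<in> borel_measurable P"
begin

definition distortion where
  "distortion i e z = (fst (fst z) e - \<phi> i e (restrict (snd z) (DS i), snd (fst z) i))\<^sup>2"

definition low_distortion where
  "low_distortion n \<epsilon> z \<longleftrightarrow> (\<forall>i<m. \<forall>e<k. (\<Sum>t<n. distortion i e (z t)) \<le> real n * (\<Delta> i e + \<epsilon>))"

lemma distortion_measurable: "i < m \<Longrightarrow> e < k \<Longrightarrow> distortion i e \<in> borel_measurable indep_law"
  using borel_measurable_integrable[OF distortion_integrable]
  by (simp add: distortion_def[abs_def] cong: measurable_cong_sets)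

lemma \<Delta>_nonneg: "i < m \<Longrightarrow> e < k \<Longrightarrow> \<Delta> i e \<ge> 0"
  by (rule order_trans[OF _ mean_distortion_le]) simp_all

lemma low_distortion_measurable[measurable]:
  "Measurable.pred (PiM {..<n} (\<lambda>_. indep_law)) (low_distortion n \<epsilon>)"
proof -
  note [measurable] = distortion_measurable
  show ?thesis unfolding low_distortion_def by measurable
qed

lemma high_distortion_tendsto_0:
  assumes "\<epsilon> > 0"
  shows "(\<lambda>n. measure (PiM {..<n} (\<lambda>_. joint_law))
    {z\<in>space (PiM {..<n} (\<lambda>_. joint_law)). \<not> low_distortion n \<epsilon> z}) \<longlonglongrightarrow> 0"
proof -
  let ?J = "\<lambda>n. PiM {..<n::nat} (\<lambda>_. joint_law)"
  let ?bad = "\<lambda>p n. {z\<in>space (?J n). real n * ((\<integral>z. case_prod distortion p z \<partial>joint_law) + \<epsilon>)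
    < (\<Sum>t<n. case_prod distortion p (z t))}"
  show ?thesis
  proof (rule measure_tendsto_0_mono_AE)
    have finite_M: "finite_measure (?J n)" for n
      by (intro prob_space.finite_measure prob_space_PiM prob_space_joint_law)
    then show "finite_measure (?J n)" for n .
    have bad_sets: "?bad p n \<in> sets (?J n)" if "p \<in> {..<m} \<times> {..<k}" for p n
    proof -
      have [measurable]: "case_prod distortion p \<in> borel_measurable joint_law"
        using that distortion_measurable by (auto cong: measurable_cong_sets)
      show ?thesis by measurable
    qed
    then show "(\<Union>p\<in>{..<m} \<times> {..<k}. ?bad p n) \<in> sets (?J n)" for n by (intro sets.finite_UN) auto
    show "(\<lambda>n. measure (?J n) (\<Union>p\<in>{..<m} \<times> {..<k}. ?bad p n)) \<longlonglongrightarrow> 0"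
    proof (rule measure_UN_tendsto_0[OF finite_M _ bad_sets])
      show "(\<lambda>n. measure (?J n) (?bad p n)) \<longlonglongrightarrow> 0" if "p \<in> {..<m} \<times> {..<k}" for p
        by (rule weak_law_upper_tail[OF prob_space_joint_law _ \<open>\<epsilon> > 0\<close>])
          (use that distortion_integrable in \<open>auto simp: distortion_def[abs_def]\<close>)
    qed simp_all
    fix n
    have "z \<in> (\<Union>p\<in>{..<m} \<times> {..<k}. ?bad p n)" if z_space: "z \<in> space (?J n)" and "\<not> low_distortion n \<epsilon> z" for z
    proof -
      obtain i e where ie_less: "i < m" "e < k" and "real n * (\<Delta> i e + \<epsilon>) < (\<Sum>t<n. distortion i e (z t))"
        using \<open>\<not> low_distortion n \<epsilon> z\<close> by (auto simp: low_distortion_def not_le)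
      moreover have "real n * ((\<integral>z. distortion i e z \<partial>joint_law) + \<epsilon>) \<le> real n * (\<Delta> i e + \<epsilon>)"
        using mean_distortion_le[OF ie_less] by (intro mult_left_mono) (simp_all add: distortion_def)
      ultimately show ?thesis using z_space by (intro UN_I[of "(i, e)"]) auto
    qed
    then show "AE z in ?J n. z \<in> {z\<in>space (?J n). \<not> low_distortion n \<epsilon> z} \<longrightarrow> z \<in> (\<Union>p\<in>{..<m} \<times> {..<k}. ?bad p n)"
      by (intro AE_I2) blast
  qed
qed

definition bin_count :: "real \<Rightarrow> nat \<Rightarrow> 's \<Rightarrow> nat" where
  "bin_count \<theta> n S = exp_size (R S + 4 * \<theta>) n"

definition bin_size :: "real \<Rightarrow> nat \<Rightarrow> 's \<Rightarrow> nat" where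
  "bin_size \<theta> n S = exp_size (R' S - 2 * \<theta>) n"

definition error_bound :: "real \<Rightarrow> real \<Rightarrow> nat \<Rightarrow> real" where
  "error_bound \<epsilon> \<theta> n =
     8 * measure (PiM {..<n} (\<lambda>_. joint_law)) {z\<in>space (PiM {..<n} (\<lambda>_. joint_law)).
       \<not> enc_typical n \<theta> (\<lambda>t. fst (fst (z t))) (\<lambda>t. snd (z t))} +
     4 * ((\<Prod>S\<in>set vs. 1 + exp (real n * (R S + R' S + \<theta>)) / real (bin_count \<theta> n S * bin_size \<theta> n S)) - 1) +
     2 * (measure (PiM {..<n} (\<lambda>_. joint_law)) {z\<in>space (PiM {..<n} (\<lambda>_. joint_law)).
         \<not> (low_distortion n \<epsilon> z \<and>
           (\<forall>l<m. dec_typical n \<theta> l (\<lambda>t. snd (fst (z t)) l) (\<lambda>t. restrict (snd (z t)) (DS l))))} +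
       (\<Sum>l<m. exp (real n * \<theta>) * ((\<Prod>S\<in>DS l. 1 + real (bin_size \<theta> n S - 1) * exp (- real n * R' S)) - 1)))"

lemma unacceptable_tendsto_0:
  assumes "\<epsilon> > 0" and "\<theta> > 0"
  shows "(\<lambda>n. measure (PiM {..<n} (\<lambda>_. joint_law)) {z\<in>space (PiM {..<n} (\<lambda>_. joint_law)).
    \<not> (low_distortion n \<epsilon> z \<and>
      (\<forall>l<m. dec_typical n \<theta> l (\<lambda>t. snd (fst (z t)) l) (\<lambda>t. restrict (snd (z t)) (DS l))))}) \<longlonglongrightarrow> 0"
proof -
  let ?J = "\<lambda>n. PiM {..<n::nat} (\<lambda>_. joint_law)"
  let ?dec = "\<lambda>n z. \<forall>l<m. dec_typical n \<theta> l (\<lambda>t. snd (fst (z t)) l) (\<lambda>t. restrict (snd (z t)) (DS l))"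
  let ?bad = "\<lambda>b n. {z\<in>space (?J n). \<not> (if b then low_distortion n \<epsilon> z else ?dec n z)}"
  have "(\<lambda>n. measure (?J n) (\<Union>b\<in>UNIV. ?bad b n)) \<longlonglongrightarrow> 0"
  proof (rule measure_UN_tendsto_0)
    show "finite_measure (?J n)" for n by (intro prob_space.finite_measure prob_space_PiM prob_space_joint_law)
    note [measurable] = dec_typical_restrict_measurable
    show "?bad b n \<in> sets (?J n)" for b n by (cases b; simp; measurable)
    show "(\<lambda>n. measure (?J n) (?bad b n)) \<longlonglongrightarrow> 0" for b
      using high_distortion_tendsto_0[OF \<open>\<epsilon> > 0\<close>] dec_atypical_tendsto_0[OF prob_space_joint_law \<open>\<theta> > 0\<close> mean_ln_g_ge]
      by (cases b) simp_all
  qed simp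
  moreover have "(\<Union>b\<in>UNIV. ?bad b n) = {z\<in>space (?J n). \<not> (low_distortion n \<epsilon> z \<and> ?dec n z)}" for n
    by (auto simp: UNIV_bool)
  ultimately show ?thesis by simp
qed

lemma error_bound_tendsto_0:
  assumes "\<epsilon> > 0" and \<theta>_pos: "\<theta> > 0"
  shows "error_bound \<epsilon> \<theta> \<longlonglongrightarrow> 0"
proof -
  have enc: "(\<lambda>n. measure (PiM {..<n} (\<lambda>_. joint_law)) {z\<in>space (PiM {..<n} (\<lambda>_. joint_law)).
      \<not> enc_typical n \<theta> (\<lambda>t. fst (fst (z t))) (\<lambda>t. snd (z t))}) \<longlonglongrightarrow> 0"
    by (rule enc_atypical_tendsto_0[OF prob_space_joint_law \<theta>_pos ln_rho_integrable mean_ln_rho_le])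
  have covering: "(\<lambda>n. (\<Prod>S\<in>set vs.
      1 + exp (real n * (R S + R' S + \<theta>)) / real (bin_count \<theta> n S * bin_size \<theta> n S)) - 1) \<longlonglongrightarrow> 0"
    unfolding bin_count_def bin_size_def by (rule covering_error_tendsto_0) (use \<theta>_pos in simp)
  have packing: "(\<lambda>n. \<Sum>l<m. exp (real n * \<theta>) *
      ((\<Prod>S\<in>DS l. 1 + real (bin_size \<theta> n S - 1) * exp (- real n * R' S)) - 1)) \<longlonglongrightarrow> (\<Sum>l<m. 0)"
    unfolding bin_size_def by (intro tendsto_sum packing_error_tendsto_0 \<theta>_pos) simp
  have "error_bound \<epsilon> \<theta> \<longlonglongrightarrow> 8 * 0 + 4 * 0 + 2 * (0 + (\<Sum>l<m. 0))"
    unfolding error_bound_def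
    by (intro tendsto_add tendsto_mult_left enc covering packing unacceptable_tendsto_0 assms)
  then show ?thesis by simp
qed

lemma is_code_exists:
  assumes "error_bound \<epsilon> \<theta> n < \<eta>" and "\<eta> > 0" and "n > 0" and "\<epsilon> \<ge> 0"
    and tail: "\<And>e. e < k \<Longrightarrow> (\<integral>\<^sup>+z. ennreal ((fst z e)\<^sup>2) * indicator {z. C < (fst z e)\<^sup>2} z \<partial>P) \<le> ennreal \<kappa>"
    and nonneg: "C \<ge> 0" "\<kappa> \<ge> 0"
  shows "\<exists>f h. is_code m k kY P n (card (PiE (set vs) (\<lambda>S. {..<bin_count \<theta> n S})))
    (\<lambda>i e. \<Delta> i e + \<epsilon> + (2 * \<beta>\<^sup>2 + 2 * C) * \<eta> + 2 * \<kappa>) f h"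
proof -
  interpret rc: random_codebook P "vecM k" fst q vs \<rho> m DS "\<lambda>l. vecM (kY l)" "\<lambda>l z. snd z l" g R R' n
    "bin_count \<theta> n" "bin_size \<theta> n" \<theta> "low_distortion n \<epsilon>"
    by (intro random_codebook.intro random_codebook_axioms.intro codebook_densities_axioms prob_space_joint_law
        low_distortion_measurable) (simp_all add: bin_count_def bin_size_def exp_size_pos)
  have "8 * measure (PiM {..<n} (\<lambda>_. joint_law)) {z\<in>space (PiM {..<n} (\<lambda>_. joint_law)). \<not> rc.enc_typical_block z}
      + 4 * ((\<Prod>S\<in>set vs. 1 + rc.enc_bound S / real (bin_count \<theta> n S * bin_size \<theta> n S)) - 1)
      + 2 * (measure (PiM {..<n} (\<lambda>_. joint_law)) {z\<in>space (PiM {..<n} (\<lambda>_. joint_law)). \<not> rc.acceptable z} + rc.confusion_bound)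
    < \<eta>"
    using assms(1)
    by (simp only: error_bound_def rc.enc_typical_block_def rc.enc_bound_def rc.acceptable_def rc.confusion_bound_def)
  from rc.codebook_exists[OF this \<open>\<eta> > 0\<close>] obtain c f
    where c_space: "c \<in> space (PiM {..<n} (\<lambda>_. rc.codebook_law))"
      and f_measurable: "f \<in> measurable (PiM {..<n} (\<lambda>_. vecM k)) (count_space rc.selections)"
      and failure: "{a\<in>space (PiM {..<n} (\<lambda>_. P)). rc.failure (f (\<lambda>t\<in>{..<n}. fst (a t))) (rc.zip_block a c)}
          \<in> sets (PiM {..<n} (\<lambda>_. P))"
        "measure (PiM {..<n} (\<lambda>_. P))
          {a\<in>space (PiM {..<n} (\<lambda>_. P)). rc.failure (f (\<lambda>t\<in>{..<n}. fst (a t))) (rc.zip_block a c)} < \<eta>"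
    by blast
  interpret bc: block_code P k q vs \<rho> m DS kY g R R' n "bin_count \<theta> n" "bin_size \<theta> n" \<theta> "low_distortion n \<epsilon>"
    \<phi> \<beta> "\<lambda>i e. \<Delta> i e + \<epsilon>" c f \<eta>
  proof unfold_locales
    show "(\<Sum>t<n. (fst (fst (z t)) e - \<phi> i e (restrict (snd (z t)) (DS i), snd (fst (z t)) i))\<^sup>2)
        \<le> real n * (\<Delta> i e + \<epsilon>)"
      if "low_distortion n \<epsilon> z" "i < m" "e < k" for z i e
      using that by (simp add: low_distortion_def distortion_def)
    show "\<Delta> i e + \<epsilon> \<ge> 0" if "i < m" "e < k" for i e
      using \<Delta>_nonneg[OF that] \<open>\<epsilon> \<ge> 0\<close> by simp
  qed (use c_space f_measurable failure phi_measurable phi_bound \<open>n > 0\<close> in auto)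
  show ?thesis
    using bc.is_code[OF coordinate_measurable tail nonneg] unfolding rc.bins_def by blast
qed

lemma ln_message_count_le:
  assumes "\<theta> > 0" "n > 0"
  shows "ln (real (card (PiE (set vs) (\<lambda>S. {..<bin_count \<theta> n S})))) / real n
    \<le> (\<Sum>S\<in>set vs. R S) + real (card (set vs)) * (4 * \<theta> + ln 2 / real n)"
  using ln_card_PiE_exp_size_le[of "set vs" "\<lambda>S. R S + 4 * \<theta>" n] assms R_nonneg
  by (simp add: bin_count_def sum.distrib algebra_simps)

lemma square_tail_bound_exists:
  assumes "\<kappa> > 0"
  shows "\<exists>C\<ge>0. \<forall>e<k. (\<integral>\<^sup>+z. ennreal ((fst z e)\<^sup>2) * indicator {z. C < (fst z e)\<^sup>2} z \<partial>P) \<le> ennreal \<kappa>"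
proof -
  have "\<forall>\<^sub>F C in at_top. \<forall>e\<in>{..<k}. (\<integral>\<^sup>+z. ennreal ((fst z e)\<^sup>2) * indicator {z. C < (fst z e)\<^sup>2} z \<partial>P) \<le> ennreal \<kappa>"
    using assms square_integrable by (intro eventually_ball_finite ballI eventually_nn_integral_tail_le) auto
  from eventually_happens'[OF _ eventually_conj[OF eventually_ge_at_top[of 0] this]]
  show ?thesis by auto
qed

lemma codes_eventually:
  assumes \<epsilon>_pos: "\<epsilon> > 0"
  shows "\<forall>\<^sub>F n in sequentially. \<exists>M f h. is_code m k kY P n M (\<lambda>i e. \<Delta> i e + \<epsilon>) f h \<and>
    ln (real M) / real n \<le> (\<Sum>S\<in>set vs. R S) + \<epsilon>"
proof -
  define s where "s = real (card (set vs))"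
  define \<theta> where "\<theta> = \<epsilon> / (8 * (s + 1))"
  have "s \<ge> 0" by (simp add: s_def)
  then have \<theta>_pos: "\<theta> > 0" and s\<theta>: "s * (4 * \<theta>) < \<epsilon>"
    using \<epsilon>_pos by (simp_all add: \<theta>_def field_simps add_strict_increasing)
  obtain C where C_nonneg: "C \<ge> 0"
    and tail: "\<And>e. e < k \<Longrightarrow> (\<integral>\<^sup>+z. ennreal ((fst z e)\<^sup>2) * indicator {z. C < (fst z e)\<^sup>2} z \<partial>P) \<le> ennreal (\<epsilon> / 8)"
    using square_tail_bound_exists[of "\<epsilon> / 8"] \<epsilon>_pos by auto
  define b where "b = 2 * \<beta>\<^sup>2 + 2 * C"
  define \<eta> where "\<eta> = \<epsilon> / (4 * (b + 1))"
  have "b \<ge> 0" using C_nonneg by (simp add: b_def)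
  then have \<eta>_pos: "\<eta> > 0" and b\<eta>: "b * \<eta> \<le> \<epsilon> / 4" using \<epsilon>_pos by (simp_all add: \<eta>_def field_simps)
  have "(\<lambda>n. s * (4 * \<theta> + ln 2 / real n)) \<longlonglongrightarrow> s * (4 * \<theta>)" by real_asymp
  then have "\<forall>\<^sub>F n in sequentially. s * (4 * \<theta> + ln 2 / real n) < \<epsilon>"
    using s\<theta> by (rule order_tendstoD)
  moreover have "\<forall>\<^sub>F n in sequentially. error_bound (\<epsilon> / 4) \<theta> n < \<eta>"
    using \<epsilon>_pos by (intro order_tendstoD(2)[OF error_bound_tendsto_0 \<eta>_pos] \<theta>_pos) simp
  ultimately show ?thesis
    using eventually_gt_at_top[of 0]
  proof eventually_elim
    case (elim n)
    let ?M = "card (PiE (set vs) (\<lambda>S. {..<bin_count \<theta> n S}))"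
    obtain f h where "is_code m k kY P n ?M (\<lambda>i e. \<Delta> i e + \<epsilon> / 4 + b * \<eta> + 2 * (\<epsilon> / 8)) f h"
      using is_code_exists[OF elim(2) \<eta>_pos elim(3) _ tail C_nonneg] \<epsilon>_pos unfolding b_def by auto
    then have "is_code m k kY P n ?M (\<lambda>i e. \<Delta> i e + \<epsilon>) f h"
      by (rule is_code_mono) (use b\<eta> \<epsilon>_pos in simp)
    moreover have "ln (real ?M) / real n \<le> (\<Sum>S\<in>set vs. R S) + \<epsilon>"
      using ln_message_count_le[OF \<theta>_pos elim(3)] elim(1) by (simp add: s_def)
    ultimately show ?case by blast
  qed
qed

lemma mse_achievable_sum_rate: "mse_achievable m k kY P \<Delta> (\<Sum>S\<in>set vs. R S)"
  unfolding mse_achievable_def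
proof (intro allI impI)
  fix \<epsilon> :: real assume "\<epsilon> > 0"
  from eventually_conj[OF eventually_gt_at_top[of 0] codes_eventually[OF this]]
  show "\<exists>N. \<forall>n\<ge>N. \<exists>M f g. n > 0 \<and> is_code m k kY P n M (\<lambda>i c. \<Delta> i c + \<epsilon>) f g \<and>
      ln (real M) / real n \<le> (\<Sum>S\<in>set vs. R S) + \<epsilon>"
    by (auto simp: eventually_sequentially)
qed

end

section \<open>Test channels\<close>

text \<open>\<open>q S\<close> is the law of \<open>U\<^sub>S\<close>, which also serves as its measurable space.\<close>
locale test_channel = prob_space M for M :: "'a measure" +
  fixes m k :: nat and kY :: "nat \<Rightarrow> nat" and X :: "'a \<Rightarrow> nat \<Rightarrow> real" and Y :: "'a \<Rightarrow> nat \<Rightarrow> nat \<Rightarrow> real"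
    and U :: "'s \<Rightarrow> 'a \<Rightarrow> 'u" and q :: "'s \<Rightarrow> 'u measure" and vs :: "'s list" and DS :: "nat \<Rightarrow> 's set"
    and \<Delta> :: "nat \<Rightarrow> nat \<Rightarrow> real" and R R' :: "'s \<Rightarrow> real"
  assumes X_measurable[measurable]: "X \<in> measurable M (vecM k)"
    and Y_measurable[measurable]: "Y \<in> measurable M (YM m kY)"
    and prob_space_q: "\<And>S. prob_space (q S)"
    and U_measurable: "\<And>S. S \<in> set vs \<Longrightarrow> U S \<in> measurable M (q S)"
    and distr_U: "\<And>S. S \<in> set vs \<Longrightarrow> distr M (q S) (U S) = q S"
    and distinct_vs: "distinct vs" and DS_subset: "\<And>l. l < m \<Longrightarrow> DS l \<subseteq> set vs"
    and markov: "markov_chain M (PiM (set vs) q) (\<lambda>\<omega>. \<lambda>S\<in>set vs. U S \<omega>) (vecM k) X (YM m kY) Y"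
    and X_square_integrable: "\<And>e. e < k \<Longrightarrow> integrable M (\<lambda>\<omega>. (X \<omega> e)\<^sup>2)"
    and \<Delta>_nonneg: "\<And>i e. i < m \<Longrightarrow> e < k \<Longrightarrow> \<Delta> i e \<ge> 0"
    and mmse_le: "\<And>i e. i < m \<Longrightarrow> e < k \<Longrightarrow>
      (\<integral>\<^sup>+\<omega>. ennreal ((X \<omega> e - real_cond_exp M (vimage_algebra (space M) (\<lambda>\<omega>. (\<lambda>S\<in>DS i. U S \<omega>, Y \<omega> i))
          (PiM (DS i) q \<Otimes>\<^sub>M vecM (kY i))) (\<lambda>\<omega>. X \<omega> e) \<omega>)\<^sup>2) \<partial>M) \<le> ennreal (\<Delta> i e)"
    and R_nonneg: "\<And>S. S \<in> set vs \<Longrightarrow> R S \<ge> 0"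
    and enc_mutual_info_le: "\<And>S. S \<in> set vs \<Longrightarrow>
      mutual_info M (vecM k \<Otimes>\<^sub>M PiM (predecessors vs S) q) (q S) (\<lambda>\<omega>. (X \<omega>, \<lambda>T\<in>predecessors vs S. U T \<omega>)) (U S)
        \<le> ereal (R S + R' S)"
    and dec_mutual_info_ge: "\<And>l D. l < m \<Longrightarrow> D \<subseteq> DS l \<Longrightarrow> D \<noteq> {} \<Longrightarrow>
      ereal (\<Sum>S\<in>D. R' S) \<le> (\<Sum>S\<in>D. mutual_info M (q S)
        (PiM (predecessors vs S \<inter> D) q \<Otimes>\<^sub>M PiM (DS l - D) q \<Otimes>\<^sub>M vecM (kY l)) (U S)
        (\<lambda>\<omega>. (\<lambda>T\<in>predecessors vs S \<inter> D. U T \<omega>, \<lambda>T\<in>DS l - D. U T \<omega>, Y \<omega> l)))"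
begin

definition "enc_space S = vecM k \<Otimes>\<^sub>M PiM (predecessors vs S) q"

definition "enc_side S \<omega> = (X \<omega>, \<lambda>T\<in>predecessors vs S. U T \<omega>)"

definition "dec_space l D S = PiM (predecessors vs S \<inter> D) q \<Otimes>\<^sub>M PiM (DS l - D) q \<Otimes>\<^sub>M vecM (kY l)"

definition "dec_side l D S \<omega> = (\<lambda>T\<in>predecessors vs S \<inter> D. U T \<omega>, \<lambda>T\<in>DS l - D. U T \<omega>, Y \<omega> l)"

definition dec_args :: "nat \<Rightarrow> 's set \<Rightarrow> 's \<Rightarrow> (nat \<Rightarrow> real) \<Rightarrow> ('s \<Rightarrow> 'u) \<Rightarrow> ('s \<Rightarrow> 'u) \<times> ('s \<Rightarrow> 'u) \<times> (nat \<Rightarrow> real)" where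
  "dec_args l D S y u = (restrict u (predecessors vs S \<inter> D), restrict u (DS l - D), y)"

definition enc_density :: "'s \<Rightarrow> (nat \<Rightarrow> real) \<Rightarrow> ('s \<Rightarrow> 'u) \<Rightarrow> real" where
  "enc_density S x u =
    info_density M (enc_space S) (q S) (enc_side S) (U S) ((x, restrict u (predecessors vs S)), u S)"

definition dec_density :: "nat \<Rightarrow> 's set \<Rightarrow> 's \<Rightarrow> (nat \<Rightarrow> real) \<Rightarrow> ('s \<Rightarrow> 'u) \<Rightarrow> real" where
  "dec_density l D S y u = info_density M (q S) (dec_space l D S) (U S) (dec_side l D S) (u S, dec_args l D S y u)"

abbreviation "P \<equiv> distr M (XYM m k kY) (\<lambda>\<omega>. (X \<omega>, Y \<omega>))"

lemma XY_measurable[measurable]: "(\<lambda>\<omega>. (X \<omega>, Y \<omega>)) \<in> measurable M (XYM m k kY)"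
  unfolding XYM_def by measurable

lemma YM_component[measurable]: "l < m \<Longrightarrow> (\<lambda>y. y l) \<in> measurable (YM m kY) (vecM (kY l))"
  unfolding YM_def by simp

lemma U_restrict_measurable: "A \<subseteq> set vs \<Longrightarrow> (\<lambda>\<omega>. \<lambda>S\<in>A. U S \<omega>) \<in> measurable M (PiM A q)"
  by (intro measurable_restrict U_measurable) auto

lemma enc_side_measurable: "enc_side S \<in> measurable M (enc_space S)"
  unfolding enc_side_def[abs_def] enc_space_def
  by (intro measurable_Pair X_measurable U_restrict_measurable predecessors_subset)

lemma dec_side_measurable:
  assumes "l < m" "D \<subseteq> DS l" shows "dec_side l D S \<in> measurable M (dec_space l D S)"
  unfolding dec_side_def[abs_def] dec_space_def
  using assms DS_subset[of l]
  by (intro measurable_Pair U_restrict_measurable measurable_compose[OF Y_measurable YM_component]) auto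

lemma enc_density_measurable:
  assumes S_in: "S \<in> set vs"
  shows "(\<lambda>z. enc_density S (fst z) (snd z)) \<in> borel_measurable (vecM k \<Otimes>\<^sub>M PiM (set vs) q)"
proof -
  interpret random_pair M "enc_space S" "q S" "enc_side S" "U S"
    by unfold_locales (rule enc_side_measurable U_measurable[OF S_in])+
  have "(\<lambda>z. ((fst z, restrict (snd z) (predecessors vs S)), snd z S))
      \<in> measurable (vecM k \<Otimes>\<^sub>M PiM (set vs) q) (enc_space S \<Otimes>\<^sub>M q S)"
    unfolding enc_space_def using S_in
    by (intro measurable_Pair measurable_fst measurable_compose[OF measurable_snd measurable_restrict_subset]
        measurable_compose[OF measurable_snd measurable_component_singleton] predecessors_subset)
  from measurable_compose[OF this info_density_measurable] show ?thesis by (simp add: enc_density_def)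
qed

lemma enc_density_subdensity: "S \<in> set vs \<Longrightarrow> (\<integral>\<^sup>+v. ennreal (enc_density S x (u(S := v))) \<partial>q S) \<le> 1"
  using nn_integral_info_density_snd_le_1[where M=M and SB="q S" and B="U S"
    and a="(x, restrict u (predecessors vs S))"]
  by (simp add: enc_density_def distr_U not_in_predecessors del: restrict_apply)

lemma dec_args_measurable:
  assumes "D \<subseteq> DS l"
  shows "(\<lambda>z. dec_args l D S (fst z) (snd z)) \<in> measurable (vecM (kY l) \<Otimes>\<^sub>M PiM (DS l) q) (dec_space l D S)"
  unfolding dec_args_def dec_space_def using assms
  by (intro measurable_Pair measurable_fst measurable_compose[OF measurable_snd measurable_restrict_subset]) auto

lemma dec_density_measurable:
  assumes l_less: "l < m" and D_subset: "D \<subseteq> DS l" and S_in: "S \<in> D"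
  shows "(\<lambda>z. dec_density l D S (fst z) (snd z)) \<in> borel_measurable (vecM (kY l) \<Otimes>\<^sub>M PiM (DS l) q)"
proof -
  interpret random_pair M "q S" "dec_space l D S" "U S" "dec_side l D S"
    by unfold_locales
      (use dec_side_measurable[OF l_less D_subset] U_measurable DS_subset[OF l_less] D_subset S_in in auto)
  have "(\<lambda>z. (snd z S, dec_args l D S (fst z) (snd z)))
      \<in> measurable (vecM (kY l) \<Otimes>\<^sub>M PiM (DS l) q) (q S \<Otimes>\<^sub>M dec_space l D S)"
    using D_subset S_in by (intro measurable_Pair dec_args_measurable
        measurable_compose[OF measurable_snd measurable_component_singleton]) auto
  from measurable_compose[OF this info_density_measurable] show ?thesis by (simp add: dec_density_def)
qed

lemma dec_args_fun_upd: "S' \<notin> predecessors vs S \<Longrightarrow> S' \<in> D \<Longrightarrow> dec_args l D S y (u(S' := v)) = dec_args l D S y u"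
  by (simp add: dec_args_def del: restrict_apply)

lemma dec_density_subdensity:
  assumes "l < m" "D \<subseteq> DS l" "S \<in> D" shows "(\<integral>\<^sup>+v. ennreal (dec_density l D S y (u(S := v))) \<partial>q S) \<le> 1"
  using nn_integral_info_density_fst_le_1[where M=M and SA="q S" and A="U S" and b="dec_args l D S y u"]
    assms DS_subset[of l]
  by (simp add: dec_density_def dec_args_fun_upd not_in_predecessors distr_U subset_eq)

sublocale codebook_densities P "vecM k" fst q vs enc_density m DS "\<lambda>l. vecM (kY l)" "\<lambda>l z. snd z l" dec_density R R'
proof (rule codebook_densities.intro)
  show "prob_space P" by (rule prob_space_distr) measurable
  show "fst \<in> measurable P (vecM k)" by (simp add: XYM_def)
  show "(\<lambda>z. snd z l) \<in> measurable P (vecM (kY l))" if "l < m" for l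
    using measurable_compose[OF measurable_snd YM_component[OF that], of "vecM k"] by (simp add: XYM_def)
  show "enc_density S x u \<ge> 0" "dec_density l D S y u \<ge> 0" for l D S x y u
    by (simp_all add: enc_density_def dec_density_def info_density_nonneg)
  show "sorted_wrt (\<lambda>S S'. \<forall>x. ignores (enc_density S x) S') vs"
    by (rule sorted_wrt_mono_rel[OF _ sorted_wrt_predecessors[OF distinct_vs]])
      (auto simp: ignores_def enc_density_def simp del: restrict_apply)
  show "sorted_wrt (\<lambda>S S'. \<forall>y. ignores (dec_density l D S y) S') (filter (\<lambda>S. S \<in> D) vs)" for l D
    by (rule sorted_wrt_mono_rel[OF _ sorted_wrt_filter[OF sorted_wrt_predecessors[OF distinct_vs]]])
      (auto simp: ignores_def dec_density_def dec_args_fun_upd)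
qed (rule prob_space_q distinct_vs DS_subset enc_density_measurable enc_density_subdensity
    dec_density_measurable dec_density_subdensity; assumption)+

definition XYU :: "'a \<Rightarrow> ((nat \<Rightarrow> real) \<times> (nat \<Rightarrow> nat \<Rightarrow> real)) \<times> ('s \<Rightarrow> 'u)" where
  "XYU \<omega> = ((X \<omega>, Y \<omega>), \<lambda>S\<in>set vs. U S \<omega>)"

lemma XYU_measurable[measurable]: "XYU \<in> measurable M indep_law"
proof -
  have "(\<lambda>\<omega>. (X \<omega>, Y \<omega>)) \<in> measurable M P" by simp
  then show ?thesis
    unfolding XYU_def[abs_def] indep_law_def by (intro measurable_Pair U_restrict_measurable) auto
qed

lemma mutual_info_enc_finite:
  "S \<in> set vs \<Longrightarrow> mutual_info M (enc_space S) (q S) (enc_side S) (U S) < \<infinity>"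
  using enc_mutual_info_le[of S] unfolding enc_space_def enc_side_def[abs_def] by (auto elim: le_less_trans)

lemma random_pair_enc: "S \<in> set vs \<Longrightarrow> random_pair M (enc_space S) (q S) (enc_side S) (U S)"
  by unfold_locales (auto intro: enc_side_measurable U_measurable)

lemma distr_enc_pair:
  assumes S_in: "S \<in> set vs"
  shows "distr M (enc_space S \<Otimes>\<^sub>M q S) (\<lambda>\<omega>. (enc_side S \<omega>, U S \<omega>))
      = density (distr M (enc_space S) (enc_side S) \<Otimes>\<^sub>M q S)
    (\<lambda>z. ennreal (info_density M (enc_space S) (q S) (enc_side S) (U S) z))"
  using random_pair.PAB_eq_density[OF random_pair_enc[OF S_in]
      mutual_info_finite_imp_ac[OF mutual_info_enc_finite[OF S_in]]]
  by (simp add: distr_U[OF S_in])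

lemma nn_integral_X_U:
  assumes F_measurable: "F \<in> borel_measurable (vecM k \<Otimes>\<^sub>M PiM (set vs) q)"
  shows "(\<integral>\<^sup>+\<omega>. F (X \<omega>, \<lambda>S\<in>set vs. U S \<omega>) \<partial>M)
    = (\<integral>\<^sup>+x. \<integral>\<^sup>+u. F (x, u) * (\<Prod>S\<in>set vs. ennreal (enc_density S x u)) \<partial>PiM (set vs) q \<partial>distr M (vecM k) X)"
  unfolding enc_density_def
proof (rule nn_integral_chain_density[OF prob_space_axioms X_measurable prob_space_q distinct_vs U_measurable _ _
      F_measurable])
  fix S assume S_in: "S \<in> set vs"
  interpret random_pair M "enc_space S" "q S" "enc_side S" "U S" by (rule random_pair_enc[OF S_in])
  show "(\<lambda>z. ennreal (info_density M (enc_space S) (q S) (enc_side S) (U S) z))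
      \<in> borel_measurable ((vecM k \<Otimes>\<^sub>M PiM (predecessors vs S) q) \<Otimes>\<^sub>M q S)"
    unfolding enc_space_def[symmetric] by measurable
  show "distr M ((vecM k \<Otimes>\<^sub>M PiM (predecessors vs S) q) \<Otimes>\<^sub>M q S) (\<lambda>\<omega>. ((X \<omega>, \<lambda>T\<in>predecessors vs S. U T \<omega>), U S \<omega>)) =
      density (distr M (vecM k \<Otimes>\<^sub>M PiM (predecessors vs S) q) (\<lambda>\<omega>. (X \<omega>, \<lambda>T\<in>predecessors vs S. U T \<omega>)) \<Otimes>\<^sub>M q S)
        (\<lambda>z. ennreal (info_density M (enc_space S) (q S) (enc_side S) (U S) z))"
    using distr_enc_pair[OF S_in] unfolding enc_space_def enc_side_def[abs_def] .
qed

lemma joint_law_eq_distr: "joint_law = distr M indep_law XYU"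
proof -
  define w where "w z = (\<Prod>S\<in>set vs. ennreal (enc_density S (fst z) (snd z)))" for z
  have w_measurable: "w \<in> borel_measurable (vecM k \<Otimes>\<^sub>M PiM (set vs) q)"
    unfolding w_def
    by (intro borel_measurable_prod_ennreal measurable_compose[OF enc_density_measurable measurable_ennreal])
  have sets_indep_law: "sets ((vecM k \<Otimes>\<^sub>M YM m kY) \<Otimes>\<^sub>M PiM (set vs) q) = sets indep_law"
    unfolding indep_law_def by (rule sets_pair_measure_cong) (simp_all add: XYM_def)
  have "distr M ((vecM k \<Otimes>\<^sub>M YM m kY) \<Otimes>\<^sub>M PiM (set vs) q) (\<lambda>\<omega>. ((X \<omega>, Y \<omega>), \<lambda>S\<in>set vs. U S \<omega>))
    = density (distr M (vecM k \<Otimes>\<^sub>M YM m kY) (\<lambda>\<omega>. (X \<omega>, Y \<omega>)) \<Otimes>\<^sub>M PiM (set vs) q) (\<lambda>z. w (fst (fst z), snd z))"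
    by (rule markov_chain_density[OF prob_space_axioms X_measurable Y_measurable
          prob_space_PiM[OF prob_space_q] U_restrict_measurable[OF subset_refl] markov w_measurable])
      (simp add: nn_integral_X_U w_def)
  also have "\<dots> = joint_law"
    by (simp add: joint_law_def indep_law_def joint_density_def[abs_def] w_def XYM_def[symmetric])
  also have "distr M ((vecM k \<Otimes>\<^sub>M YM m kY) \<Otimes>\<^sub>M PiM (set vs) q) (\<lambda>\<omega>. ((X \<omega>, Y \<omega>), \<lambda>S\<in>set vs. U S \<omega>))
      = distr M indep_law XYU"
    by (rule distr_cong) (simp_all add: XYU_def sets_indep_law)
  finally show ?thesis ..
qed

lemma prob_space_joint_law: "prob_space joint_law"
  unfolding joint_law_eq_distr by (rule prob_space_distr) measurable

lemma
  fixes F :: "_ \<Rightarrow> real"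
  assumes "F \<in> borel_measurable indep_law"
  shows integrable_joint_law_iff: "integrable joint_law F \<longleftrightarrow> integrable M (\<lambda>\<omega>. F (XYU \<omega>))"
    and integral_joint_law: "(\<integral>z. F z \<partial>joint_law) = (\<integral>\<omega>. F (XYU \<omega>) \<partial>M)"
  unfolding joint_law_eq_distr
  by (rule integrable_distr_eq[OF XYU_measurable assms] integral_distr[OF XYU_measurable assms])+

lemma enc_density_XYU:
  assumes "S \<in> set vs"
  shows "enc_density S (fst (fst (XYU \<omega>))) (snd (XYU \<omega>))
      = info_density M (enc_space S) (q S) (enc_side S) (U S) (enc_side S \<omega>, U S \<omega>)"
proof -
  have "restrict (\<lambda>S\<in>set vs. U S \<omega>) (predecessors vs S) = (\<lambda>T\<in>predecessors vs S. U T \<omega>)"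
    using predecessors_subset[of vs S] by (auto simp: restrict_def fun_eq_iff)
  then show ?thesis using assms by (simp add: enc_density_def XYU_def enc_side_def del: restrict_apply) simp
qed

lemma ln_enc_density_measurable: "S \<in> set vs \<Longrightarrow>
    (\<lambda>z. ln (enc_density S (fst (fst z)) (snd z))) \<in> borel_measurable indep_law"
  by (intro borel_measurable_ln rho_comp_measurable) measurable

lemma integrable_ln_enc_density:
  assumes S_in: "S \<in> set vs" shows "integrable joint_law (\<lambda>z. ln (enc_density S (fst (fst z)) (snd z)))"
  using random_pair.integrable_ln_info_density[OF random_pair_enc[OF S_in] mutual_info_finite_imp_ac]
    mutual_info_enc_finite[OF S_in]
  by (simp add: integrable_joint_law_iff[OF ln_enc_density_measurable[OF S_in]] enc_density_XYU[OF S_in])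

lemma integral_ln_enc_density_le:
  assumes S_in: "S \<in> set vs" shows "(\<integral>z. ln (enc_density S (fst (fst z)) (snd z)) \<partial>joint_law) \<le> R S + R' S"
proof -
  have "ereal (\<integral>z. ln (enc_density S (fst (fst z)) (snd z)) \<partial>joint_law)
      = mutual_info M (enc_space S) (q S) (enc_side S) (U S)"
    using random_pair.integral_ln_info_density[OF random_pair_enc[OF S_in] mutual_info_finite_imp_ac]
      mutual_info_enc_finite[OF S_in]
    by (simp add: integral_joint_law[OF ln_enc_density_measurable[OF S_in]] enc_density_XYU[OF S_in])
  also have "\<dots> \<le> ereal (R S + R' S)"
    using enc_mutual_info_le[OF S_in] unfolding enc_space_def enc_side_def[abs_def] .
  finally show ?thesis by simp
qed

lemma absolutely_continuous_joint_law: "absolutely_continuous indep_law joint_law"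
  unfolding joint_law_def by (rule absolutely_continuousI_density) measurable

lemma dec_args_XYU:
  assumes "l < m" "D \<subseteq> DS l"
  shows "dec_args l D S (snd (fst (XYU \<omega>)) l) (restrict (snd (XYU \<omega>)) (DS l)) = dec_side l D S \<omega>"
  using assms DS_subset[of l] by (auto simp: dec_args_def dec_side_def XYU_def restrict_def fun_eq_iff)

lemma dec_args_joint_measurable:
  assumes l_less: "l < m" and D_subset: "D \<subseteq> DS l"
  shows "(\<lambda>z. dec_args l D S (snd (fst z) l) (restrict (snd z) (DS l))) \<in> measurable indep_law (dec_space l D S)"
proof -
  have "(\<lambda>z. (snd (fst z) l, restrict (snd z) (DS l))) \<in> measurable indep_law (vecM (kY l) \<Otimes>\<^sub>M PiM (DS l) q)"
    using py_measurable[OF l_less] by (intro measurable_Pair measurable_compose[OF fst_indep_law]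
        measurable_compose[OF snd_indep_law measurable_restrict_subset[OF DS_subset[OF l_less]]])
  from measurable_compose[OF this dec_args_measurable[OF D_subset]] show ?thesis by simp
qed

lemma absolutely_continuous_dec:
  assumes l_less: "l < m" and D_subset: "D \<subseteq> DS l" and S_in: "S \<in> D"
  defines "B \<equiv> \<lambda>z. dec_args l D S (snd (fst z) l) (restrict (snd z) (DS l))"
  shows "absolutely_continuous (distr joint_law (q S) (\<lambda>z. snd z S) \<Otimes>\<^sub>M distr joint_law (dec_space l D S) B)
    (distr joint_law (q S \<Otimes>\<^sub>M dec_space l D S) (\<lambda>z. (snd z S, B z)))"
proof (rule absolutely_continuous_coordinate[where Z="\<lambda>z. z" and I="set vs" and P=P and q=q and S=S])
  show "S \<in> set vs" using S_in D_subset DS_subset[OF l_less] by auto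
  show "ignores (\<lambda>u. B (a, u)) S" for a
    using S_in by (auto simp: B_def ignores_def dec_args_def not_in_predecessors simp del: restrict_apply)
  show "B \<in> measurable (P \<Otimes>\<^sub>M PiM (set vs) q) (dec_space l D S)"
    using dec_args_joint_measurable[OF l_less D_subset] by (simp add: B_def indep_law_def[symmetric])
  show "absolutely_continuous (P \<Otimes>\<^sub>M PiM (set vs) q) (distr joint_law (P \<Otimes>\<^sub>M PiM (set vs) q) (\<lambda>z. z))"
    using absolutely_continuous_joint_law by (simp add: distr_id2 sets_joint_law indep_law_def[symmetric])
qed (simp_all add: prob_space_P prob_space_q prob_space_joint_law indep_law_def[symmetric])

lemma ln_mean_ge_dec_density:
  assumes l_less: "l < m" and D_props: "D \<subseteq> DS l" "D \<noteq> {}"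
  shows "ln_mean_ge joint_law (\<lambda>z. \<Prod>S\<in>D. dec_density l D S (snd (fst z) l) (restrict (snd z) (DS l))) (\<Sum>S\<in>D. R' S)"
proof -
  let ?B = "\<lambda>S z. dec_args l D S (snd (fst z) l) (restrict (snd z) (DS l))"
  note B_measurable = dec_args_joint_measurable[OF l_less D_props(1)]
  have U_measurable: "(\<lambda>z. snd z S) \<in> measurable indep_law (q S)" if "S \<in> D" for S
    using that D_props DS_subset[OF l_less]
    by (intro measurable_compose[OF snd_indep_law measurable_component_singleton]) auto
  have U_XYU: "(\<lambda>\<omega>. snd (XYU \<omega>) S) = U S" if "S \<in> D" for S
    using that D_props DS_subset[OF l_less] by (auto simp: XYU_def)
  have B_XYU: "(\<lambda>\<omega>. ?B S (XYU \<omega>)) = dec_side l D S" for S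
    using dec_args_XYU[OF l_less D_props(1)] by (simp add: fun_eq_iff)
  have "ereal (\<Sum>S\<in>D. R' S) \<le> (\<Sum>S\<in>D. mutual_info M (q S) (dec_space l D S) (U S) (dec_side l D S))"
    using dec_mutual_info_ge[OF l_less D_props] unfolding dec_space_def dec_side_def[abs_def] .
  then have "ereal (\<Sum>S\<in>D. R' S) \<le> (\<Sum>S\<in>D. mutual_info joint_law (q S) (dec_space l D S) (\<lambda>z. snd z S) (?B S))"
    by (simp add: joint_law_eq_distr mutual_info_distr[OF XYU_measurable U_measurable B_measurable] U_XYU B_XYU
        cong: sum.cong)
  then have "ln_mean_ge joint_law (\<lambda>z. \<Prod>S\<in>D. info_density joint_law (q S) (dec_space l D S) (\<lambda>z. snd z S) (?B S)
      (snd z S, ?B S z)) (\<Sum>S\<in>D. R' S)"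
    using finite_subset[OF D_props(1) finite_DS[OF l_less]] D_props U_measurable B_measurable
    by (intro ln_mean_ge_prod_info_density[OF prob_space_joint_law] absolutely_continuous_dec[OF l_less D_props(1)]) simp_all
  then show ?thesis
    using subsetD[OF D_props(1)]
    by (simp add: joint_law_eq_distr info_density_distr[OF XYU_measurable U_measurable B_measurable] U_XYU B_XYU
        dec_density_def cong: prod.cong)
qed

lemma X_coordinate_measurable[measurable]: "e < k \<Longrightarrow> (\<lambda>\<omega>. X \<omega> e) \<in> borel_measurable M"
  using measurable_compose[OF X_measurable, of "\<lambda>x. x e" borel] by (simp add: vecM_def)

lemma side_information_measurable:
  "i < m \<Longrightarrow> (\<lambda>\<omega>. (\<lambda>S\<in>DS i. U S \<omega>, Y \<omega> i)) \<in> measurable M (PiM (DS i) q \<Otimes>\<^sub>M vecM (kY i))"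
  by (intro measurable_Pair U_restrict_measurable DS_subset measurable_compose[OF Y_measurable YM_component])

lemma estimator_exists:
  assumes i_less: "i < m" and e_less: "e < k"
  shows "\<exists>\<psi>\<in>borel_measurable (PiM (DS i) q \<Otimes>\<^sub>M vecM (kY i)).
    (\<integral>\<^sup>+\<omega>. ennreal ((X \<omega> e - \<psi> (\<lambda>S\<in>DS i. U S \<omega>, Y \<omega> i))\<^sup>2) \<partial>M) \<le> ennreal (\<Delta> i e)"
proof -
  let ?B = "\<lambda>\<omega>. (\<lambda>S\<in>DS i. U S \<omega>, Y \<omega> i)" and ?N = "PiM (DS i) q \<Otimes>\<^sub>M vecM (kY i)"
  let ?E = "real_cond_exp M (vimage_algebra (space M) ?B ?N) (\<lambda>\<omega>. X \<omega> e)"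
  have "?B \<in> space M \<rightarrow> space ?N" using measurable_space[OF side_information_measurable[OF i_less]] by blast
  from doob_dynkin[OF borel_measurable_cond_exp this]
  obtain \<psi> where \<psi>_measurable: "\<psi> \<in> borel_measurable ?N" and E_eq: "\<forall>\<omega>\<in>space M. ?E \<omega> = \<psi> (?B \<omega>)" by (rule bexE)
  have "(\<integral>\<^sup>+\<omega>. ennreal ((X \<omega> e - \<psi> (?B \<omega>))\<^sup>2) \<partial>M) = (\<integral>\<^sup>+\<omega>. ennreal ((X \<omega> e - ?E \<omega>)\<^sup>2) \<partial>M)"
    by (intro nn_integral_cong) (simp add: E_eq)
  also have "\<dots> \<le> ennreal (\<Delta> i e)" by (rule mmse_le[OF i_less e_less])
  finally show ?thesis using \<psi>_measurable by (rule bexI)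
qed

lemma eventually_clip_estimator:
  assumes i_less: "i < m" and e_less: "e < k" and \<psi>_measurable: "\<psi> \<in> borel_measurable (PiM (DS i) q \<Otimes>\<^sub>M vecM (kY i))"
    and error: "(\<integral>\<^sup>+\<omega>. ennreal ((X \<omega> e - \<psi> (\<lambda>S\<in>DS i. U S \<omega>, Y \<omega> i))\<^sup>2) \<partial>M) \<le> ennreal (\<Delta> i e)" and "\<epsilon> > 0"
  shows "\<forall>\<^sub>F b in at_top. integrable M (\<lambda>\<omega>. (X \<omega> e - clip b (\<psi> (\<lambda>S\<in>DS i. U S \<omega>, Y \<omega> i)))\<^sup>2) \<and>
    (\<integral>\<omega>. (X \<omega> e - clip b (\<psi> (\<lambda>S\<in>DS i. U S \<omega>, Y \<omega> i)))\<^sup>2 \<partial>M) \<le> \<Delta> i e + \<epsilon>"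
proof -
  let ?\<psi> = "\<lambda>\<omega>. \<psi> (\<lambda>S\<in>DS i. U S \<omega>, Y \<omega> i)"
  have X_e_measurable[measurable]: "(\<lambda>\<omega>. X \<omega> e) \<in> borel_measurable M" using e_less by simp
  have \<psi>_M[measurable]: "?\<psi> \<in> borel_measurable M"
    by (rule measurable_compose[OF side_information_measurable[OF i_less] \<psi>_measurable])
  have int: "integrable M (\<lambda>\<omega>. (X \<omega> e - ?\<psi> \<omega>)\<^sup>2)"
    by (rule integrableI_nonneg) (use error in \<open>auto intro: le_less_trans\<close>)
  then have "(\<integral>\<omega>. (X \<omega> e - ?\<psi> \<omega>)\<^sup>2 \<partial>M) \<le> \<Delta> i e"
    using error \<Delta>_nonneg[OF i_less e_less] by (subst (asm) nn_integral_eq_integral) auto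
  then have mean_less: "(\<integral>\<omega>. (X \<omega> e - ?\<psi> \<omega>)\<^sup>2 \<partial>M) < \<Delta> i e + \<epsilon>"
    using \<open>\<epsilon> > 0\<close> by simp
  note clip_tendsto = integral_power2_diff_clip_tendsto[OF X_e_measurable \<psi>_M X_square_integrable[OF e_less] int]
  from order_tendstoD(2)[OF clip_tendsto(2) mean_less] clip_tendsto(1)
  show ?thesis by eventually_elim simp
qed

lemma bounded_estimators_exist:
  assumes "\<epsilon> > 0"
  shows "\<exists>\<phi> b. (\<forall>i e z. \<bar>\<phi> i e z\<bar> \<le> b) \<and> (\<forall>i<m. \<forall>e<k. \<phi> i e \<in> borel_measurable (PiM (DS i) q \<Otimes>\<^sub>M vecM (kY i)) \<and>
    integrable M (\<lambda>\<omega>. (X \<omega> e - \<phi> i e (\<lambda>S\<in>DS i. U S \<omega>, Y \<omega> i))\<^sup>2) \<and>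
    (\<integral>\<omega>. (X \<omega> e - \<phi> i e (\<lambda>S\<in>DS i. U S \<omega>, Y \<omega> i))\<^sup>2 \<partial>M) \<le> \<Delta> i e + \<epsilon>)"
proof -
  have "\<forall>i e. \<exists>\<psi>. i < m \<longrightarrow> e < k \<longrightarrow> \<psi> \<in> borel_measurable (PiM (DS i) q \<Otimes>\<^sub>M vecM (kY i)) \<and>
      (\<integral>\<^sup>+\<omega>. ennreal ((X \<omega> e - \<psi> (\<lambda>S\<in>DS i. U S \<omega>, Y \<omega> i))\<^sup>2) \<partial>M) \<le> ennreal (\<Delta> i e)"
    using estimator_exists by blast
  then have "\<exists>\<psi>. \<forall>i e. i < m \<longrightarrow> e < k \<longrightarrow> \<psi> i e \<in> borel_measurable (PiM (DS i) q \<Otimes>\<^sub>M vecM (kY i)) \<and>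
      (\<integral>\<^sup>+\<omega>. ennreal ((X \<omega> e - \<psi> i e (\<lambda>S\<in>DS i. U S \<omega>, Y \<omega> i))\<^sup>2) \<partial>M) \<le> ennreal (\<Delta> i e)"
    by (simp only: choice_iff)
  then obtain \<psi> where \<psi>_measurable: "\<And>i e. i < m \<Longrightarrow> e < k \<Longrightarrow> \<psi> i e \<in> borel_measurable (PiM (DS i) q \<Otimes>\<^sub>M vecM (kY i))"
    and error: "\<And>i e. i < m \<Longrightarrow> e < k \<Longrightarrow>
      (\<integral>\<^sup>+\<omega>. ennreal ((X \<omega> e - \<psi> i e (\<lambda>S\<in>DS i. U S \<omega>, Y \<omega> i))\<^sup>2) \<partial>M) \<le> ennreal (\<Delta> i e)"
    by auto
  have "\<forall>\<^sub>F b in at_top. b \<ge> 0 \<and> (\<forall>i\<in>{..<m}. \<forall>e\<in>{..<k}.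
      integrable M (\<lambda>\<omega>. (X \<omega> e - clip b (\<psi> i e (\<lambda>S\<in>DS i. U S \<omega>, Y \<omega> i)))\<^sup>2) \<and>
      (\<integral>\<omega>. (X \<omega> e - clip b (\<psi> i e (\<lambda>S\<in>DS i. U S \<omega>, Y \<omega> i)))\<^sup>2 \<partial>M) \<le> \<Delta> i e + \<epsilon>)"
    using assms
    by (intro eventually_conj eventually_ge_at_top eventually_ball_finite ballI eventually_clip_estimator
        \<psi>_measurable error) auto
  from eventually_happens'[OF trivial_limit_at_top_linorder this] obtain b :: real where b_nonneg: "b \<ge> 0"
    and clip: "\<And>i e. i < m \<Longrightarrow> e < k \<Longrightarrow> integrable M (\<lambda>\<omega>. (X \<omega> e - clip b (\<psi> i e (\<lambda>S\<in>DS i. U S \<omega>, Y \<omega> i)))\<^sup>2) \<and>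
      (\<integral>\<omega>. (X \<omega> e - clip b (\<psi> i e (\<lambda>S\<in>DS i. U S \<omega>, Y \<omega> i)))\<^sup>2 \<partial>M) \<le> \<Delta> i e + \<epsilon>"
    by auto
  show ?thesis
    using clip abs_clip_le[OF b_nonneg] borel_measurable_clip[OF \<psi>_measurable]
    by (intro exI[of _ "\<lambda>i e z. clip b (\<psi> i e z)"] exI[of _ b]) simp
qed

lemma XYU_side_information: "i < m \<Longrightarrow> (restrict (snd (XYU \<omega>)) (DS i), snd (fst (XYU \<omega>)) i) = (\<lambda>S\<in>DS i. U S \<omega>, Y \<omega> i)"
  using DS_subset[of i] by (auto simp: XYU_def restrict_def fun_eq_iff)

lemma square_error_measurable:
  assumes i_less: "i < m" and e_less: "e < k" and \<phi>_measurable: "\<phi> \<in> borel_measurable (PiM (DS i) q \<Otimes>\<^sub>M vecM (kY i))"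
  shows "(\<lambda>z. (fst (fst z) e - \<phi> (restrict (snd z) (DS i), snd (fst z) i))\<^sup>2) \<in> borel_measurable indep_law"
proof -
  have [measurable]: "(\<lambda>z. fst (fst z) e) \<in> borel_measurable indep_law"
    using e_less by (intro measurable_compose[OF measurable_compose[OF fst_indep_law px_measurable]])
      (simp add: vecM_def)
  have "(\<lambda>z. (restrict (snd z) (DS i), snd (fst z) i)) \<in> measurable indep_law (PiM (DS i) q \<Otimes>\<^sub>M vecM (kY i))"
    using i_less by (intro measurable_Pair measurable_compose[OF fst_indep_law py_measurable]
        measurable_compose[OF snd_indep_law measurable_restrict_subset] DS_subset)
  from measurable_compose[OF this \<phi>_measurable] show ?thesis by measurable
qed

lemma mse_achievable_sum_rate: "mse_achievable m k kY P \<Delta> (\<Sum>S\<in>set vs. R S)"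
proof (rule mse_achievable_limit)
  fix \<epsilon> :: real assume "\<epsilon> > 0"
  from bounded_estimators_exist[OF this] obtain \<phi> b where bound: "\<forall>i e z. \<bar>\<phi> i e z\<bar> \<le> b"
    and estimators: "\<forall>i<m. \<forall>e<k. \<phi> i e \<in> borel_measurable (PiM (DS i) q \<Otimes>\<^sub>M vecM (kY i)) \<and>
      integrable M (\<lambda>\<omega>. (X \<omega> e - \<phi> i e (\<lambda>S\<in>DS i. U S \<omega>, Y \<omega> i))\<^sup>2) \<and>
      (\<integral>\<omega>. (X \<omega> e - \<phi> i e (\<lambda>S\<in>DS i. U S \<omega>, Y \<omega> i))\<^sup>2 \<partial>M) \<le> \<Delta> i e + \<epsilon>"
    by (elim exE conjE)
  then have \<phi>_measurable: "\<phi> i e \<in> borel_measurable (PiM (DS i) q \<Otimes>\<^sub>M vecM (kY i))" if "i < m" "e < k" for i e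
    using that by simp
  have fst_XYU: "fst (fst (XYU \<omega>)) = X \<omega>" for \<omega> by (simp add: XYU_def)
  have coordinate: "(\<lambda>x. x e) \<in> borel_measurable (vecM k)" if "e < k" for e using that by (simp add: vecM_def)
  interpret block_source P k q vs enc_density m DS kY dec_density R R' \<phi> b "\<lambda>i e. \<Delta> i e + \<epsilon>"
  proof (intro block_source.intro block_source_axioms.intro codebook_densities_axioms)
    fix i e assume ie_less: "i < m" "e < k"
    note error_measurable = square_error_measurable[OF ie_less \<phi>_measurable[OF ie_less]]
    show "integrable joint_law (\<lambda>z. (fst (fst z) e - \<phi> i e (restrict (snd z) (DS i), snd (fst z) i))\<^sup>2)"
      using estimators ie_less
      by (simp only: integrable_joint_law_iff[OF error_measurable] fst_XYU XYU_side_information[OF ie_less(1)])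
    show "(\<integral>z. (fst (fst z) e - \<phi> i e (restrict (snd z) (DS i), snd (fst z) i))\<^sup>2 \<partial>joint_law) \<le> \<Delta> i e + \<epsilon>"
      using estimators ie_less
      by (simp only: integral_joint_law[OF error_measurable] fst_XYU XYU_side_information[OF ie_less(1)])
  next
    fix e assume e_less: "e < k"
    show fst_P: "(\<lambda>z. fst z e) \<in> borel_measurable P"
      by (rule measurable_compose[OF px_measurable coordinate[OF e_less]])
    show "integrable P (\<lambda>z. (fst z e)\<^sup>2)"
      using fst_P X_square_integrable[OF e_less] by (subst integrable_distr_eq) auto
  qed (fact prob_space_joint_law R_nonneg integrable_ln_enc_density integral_ln_enc_density_le
      ln_mean_ge_dec_density \<phi>_measurable bound[rule_format])+
  show "mse_achievable m k kY P (\<lambda>i e. \<Delta> i e + \<epsilon>) (\<Sum>S\<in>set vs. R S)"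
    by (rule mse_achievable_sum_rate)
qed

end

section \<open>Gaussian sources\<close>

lemma before_eq_predecessors:
  assumes distinct_vs: "distinct vs" and S_in: "S \<in> set vs"
  shows "before vs S = predecessors vs S"
proof -
  obtain ys zs where vs_eq: "vs = ys @ S # zs" using split_list[OF S_in] by blast
  have "vs ! j = S \<longleftrightarrow> j = length ys" if "j < length vs" for j
    using nth_eq_iff_index_eq[OF distinct_vs that, of "length ys"] vs_eq by simp
  then have "before vs S = {vs ! i |i. i < length ys}" unfolding before_def using vs_eq by fastforce
  also have "\<dots> = set ys" unfolding set_conv_nth by (auto simp: vs_eq nth_append)
  also have "\<dots> = predecessors vs S" using predecessors_split[of S ys zs] distinct_vs by (simp add: vs_eq)
  finally show ?thesis .
qed

lemma markov_chain_cong_sets: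
  "sets SU = sets SU' \<Longrightarrow> markov_chain M SU U SX X SY Y \<longleftrightarrow> markov_chain M SU' U SX X SY Y"
  by (simp add: markov_chain_def)

lemma gauss_rv_square_integrable:
  assumes "prob_space M" and W_gauss: "gauss_rv M W"
  shows "integrable M (\<lambda>\<omega>. (W \<omega>)\<^sup>2)"
proof -
  interpret prob_space M by fact
  have [measurable]: "W \<in> borel_measurable M" using W_gauss by (simp add: gauss_rv_def)
  from W_gauss obtain \<mu> where "(AE \<omega> in M. W \<omega> = \<mu>) \<or> (\<exists>\<sigma>>0. distributed M lborel W (normal_density \<mu> \<sigma>))"
    by (auto simp: gauss_rv_def)
  then consider (degenerate) "AE \<omega> in M. W \<omega> = \<mu>"
    | (normal) \<sigma> where "\<sigma> > 0" "distributed M lborel W (normal_density \<mu> \<sigma>)" by blast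
  then show ?thesis
  proof cases
    case degenerate
    then have "AE \<omega> in M. norm ((W \<omega>)\<^sup>2) \<le> \<mu>\<^sup>2" by eventually_elim simp
    then show ?thesis by (intro integrable_const_bound) auto
  next
    case (normal \<sigma>)
    have expand: "(\<lambda>x. normal_density \<mu> \<sigma> x * x\<^sup>2) = (\<lambda>x. normal_density \<mu> \<sigma> x * (x - \<mu>) ^ 2
        + 2 * \<mu> * (normal_density \<mu> \<sigma> x * (x - \<mu>) ^ 1) + \<mu>\<^sup>2 * normal_density \<mu> \<sigma> x)"
      by (auto simp: power2_eq_square algebra_simps)
    have "integrable lborel (\<lambda>x. normal_density \<mu> \<sigma> x * x\<^sup>2)"
      unfolding expand
      by (intro Bochner_Integration.integrable_add integrable_mult_right
          integrable_normal_moment[OF normal(1)] integrable_normal_density[OF normal(1)])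
    then show ?thesis using distributed_integrable[OF normal(2), of "\<lambda>x. x\<^sup>2"] by simp
  qed
qed

lemma jgauss_imp_gauss_rv:
  assumes W_jgauss: "jgauss M I W" and i_in: "i \<in> I"
  shows "gauss_rv M (W i)"
proof -
  have "gauss_rv M (\<lambda>\<omega>. \<Sum>j\<in>I. of_bool (j = i) * W j \<omega>)"
    using W_jgauss[unfolded jgauss_def, THEN conjunct2, THEN conjunct2] by (rule spec)
  moreover have "(\<Sum>j\<in>I. of_bool (j = i) * W j \<omega>) = W i \<omega>" for \<omega>
    using W_jgauss i_in by (simp add: jgauss_def of_bool_def if_distrib[of "\<lambda>b. b * _"] sum.delta cong: if_cong)
  ultimately show ?thesis by simp
qed

lemma gaussian_source_square_integrable:
  assumes "gaussian_source m k kY P" and "e < k"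
  shows "integrable P (\<lambda>z. (fst z e)\<^sup>2)"
proof -
  have "gauss_rv P (source_val (XC e))"
    using assms by (intro jgauss_imp_gauss_rv) (auto simp: gaussian_source_def source_coords_def)
  then show ?thesis
    using gauss_rv_square_integrable[of P "source_val (XC e)"] assms by (simp add: gaussian_source_def)
qed

lemma Uval_measurable:
  assumes T_in_range: "T \<in> measurable M (count_space UNIV)" "\<And>\<omega>. \<omega> \<in> space M \<Longrightarrow> T \<omega> \<in> {1..\<tau>}"
    and Uf_measurable: "\<And>t. t \<in> {1..\<tau>} \<Longrightarrow> Uf S t \<in> measurable M (vecM d)"
  shows "Uval Uf T S \<in> measurable M (UM d)"
proof -
  have "(\<lambda>\<omega>. Uf S (T \<omega>) \<omega>) \<in> measurable M (vecM d)"
  proof (rule measurable_compose_countable'[OF Uf_measurable])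
    show "T \<in> measurable M (count_space {1..\<tau>})" 
      using T_in_range by (simp add: measurable_count_space_eq2)
  qed simp_all
  then show ?thesis unfolding UM_def Uval_def[abs_def] using T_in_range(1) by (rule measurable_Pair)
qed

locale gaussian_scheme =
  fixes m k kY P D vs M X Y T \<tau> dU Uf R R'
  assumes source: "gaussian_source m k kY P" and distortion_pos: "\<And>i e. i < m \<Longrightarrow> e < k \<Longrightarrow> D i e > 0"
    and ordering: "vs \<in> orderings m" and CG: "CG m k kY P D M X Y T \<tau> dU Uf"
    and LP: "LP m k kY vs M X Y T dU Uf R R'"
begin

definition aux_law :: "nat set \<Rightarrow> ((nat \<Rightarrow> real) \<times> nat) measure" where
  "aux_law S = (if S \<in> subsets m then distr M (UM (dU S)) (Uval Uf T S) else return (count_space UNIV) undefined)"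

lemma set_vs: "set vs = subsets m" and distinct_vs: "distinct vs"
  using ordering by (simp_all add: orderings_def)

lemma
  shows prob_space_M: "prob_space M" and X_measurable: "X \<in> measurable M (vecM k)"
    and Y_measurable: "Y \<in> measurable M (YM m kY)" and distr_XY: "distr M (XYM m k kY) (\<lambda>\<omega>. (X \<omega>, Y \<omega>)) = P"
    and T_measurable: "T \<in> measurable M (count_space UNIV)" and T_range: "\<And>\<omega>. \<omega> \<in> space M \<Longrightarrow> T \<omega> \<in> {1..\<tau>}"
    and Uf_measurable: "\<And>S t. S \<in> subsets m \<Longrightarrow> t \<in> {1..\<tau>} \<Longrightarrow> Uf S t \<in> measurable M (vecM (dU S))"
  using CG by (simp_all only: CG_def)

lemma aux_measurable: "S \<in> subsets m \<Longrightarrow> Uval Uf T S \<in> measurable M (UM (dU S))"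
  by (rule Uval_measurable[OF T_measurable T_range Uf_measurable])

lemma sets_aux_law: "S \<in> subsets m \<Longrightarrow> sets (aux_law S) = sets (UM (dU S))"
  by (simp add: aux_law_def)

lemma sets_PiM_aux_law: "A \<subseteq> subsets m \<Longrightarrow> sets (PiM A aux_law) = sets (UcollM dU A)"
  unfolding UcollM_def by (rule sets_PiM_cong) (auto simp: sets_aux_law)

lemma Ucoll_eq: "Ucoll Uf T A = (\<lambda>\<omega>. \<lambda>S\<in>A. Uval Uf T S \<omega>)"
  by (simp add: Ucoll_def fun_eq_iff)

lemma Dl_subset: "Dl m l \<subseteq> subsets m"
  by (auto simp: Dl_def)

lemma before_eq: "S \<in> subsets m \<Longrightarrow> before vs S = predecessors vs S"
  by (rule before_eq_predecessors) (simp_all add: distinct_vs set_vs)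

lemma predecessors_subsets: "predecessors vs S \<subseteq> subsets m"
  using predecessors_subset[of vs S] by (simp add: set_vs)

lemma enc_mutual_info_le:
  assumes S_in: "S \<in> subsets m"
  shows "mutual_info M (vecM k \<Otimes>\<^sub>M PiM (predecessors vs S) aux_law) (aux_law S)
    (\<lambda>\<omega>. (X \<omega>, \<lambda>S'\<in>predecessors vs S. Uval Uf T S' \<omega>)) (Uval Uf T S) \<le> ereal (R S + R' S)"
proof -
  have "mutual_info M (vecM k \<Otimes>\<^sub>M UcollM dU (predecessors vs S)) (UM (dU S))
      (\<lambda>\<omega>. (X \<omega>, \<lambda>S'\<in>predecessors vs S. Uval Uf T S' \<omega>)) (Uval Uf T S) - ereal (R' S) \<le> ereal (R S)"
    using LP[unfolded LP_def, THEN conjunct2, THEN conjunct1, THEN bspec, OF S_in]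
    unfolding Ucoll_eq before_eq[OF S_in] .
  then have "mutual_info M (vecM k \<Otimes>\<^sub>M UcollM dU (predecessors vs S)) (UM (dU S))
      (\<lambda>\<omega>. (X \<omega>, \<lambda>S'\<in>predecessors vs S. Uval Uf T S' \<omega>)) (Uval Uf T S) \<le> ereal (R S + R' S)"
    by (simp add: ereal_minus_le_iff add.commute)
  also have "mutual_info M (vecM k \<Otimes>\<^sub>M UcollM dU (predecessors vs S)) (UM (dU S))
      (\<lambda>\<omega>. (X \<omega>, \<lambda>S'\<in>predecessors vs S. Uval Uf T S' \<omega>)) (Uval Uf T S)
    = mutual_info M (vecM k \<Otimes>\<^sub>M PiM (predecessors vs S) aux_law) (aux_law S)
      (\<lambda>\<omega>. (X \<omega>, \<lambda>S'\<in>predecessors vs S. Uval Uf T S' \<omega>)) (Uval Uf T S)"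
    by (intro mutual_info_cong_sets sets_pair_measure_cong refl)
      (simp_all add: S_in sets_aux_law sets_PiM_aux_law predecessors_subsets)
  finally show ?thesis .
qed

lemma dec_mutual_info_ge:
  assumes l_less: "l < m" and D'_subset: "D' \<subseteq> Dl m l" "D' \<noteq> {}"
  shows "ereal (\<Sum>S\<in>D'. R' S) \<le> (\<Sum>S\<in>D'. mutual_info M (aux_law S)
    (PiM (predecessors vs S \<inter> D') aux_law \<Otimes>\<^sub>M PiM (Dl m l - D') aux_law \<Otimes>\<^sub>M vecM (kY l)) (Uval Uf T S)
    (\<lambda>\<omega>. (\<lambda>S'\<in>predecessors vs S \<inter> D'. Uval Uf T S' \<omega>, \<lambda>S'\<in>Dl m l - D'. Uval Uf T S' \<omega>, Y \<omega> l)))"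
proof -
  have "ereal (\<Sum>S\<in>D'. R' S) \<le> (\<Sum>S\<in>D'. mutual_info M (UM (dU S))
      (UcollM dU (before vs S \<inter> D') \<Otimes>\<^sub>M UcollM dU (Dl m l - D') \<Otimes>\<^sub>M vecM (kY l)) (Uval Uf T S)
      (\<lambda>\<omega>. (Ucoll Uf T (before vs S \<inter> D') \<omega>, Ucoll Uf T (Dl m l - D') \<omega>, Y \<omega> l)))"
    using LP l_less D'_subset unfolding LP_def by blast
  also have "\<dots> = (\<Sum>S\<in>D'. mutual_info M (aux_law S)
    (PiM (predecessors vs S \<inter> D') aux_law \<Otimes>\<^sub>M PiM (Dl m l - D') aux_law \<Otimes>\<^sub>M vecM (kY l)) (Uval Uf T S)
    (\<lambda>\<omega>. (\<lambda>S'\<in>predecessors vs S \<inter> D'. Uval Uf T S' \<omega>, \<lambda>S'\<in>Dl m l - D'. Uval Uf T S' \<omega>, Y \<omega> l)))"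
  proof (rule sum.cong[OF refl])
    fix S assume "S \<in> D'"
    then have S_in: "S \<in> subsets m" using D'_subset(1) Dl_subset by blast
    have sub: "predecessors vs S \<inter> D' \<subseteq> subsets m" "Dl m l - D' \<subseteq> subsets m"
      using predecessors_subsets Dl_subset by blast+
    show "mutual_info M (UM (dU S))
      (UcollM dU (before vs S \<inter> D') \<Otimes>\<^sub>M UcollM dU (Dl m l - D') \<Otimes>\<^sub>M vecM (kY l)) (Uval Uf T S)
      (\<lambda>\<omega>. (Ucoll Uf T (before vs S \<inter> D') \<omega>, Ucoll Uf T (Dl m l - D') \<omega>, Y \<omega> l)) = mutual_info M (aux_law S)
      (PiM (predecessors vs S \<inter> D') aux_law \<Otimes>\<^sub>M PiM (Dl m l - D') aux_law \<Otimes>\<^sub>M vecM (kY l)) (Uval Uf T S)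
      (\<lambda>\<omega>. (\<lambda>S'\<in>predecessors vs S \<inter> D'. Uval Uf T S' \<omega>, \<lambda>S'\<in>Dl m l - D'. Uval Uf T S' \<omega>, Y \<omega> l))"
      unfolding Ucoll_eq before_eq[OF S_in]
      by (intro mutual_info_cong_sets sets_pair_measure_cong refl)
        (simp_all add: S_in sub sets_aux_law sets_PiM_aux_law)
  qed
  finally show ?thesis .
qed

lemma X_square_integrable:
  assumes "e < k" shows "integrable M (\<lambda>\<omega>. (X \<omega> e)\<^sup>2)"
proof -
  have XY_measurable: "(\<lambda>\<omega>. (X \<omega>, Y \<omega>)) \<in> measurable M (XYM m k kY)"
    unfolding XYM_def by (intro measurable_Pair X_measurable Y_measurable)
  have int: "integrable P (\<lambda>z. (fst z e)\<^sup>2)" by (rule gaussian_source_square_integrable[OF source assms])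
  then have "(\<lambda>z. (fst z e)\<^sup>2) \<in> borel_measurable (XYM m k kY)"
    by (auto simp: distr_XY[symmetric])
  from integrable_distr_eq[OF XY_measurable this] int show ?thesis by (simp add: distr_XY)
qed

lemma mmse_le:
  assumes "i < m" "e < k"
  shows "(\<integral>\<^sup>+\<omega>. ennreal ((X \<omega> e - real_cond_exp M (vimage_algebra (space M) (\<lambda>\<omega>. (\<lambda>S\<in>Dl m i. Uval Uf T S \<omega>, Y \<omega> i))
      (PiM (Dl m i) aux_law \<Otimes>\<^sub>M vecM (kY i))) (\<lambda>\<omega>. X \<omega> e) \<omega>)\<^sup>2) \<partial>M) \<le> ennreal (D i e)"
proof -
  have "vimage_algebra (space M) (\<lambda>\<omega>. (\<lambda>S\<in>Dl m i. Uval Uf T S \<omega>, Y \<omega> i)) (PiM (Dl m i) aux_law \<Otimes>\<^sub>M vecM (kY i))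
    = vimage_algebra (space M) (\<lambda>\<omega>. (Ucoll Uf T (Dl m i) \<omega>, Y \<omega> i)) (UcollM dU (Dl m i) \<Otimes>\<^sub>M vecM (kY i))"
    unfolding Ucoll_eq by (intro vimage_algebra_cong refl sets_pair_measure_cong sets_PiM_aux_law Dl_subset)
  then show ?thesis using CG assms by (simp only: CG_def)
qed

sublocale test_channel M m k kY X Y "Uval Uf T" aux_law vs "Dl m" D R R'
proof (intro test_channel.intro test_channel_axioms.intro prob_space_M X_measurable Y_measurable distinct_vs
    X_square_integrable mmse_le dec_mutual_info_ge)
  show "prob_space (aux_law S)" for S
    using prob_space.prob_space_distr[OF prob_space_M aux_measurable]
    by (auto simp: aux_law_def intro: prob_space_return)
  show "markov_chain M (PiM (set vs) aux_law) (\<lambda>\<omega>. \<lambda>S\<in>set vs. Uval Uf T S \<omega>) (vecM k) X (YM m kY) Y"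
  proof -
    have "markov_chain M (UcollM dU (subsets m)) (Ucoll Uf T (subsets m)) (vecM k) X (YM m kY) Y"
      using CG by (simp only: CG_def)
    then show ?thesis
      unfolding set_vs markov_chain_cong_sets[OF sets_PiM_aux_law[OF subset_refl]] Ucoll_eq .
  qed
  fix S assume "S \<in> set vs"
  then have S_in: "S \<in> subsets m" by (simp add: set_vs)
  then show "Uval Uf T S \<in> measurable M (aux_law S)"
    using aux_measurable by (simp add: aux_law_def)
  show "distr M (aux_law S) (Uval Uf T S) = aux_law S"
    using S_in by (simp add: aux_law_def cong: distr_cong)
  show "R S \<ge> 0" using LP S_in by (simp add: LP_def)
  show "mutual_info M (vecM k \<Otimes>\<^sub>M PiM (predecessors vs S) aux_law) (aux_law S)
    (\<lambda>\<omega>. (X \<omega>, \<lambda>S'\<in>predecessors vs S. Uval Uf T S' \<omega>)) (Uval Uf T S) \<le> ereal (R S + R' S)"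
    by (rule enc_mutual_info_le[OF S_in])
next
  show "Dl m l \<subseteq> set vs" for l by (simp add: set_vs Dl_subset)
  show "D i e \<ge> 0" if "i < m" "e < k" for i e using distortion_pos[OF that] by simp
qed

end

theorem theorem2:
  fixes m k :: nat and kY :: "nat \<Rightarrow> nat"
    and P :: "((nat \<Rightarrow> real) \<times> (nat \<Rightarrow> nat \<Rightarrow> real)) measure"
    and D :: "nat \<Rightarrow> nat \<Rightarrow> real"
  assumes "m \<ge> 1" and "k \<ge> 1" and "\<forall>i<m. kY i \<ge> 1"
    and "gaussian_source m k kY P"
    and "\<forall>i<m. \<forall>c<k. D i c > 0"
  shows "R_MSE m k kY P D \<le> R_G_ach m k kY P D"
proof -
  have "R_MSE m k kY P D \<le> ereal (\<Sum>S\<in>subsets m. R S)"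
    if "vs \<in> orderings m" "CG m k kY P D M X Y T \<tau> dU Uf" "LP m k kY vs M X Y T dU Uf R R'"
    for vs M X Y T \<tau> dU Uf R R'
  proof -
    interpret gaussian_scheme m k kY P D vs M X Y T \<tau> dU Uf R R'
      by unfold_locales (use assms that in auto)
    have "mse_achievable m k kY P D (\<Sum>S\<in>subsets m. R S)"
      using mse_achievable_sum_rate by (simp add: distr_XY set_vs)
    then show ?thesis unfolding R_MSE_def by (intro Inf_lower) blast
  qed
  then show ?thesis
    unfolding R_G_ach_def by (intro INF_greatest Inf_greatest) (auto intro!: Inf_greatest)
qed

end
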